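(* Let $n\ge2$, $j\ge1$, $j\not\equiv0\pmod n$. Let $\gamma(x,t)$ be a solution of the $j$-th central affine curve flow $\gamma_t=gZ_{j,0}(u)e_1$ on $\mathcal{M}_n(\mathbb{R})$, with $g(\cdot,t)$ and $u(\cdot,t)$ the central affine moving frame and curvature of $\gamma(\cdot,t)$. Let $k$ be a non-zero real constant and $d(k)\in GL(n,\mathbb{R})$ a constant matrix with $\det(d(k))=(-1)^nk$. Let $h$ be a (smooth real-valued) solution of the system $(\mathrm{BT})_{u,k}$, and set $$\tilde g(x,t)=d(k)\,g(x,t)\,f_{u,h}(x,t,0)^{-1}.$$ Then $h*\gamma(x,t)=\tilde g(x,t)e_1$ is again a solution of the $j$-th central affine curve flow, and $\tilde g(\cdot,t)$ is the central affine moving frame along $h*\gamma(\cdot,t)$.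
   Context: $\mathcal{M}_n(\mathbb{R})$ is the set of smooth $\gamma:\mathbb{R}\to\mathbb{R}^n\setminus\{0\}$ with $\det(\gamma,\gamma_x,\ldots,\gamma_x^{(n-1)})=1$. For such $\gamma$ the central affine moving frame $g=(\gamma,\ldots,\gamma_x^{(n-1)})$ satisfies $g_x=g(b+u)$ with $b=\sum_{i=1}^{n-1}e_{i+1,i}$ and central affine curvature $u=\sum_{i=1}^{n-1}u_ie_{in}$, where $\gamma_x^{(n)}=u_1\gamma+\cdots+u_{n-1}\gamma_x^{(n-2)}$. $V_n=\bigoplus_{i=1}^{n-1}\mathbb{R}e_{in}$, $e_1=(1,0,\ldots,0)^t$. A solution of the $j$-th central affine curve flow is a smooth $\gamma(x,t)$ with $\gamma(\cdot,t)\in\mathcal{M}_n(\mathbb{R})$ and $\gamma_t=gZ_{j,0}(u)e_1$. Let $J=e_{1n}\lambda+b$. For smooth $V_n$-valued $u$, let $Y(u,\lambda)=e_{1n}\lambda+\sum_{i\le 0}Y_{1,i}(u)\lambda^i$ be the unique formal series with smooth $sl(n)$-valued coefficients satisfying $Y_x+[J+u,Y]=0$ and $Y^n=\lambda I_n$; its coefficients are differential polynomials in $u$. Write $Y^j=\sum_i Y_{j,i}(u)\lambda^i$. There is a unique strictly upper triangular $\zeta_j(u)$ with $[\partial_x+b+u,\,Y_{j,0}(u)-\zeta_j(u)]\in V_n$, where $[\partial_x+A,B]=B_x+[A,B]$. Set $Z_j(u,\lambda)=\sum_{i\ge0}Y_{j,i}(u)\lambda^i-\zeta_j(u)$ and $Z_{j,0}(u)=Z_j(u,0)$.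 Given functions $u_1,\dots,u_{n-1},h$ of $(x,t)$, define $w=(w_1,\ldots,w_n)^t$ by $w_n=1$, $w_{n-1}=-h$, and $w_{i-1}=-(w_i)_x-hw_i-u_i$ for $i=n-1,n-2,\ldots,2$. The system $(\mathrm{BT})_{u,k}$ for $h$ is $$(w_1)_x+h\,w_1+u_1+k=0,\qquad h_t=-\partial_x\big[(Z_j(u,k)\,w)_n\big]$$ (the subscript $n$ is the last component). Set $s_i(u,h)=(w_i)_x-\sum_{m=i+1}^{n}\binom{m-1}{i-1}w_m h_x^{(m-i)}$, $1\le i\le n-1$, and $f_{u,h}=J+hI_n+N(u,h)$ where $N$ is strictly upper triangular with $N_{ij}=\binom{j-1}{i-1}h_x^{(j-i)}$ for $1\le i<j<n$ and $N_{in}=u_i+s_i(u,h)+\binom{n-1}{i-1}h_x^{(n-i)}$ for $1\le i\le n-1$. One writes $h*u$ for $\tilde u=\sum_i(u_i+s_i(u,h))e_{in}$. (For $k\in\mathbb R$ and $h$ a solution, $\det f_{u,h}=(-1)^{n-1}(\lambda-k)$.) *)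

theory Defs
  imports
    "HOL-Analysis.Derivative"
    "HOL-Computational_Algebra.Formal_Laurent_Series"
    "Jordan_Normal_Form.Gauss_Jordan_Elimination"
    "Jordan_Normal_Form.Determinant"
begin

text \<open>
  Conventions. Matrices and vectors are those of \<open>Jordan_Normal_Form\<close>, whose indices start at 0;
  \<open>mat1\<close> and \<open>vec1\<close> build them from formulas with indices \<open>1, \<dots>, n\<close>. Matrix- and
  vector-valued maps are differentiated entrywise. A function of \<open>(x, t)\<close> is a curried map on
  \<open>real\<close> and \<open>real\<close>, used for \<open>t\<close> in an open set \<open>T\<close>; notions that involve only
  the variable \<open>x\<close> are defined for functions of \<open>x\<close> and applied with \<open>t\<close> frozen.
\<close>

subsection \<open>Smooth maps\<close>

text \<open>Meant for open sets \<open>S\<close> of a finite-dimensional space, where continuity of all directional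
  derivatives is continuity of the derivative.\<close>

primrec Ck_on :: "nat \<Rightarrow> 'a::real_normed_vector set \<Rightarrow> ('a \<Rightarrow> 'b::real_normed_vector) \<Rightarrow> bool" where
  "Ck_on 0 S f \<longleftrightarrow> continuous_on S f"
| "Ck_on (Suc k) S f \<longleftrightarrow> (\<forall>p\<in>S. f differentiable (at p)) \<and>
     (\<forall>v. Ck_on k S (\<lambda>p. frechet_derivative f (at p) v))"

definition smooth_on :: "'a::real_normed_vector set \<Rightarrow> ('a \<Rightarrow> 'b::real_normed_vector) \<Rightarrow> bool" where
  "smooth_on S f \<longleftrightarrow> (\<forall>k. Ck_on k S f)"

definition smooth_mat :: "nat \<Rightarrow> (real \<Rightarrow> real mat) \<Rightarrow> bool" where
  "smooth_mat n A \<longleftrightarrow> (\<forall>x. A x \<in> carrier_mat n n) \<and>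
     (\<forall>r<n. \<forall>c<n. smooth_on UNIV (\<lambda>x. A x $$ (r, c)))"

subsection \<open>Matrices\<close>

definition mat1 :: "nat \<Rightarrow> (nat \<Rightarrow> nat \<Rightarrow> 'a) \<Rightarrow> 'a mat" where
  "mat1 n F = mat n n (\<lambda>(r, c). F (Suc r) (Suc c))"

definition vec1 :: "nat \<Rightarrow> (nat \<Rightarrow> 'a) \<Rightarrow> 'a vec" where
  "vec1 n F = vec n (\<lambda>r. F (Suc r))"

definition mat_deriv :: "nat \<Rightarrow> (real \<Rightarrow> real mat) \<Rightarrow> real \<Rightarrow> real mat" where
  "mat_deriv n A x = mat n n (\<lambda>rc. deriv (\<lambda>y. A y $$ rc) x)"

definition commutator :: "'a::ring mat \<Rightarrow> 'a mat \<Rightarrow> 'a mat" where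
  "commutator A B = A * B - B * A"

definition mat_trace :: "'a::comm_monoid_add mat \<Rightarrow> 'a" where
  "mat_trace A = (\<Sum>i<dim_row A. A $$ (i, i))"

definition strictly_upper :: "nat \<Rightarrow> real mat set" where
  "strictly_upper n = {A \<in> carrier_mat n n. \<forall>r<n. \<forall>c\<le>r. A $$ (r, c) = 0}"

definition e_mat :: "nat \<Rightarrow> nat \<Rightarrow> nat \<Rightarrow> 'a::zero_neq_one mat" where
  "e_mat n i j = mat1 n (\<lambda>r c. if r = i \<and> c = j then 1 else 0)"

definition b_mat :: "nat \<Rightarrow> 'a::zero_neq_one mat" where
  "b_mat n = mat1 n (\<lambda>r c. if r = c + 1 then 1 else 0)"

definition J_mat :: "nat \<Rightarrow> 'a::comm_ring_1 \<Rightarrow> 'a mat" where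
  "J_mat n l = l \<cdot>\<^sub>m e_mat n 1 n + b_mat n"

text \<open>The span of the matrix units \<open>e_mat n i n\<close>, \<open>1 \<le> i \<le> n - 1\<close>.\<close>

definition V_space :: "nat \<Rightarrow> real mat set" where
  "V_space n = {mat1 n (\<lambda>r c. if r < n \<and> c = n then a r else 0) | a. True}"

text \<open>The coefficient \<open>u\<^sub>i\<close> of an element \<open>u\<close> of \<open>V_space n\<close>, \<open>1 \<le> i \<le> n - 1\<close>.\<close>

definition ucoeff :: "nat \<Rightarrow> real mat \<Rightarrow> nat \<Rightarrow> real" where
  "ucoeff n u i = u $$ (i - 1, n - 1)"

subsection \<open>Central affine curves\<close>

definition curve_deriv :: "nat \<Rightarrow> nat \<Rightarrow> (real \<Rightarrow> real vec) \<Rightarrow> real \<Rightarrow> real vec" where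
  "curve_deriv n m \<gamma> x = vec n (\<lambda>i. (deriv ^^ m) (\<lambda>y. \<gamma> y $ i) x)"

definition ca_frame :: "nat \<Rightarrow> (real \<Rightarrow> real vec) \<Rightarrow> real \<Rightarrow> real mat" where
  "ca_frame n \<gamma> x = mat_of_cols n (map (\<lambda>m. curve_deriv n m \<gamma> x) [0..<n])"

definition ca_curves :: "nat \<Rightarrow> (real \<Rightarrow> real vec) set" where
  "ca_curves n = {\<gamma>. (\<forall>x. \<gamma> x \<in> carrier_vec n \<and> \<gamma> x \<noteq> 0\<^sub>v n) \<and>
     (\<forall>i<n. smooth_on UNIV (\<lambda>x. \<gamma> x $ i)) \<and>
     (\<forall>x. det (ca_frame n \<gamma> x) = 1)}"

definition ca_curvature :: "nat \<Rightarrow> (real \<Rightarrow> real vec) \<Rightarrow> real \<Rightarrow> real mat" where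
  "ca_curvature n \<gamma> x = (THE u. u \<in> V_space n \<and>
     mat_deriv n (ca_frame n \<gamma>) x = ca_frame n \<gamma> x * (b_mat n + u))"

subsection \<open>The central affine curve flows\<close>

text \<open>A formal series in \<open>\<lambda>\<close> with finitely many positive powers is a formal Laurent series
  in the variable \<open>1/\<lambda>\<close>: thus \<open>\<lambda>\<close> is \<^const>\<open>fls_X_inv\<close>, and the coefficient of
  \<open>\<lambda>^i\<close> is the one with Laurent index \<open>-i\<close>. Matrices of such series stand for series with
  matrix coefficients.\<close>

abbreviation lam :: "real fls" where
  "lam \<equiv> fls_X_inv"

definition lam_coeff :: "int \<Rightarrow> real fls mat \<Rightarrow> real mat" where
  "lam_coeff i A = map_mat (\<lambda>a. fls_nth a (- i)) A"

definition is_Y_series :: "nat \<Rightarrow> (real \<Rightarrow> real mat) \<Rightarrow> (real \<Rightarrow> real fls mat) \<Rightarrow> bool" where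
  "is_Y_series n u Y \<longleftrightarrow>
     (\<forall>i. smooth_mat n (\<lambda>x. lam_coeff i (Y x))) \<and>
     (\<forall>i x. mat_trace (lam_coeff i (Y x)) = 0) \<and>
     (\<forall>x. lam_coeff 1 (Y x) = e_mat n 1 n) \<and>
     (\<forall>i>1. \<forall>x. lam_coeff i (Y x) = 0\<^sub>m n n) \<and>
     (\<forall>i x. mat_deriv n (\<lambda>y. lam_coeff i (Y y)) x +
        lam_coeff i (commutator (J_mat n lam + map_mat fls_const (u x)) (Y x)) = 0\<^sub>m n n) \<and>
     (\<forall>x. Y x ^\<^sub>m n = lam \<cdot>\<^sub>m 1\<^sub>m n)"

definition Y_series :: "nat \<Rightarrow> (real \<Rightarrow> real mat) \<Rightarrow> real \<Rightarrow> real fls mat" where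
  "Y_series n u = (THE Y. is_Y_series n u Y)"

definition Y_coeff :: "nat \<Rightarrow> nat \<Rightarrow> int \<Rightarrow> (real \<Rightarrow> real mat) \<Rightarrow> real \<Rightarrow> real mat" where
  "Y_coeff n j i u x = lam_coeff i (Y_series n u x ^\<^sub>m j)"

definition is_zeta :: "nat \<Rightarrow> nat \<Rightarrow> (real \<Rightarrow> real mat) \<Rightarrow> (real \<Rightarrow> real mat) \<Rightarrow> bool" where
  "is_zeta n j u z \<longleftrightarrow> smooth_mat n z \<and> (\<forall>x. z x \<in> strictly_upper n) \<and>
     (\<forall>x. mat_deriv n (\<lambda>y. Y_coeff n j 0 u y - z y) x +
        commutator (b_mat n + u x) (Y_coeff n j 0 u x - z x) \<in> V_space n)"

definition zeta :: "nat \<Rightarrow> nat \<Rightarrow> (real \<Rightarrow> real mat) \<Rightarrow> real \<Rightarrow> real mat" where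
  "zeta n j u = (THE z. is_zeta n j u z)"

text \<open>The series \<open>Y\<close> has degree 1 in \<open>\<lambda>\<close>, so \<open>Y^j\<close> has no coefficients beyond
  \<open>\<lambda>^j\<close> and the sum over all \<open>i \<ge> 0\<close> stops at \<open>j\<close>.\<close>

definition Z_mat :: "nat \<Rightarrow> nat \<Rightarrow> (real \<Rightarrow> real mat) \<Rightarrow> real \<Rightarrow> real \<Rightarrow> real mat" where
  "Z_mat n j u l x =
     mat n n (\<lambda>rc. \<Sum>i\<le>j. Y_coeff n j (int i) u x $$ rc * l ^ i) - zeta n j u x"

definition ca_flow_solution :: "nat \<Rightarrow> nat \<Rightarrow> real set \<Rightarrow> (real \<Rightarrow> real \<Rightarrow> real vec) \<Rightarrow> bool" where
  "ca_flow_solution n j T \<gamma> \<longleftrightarrow>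
     (\<forall>i<n. smooth_on (UNIV \<times> T) (\<lambda>(x, t). \<gamma> x t $ i)) \<and>
     (\<forall>t\<in>T. (\<lambda>x. \<gamma> x t) \<in> ca_curves n) \<and>
     (\<forall>t\<in>T. \<forall>x. vec n (\<lambda>i. deriv (\<lambda>s. \<gamma> x s $ i) t) =
        ca_frame n (\<lambda>y. \<gamma> y t) x *\<^sub>v
          (Z_mat n j (ca_curvature n (\<lambda>y. \<gamma> y t)) 0 x *\<^sub>v unit_vec n 0))"

subsection \<open>Baecklund transformations\<close>

text \<open>\<open>w_rev n u h m\<close> is \<open>w\<close> with index \<open>n - m\<close>.\<close>

fun w_rev :: "nat \<Rightarrow> (real \<Rightarrow> real mat) \<Rightarrow> (real \<Rightarrow> real) \<Rightarrow> nat \<Rightarrow> real \<Rightarrow> real" where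
  "w_rev n u h 0 = (\<lambda>x. 1)"
| "w_rev n u h (Suc 0) = (\<lambda>x. - h x)"
| "w_rev n u h (Suc (Suc m)) = (\<lambda>x. - deriv (w_rev n u h (Suc m)) x
     - h x * w_rev n u h (Suc m) x - ucoeff n (u x) (n - Suc m))"

definition w_fun :: "nat \<Rightarrow> (real \<Rightarrow> real mat) \<Rightarrow> (real \<Rightarrow> real) \<Rightarrow> nat \<Rightarrow> real \<Rightarrow> real" where
  "w_fun n u h i = w_rev n u h (n - i)"

definition w_vec :: "nat \<Rightarrow> (real \<Rightarrow> real mat) \<Rightarrow> (real \<Rightarrow> real) \<Rightarrow> real \<Rightarrow> real vec" where
  "w_vec n u h x = vec1 n (\<lambda>i. w_fun n u h i x)"

definition BT_solution ::
  "nat \<Rightarrow> nat \<Rightarrow> real set \<Rightarrow> (real \<Rightarrow> real \<Rightarrow> real mat) \<Rightarrow> real \<Rightarrow> (real \<Rightarrow> real \<Rightarrow> real) \<Rightarrow> bool" where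
  "BT_solution n j T u k h \<longleftrightarrow>
     smooth_on (UNIV \<times> T) (\<lambda>(x, t). h x t) \<and>
     (\<forall>t\<in>T. \<forall>x.
        deriv (w_fun n (\<lambda>y. u y t) (\<lambda>y. h y t) 1) x
          + h x t * w_fun n (\<lambda>y. u y t) (\<lambda>y. h y t) 1 x + ucoeff n (u x t) 1 + k = 0 \<and>
        deriv (\<lambda>s. h x s) t =
          - deriv (\<lambda>y. (Z_mat n j (\<lambda>z. u z t) k y *\<^sub>v
                          w_vec n (\<lambda>z. u z t) (\<lambda>z. h z t) y) $ (n - 1)) x)"

definition s_fun :: "nat \<Rightarrow> (real \<Rightarrow> real mat) \<Rightarrow> (real \<Rightarrow> real) \<Rightarrow> nat \<Rightarrow> real \<Rightarrow> real" where
  "s_fun n u h i x = deriv (w_fun n u h i) x -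
     (\<Sum>m=i+1..n. real ((m - 1) choose (i - 1)) * w_fun n u h m x * (deriv ^^ (m - i)) h x)"

definition N_mat :: "nat \<Rightarrow> (real \<Rightarrow> real mat) \<Rightarrow> (real \<Rightarrow> real) \<Rightarrow> real \<Rightarrow> real mat" where
  "N_mat n u h x = mat1 n (\<lambda>r c.
     if r < c \<and> c < n then real ((c - 1) choose (r - 1)) * (deriv ^^ (c - r)) h x
     else if r < n \<and> c = n then
       ucoeff n (u x) r + s_fun n u h r x + real ((n - 1) choose (r - 1)) * (deriv ^^ (n - r)) h x
     else 0)"

definition f_mat :: "nat \<Rightarrow> (real \<Rightarrow> real mat) \<Rightarrow> (real \<Rightarrow> real) \<Rightarrow> real \<Rightarrow> real \<Rightarrow> real mat" where
  "f_mat n u h x l = J_mat n l + h x \<cdot>\<^sub>m 1\<^sub>m n + N_mat n u h x"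

end

theory Submission
  imports Defs "HOL-Analysis.Henstock_Kurzweil_Integration"
begin

text \<open>
  The components of \<open>\<gamma>\<close> are annihilated by \<open>L = \<partial>^n - \<Sum> u\<^sub>i \<partial>^(i-1)\<close>. The first equation of the
  Baecklund system says that \<open>L - k = (\<partial> + h) Q\<close> with \<open>Q = \<Sum> w\<^sub>i \<partial>^(i-1)\<close>, and the new curve
  belongs to \<open>L' = Q (\<partial> + h) + k\<close>. The matrix \<open>f\<close> describes the operator \<open>\<partial> + h\<close>, so that
  \<open>f\<^sub>x = f (J + u) - (J + u') f\<close> and \<open>f w = (\<lambda> - k) e\<^sub>1\<close>. At \<open>\<lambda> = 0\<close> this shows that \<open>g'\<close> is a
  central affine frame with curvature \<open>u'\<close>, and that \<open>\<gamma>' = - k^(-1) d g w\<close>.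

  A formal wave function yields an invertible series \<open>P\<close> with \<open>P\<^sub>x + J P = P (J + u)\<close>. Every
  series \<open>C\<close> with \<open>C\<^sub>x + [J, C] = 0\<close> commutes with \<open>J\<close>. Therefore \<open>Y = P^(-1) J P\<close> is the unique
  admissible series, and \<open>f Y = Y' f\<close>, because \<open>P' f P^(-1)\<close> commutes with \<open>J\<close>. Comparing powers
  of \<open>\<lambda>\<close>, one finds that \<open>f Z - Z' f\<close> does not depend on \<open>\<lambda>\<close>.

  The equation for \<open>h\<^sub>t\<close> amounts to \<open>w\<^sub>t = - Z(k) w + (Z(k) w)\<^sub>n w\<close>. Differentiating
  \<open>\<gamma>' = - k^(-1) d g w\<close> in \<open>t\<close> and comparing \<open>f Z - Z' f\<close> at \<open>\<lambda> = 0\<close> and \<open>\<lambda> = k\<close> gives the flow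
  equation for \<open>\<gamma>'\<close>.
\<close>

text \<open>Functions of x are elements of the ring \<open>sfun\<close>, so that determinants,
  adjugates and Laurent series over them are plain algebra. This ring has zero divisors: that P Y
  P^(-1), an n-th root of \<lambda> commuting with J, equals J is concluded at each point x
  separately, over the field of real Laurent series. Why C_x + [J, C] = 0 forces C to commute with
  J: if one diagonal of C, seen as a periodic matrix, is constant along its length, summing the
  equation over a period kills its x-derivative, and then the next diagonal is constant as well.
  Only the term \<lambda> e_1n brings \<lambda> into f and J + u, and e_1n annihilates the strictly
  upper \<zeta> from both sides. This is why cutting Y^j down to nonnegative powers leaves no
  \<lambda> in f Z - Z' f. No time derivative of f, of its inverse or of u' is formed: -k^(-1) d g w
  asks only for g_t = g Z(0) and w_t. The matrix [\<partial>_x + J + u, Z(\<lambda>)] is the same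
  for all \<lambda>: at \<lambda> = 0 the curve identifies it with u_t, at \<lambda> = k it enters
  the evolution of w.\<close>

no_notation fps_nth (infixl "$" 75)
no_notation Finite_Cartesian_Product.vec_nth (infixl "$" 90)

section \<open>Smooth functions\<close>

lemma Ck_on_cong:
  fixes f g :: "'a::real_normed_vector \<Rightarrow> 'b::real_normed_vector"
  assumes "open S" "\<And>p. p \<in> S \<Longrightarrow> f p = g p" "Ck_on k S f"
  shows "Ck_on k S g"
  using assms(2,3)
proof (induction k arbitrary: f g)
  case 0
  then show ?case by (simp cong: continuous_on_cong)
next
  case (Suc k)
  have d: "(g has_derivative frechet_derivative f (at p)) (at p)" if "p \<in> S" for p
    using Suc.prems that assms(1)
    by (auto simp: frechet_derivative_works intro: has_derivative_transform_within_open)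
  have "Ck_on k S (\<lambda>p. frechet_derivative g (at p) v)" for v
  proof (rule Suc.IH)
    show "Ck_on k S (\<lambda>p. frechet_derivative f (at p) v)" using Suc.prems by simp
    show "frechet_derivative f (at p) v = frechet_derivative g (at p) v" if "p \<in> S" for p
      using frechet_derivative_at[OF d[OF that]] by simp
  qed
  then show ?case using d by (auto simp: differentiable_def)
qed

lemma Ck_on_SucI:
  assumes "open S" "\<And>p. p \<in> S \<Longrightarrow> (f has_derivative f' p) (at p)" "\<And>v. Ck_on k S (\<lambda>p. f' p v)"
  shows "Ck_on (Suc k) S f"
proof -
  have "Ck_on k S (\<lambda>p. frechet_derivative f (at p) v)" for v
    by (rule Ck_on_cong[OF assms(1) _ assms(3)[of v]])
      (use frechet_derivative_at[OF assms(2)] in auto)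
  then show ?thesis using assms(2) by (auto simp: differentiable_def)
qed

lemma Ck_on_SucD: "Ck_on (Suc k) S f \<Longrightarrow> Ck_on k S f"
proof (induction k arbitrary: f)
  case 0
  then show ?case
    by (auto intro!: continuous_at_imp_continuous_on differentiable_imp_continuous_within)
qed auto

lemma Ck_on_const: "Ck_on k S (\<lambda>p. c)"
  by (induction k arbitrary: c) auto

lemma Ck_on_add:
  assumes "open S"
  shows "Ck_on k S f \<Longrightarrow> Ck_on k S g \<Longrightarrow> Ck_on k S (\<lambda>p. f p + g p)"
proof (induction k arbitrary: f g)
  case 0
  then show ?case by (auto intro: continuous_intros)
next
  case (Suc k)
  show ?case
    by (rule Ck_on_SucI[OF assms, where
          f' = "\<lambda>p v. frechet_derivative f (at p) v + frechet_derivative g (at p) v"])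
      (use Suc in \<open>auto intro!: has_derivative_add simp: frechet_derivative_works[symmetric]\<close>)
qed

lemma Ck_on_mult:
  fixes f g :: "'a::real_normed_vector \<Rightarrow> real"
  assumes "open S"
  shows "Ck_on k S f \<Longrightarrow> Ck_on k S g \<Longrightarrow> Ck_on k S (\<lambda>p. f p * g p)"
proof (induction k arbitrary: f g)
  case 0
  then show ?case by (auto intro: continuous_intros)
next
  case (Suc k)
  show ?case
  proof (rule Ck_on_SucI[OF assms, where
          f' = "\<lambda>p v. f p * frechet_derivative g (at p) v + frechet_derivative f (at p) v * g p"])
    show "Ck_on k S (\<lambda>p. f p * frechet_derivative g (at p) v +
        frechet_derivative f (at p) v * g p)" for v
    proof (intro Ck_on_add[OF assms] Suc.IH)
      show "Ck_on k S f" "Ck_on k S g" using Suc.prems Ck_on_SucD by blast+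
    qed (use Suc.prems in auto)
  qed (use Suc in \<open>auto intro!: has_derivative_mult simp: frechet_derivative_works[symmetric]\<close>)
qed

lemma smooth_on_const: "smooth_on S (\<lambda>p. c)"
  by (simp add: smooth_on_def Ck_on_const)

lemma smooth_on_add:
  "open S \<Longrightarrow> smooth_on S f \<Longrightarrow> smooth_on S g \<Longrightarrow> smooth_on S (\<lambda>p. f p + g p)"
  by (simp add: smooth_on_def Ck_on_add)

lemma smooth_on_mult:
  fixes f g :: "'a::real_normed_vector \<Rightarrow> real"
  shows "open S \<Longrightarrow> smooth_on S f \<Longrightarrow> smooth_on S g \<Longrightarrow> smooth_on S (\<lambda>p. f p * g p)"
  by (simp add: smooth_on_def Ck_on_mult)

lemma smooth_on_minus:
  fixes f :: "'a::real_normed_vector \<Rightarrow> real"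
  assumes "open S" "smooth_on S f"
  shows "smooth_on S (\<lambda>p. - f p)"
  using smooth_on_mult[OF assms(1) smooth_on_const[of S "-1"] assms(2)] by simp

lemma smooth_on_diff:
  fixes f g :: "'a::real_normed_vector \<Rightarrow> real"
  assumes "open S" "smooth_on S f" "smooth_on S g"
  shows "smooth_on S (\<lambda>p. f p - g p)"
  using smooth_on_add[OF assms(1,2) smooth_on_minus[OF assms(1,3)]] by simp

lemma smooth_on_sum:
  assumes "open S" "\<And>i. i \<in> I \<Longrightarrow> smooth_on S (f i)"
  shows "smooth_on S (\<lambda>p. \<Sum>i\<in>I. f i p)"
proof (cases "finite I")
  case True
  then show ?thesis using assms(2)
    by (induction I) (auto intro!: smooth_on_const smooth_on_add[OF assms(1)])
qed (simp add: smooth_on_const)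

lemma smooth_on_prod:
  fixes f :: "'i \<Rightarrow> 'a::real_normed_vector \<Rightarrow> real"
  assumes "open S" "\<And>i. i \<in> I \<Longrightarrow> smooth_on S (f i)"
  shows "smooth_on S (\<lambda>p. \<Prod>i\<in>I. f i p)"
proof (cases "finite I")
  case True
  then show ?thesis using assms(2)
    by (induction I) (auto intro!: smooth_on_const smooth_on_mult[OF assms(1)])
qed (simp add: smooth_on_const)

lemma smooth_on_cong:
  assumes "open S" "smooth_on S f" "\<And>p. p \<in> S \<Longrightarrow> f p = g p"
  shows "smooth_on S g"
  using assms Ck_on_cong unfolding smooth_on_def by blast

lemma smooth_on_has_derivative:
  "smooth_on S f \<Longrightarrow> p \<in> S \<Longrightarrow> (f has_derivative frechet_derivative f (at p)) (at p)"
  using Ck_on.simps(2)[of 0 S f] unfolding smooth_on_def frechet_derivative_works[symmetric] by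
      blast

lemma smooth_on_continuous_on: "smooth_on S f \<Longrightarrow> continuous_on S f"
  using Ck_on.simps(1)[of S f] unfolding smooth_on_def by blast

lemma smooth_on_directional:
  "smooth_on S f \<Longrightarrow> smooth_on S (\<lambda>p. frechet_derivative f (at p) v)"
  unfolding smooth_on_def by (metis Ck_on.simps(2))

subsection \<open>One variable\<close>

lemma smooth_on_has_deriv:
  fixes f :: "real \<Rightarrow> real"
  assumes "smooth_on S f" "x \<in> S"
  shows "(f has_real_derivative deriv f x) (at x)"
proof -
  have "f differentiable (at x)"
    using smooth_on_has_derivative[OF assms] by (auto simp: differentiable_def)
  then show ?thesis
    using DERIV_deriv_iff_real_differentiable by blast
qed

lemma smooth_on_deriv:
  fixes f :: "real \<Rightarrow> real"
  assumes "open S" "smooth_on S f"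
  shows "smooth_on S (deriv f)"
proof (rule smooth_on_cong[OF assms(1) smooth_on_directional[OF assms(2), of 1]])
  fix x assume "x \<in> S"
  from frechet_derivative_at[OF smooth_on_has_deriv[OF assms(2) this, unfolded
      has_field_derivative_def]]
  show "frechet_derivative f (at x) 1 = deriv f x" by (metis mult.right_neutral)
qed

lemma smooth_on_antiderivative:
  fixes f F :: "real \<Rightarrow> real"
  assumes "open S" "smooth_on S f" "\<And>x. x \<in> S \<Longrightarrow> (F has_real_derivative f x) (at x)"
  shows "smooth_on S F"
proof -
  have *: "Ck_on (Suc k) S F" for k
    using assms(2,3) unfolding smooth_on_def
    by (intro Ck_on_SucI[OF assms(1), where f' = "\<lambda>p v. f p * v"])
      (auto simp: has_field_derivative_def intro!: Ck_on_mult[OF assms(1)] Ck_on_const)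
  show ?thesis
    unfolding smooth_on_def using * Ck_on_SucD by blast
qed

lemma smooth_antiderivative_ex:
  fixes f :: "real \<Rightarrow> real"
  assumes "smooth_on UNIV f"
  shows "\<exists>F. smooth_on UNIV F \<and> (\<forall>x. (F has_real_derivative f x) (at x))"
proof -
  have c: "continuous_on UNIV f" by (rule smooth_on_continuous_on[OF assms])
  \<comment> \<open>The integral over an interval with reversed end points is zero, so negative
    arguments need the explicit sign.\<close>
  define F where "F x = (if x \<ge> 0 then integral {0..x} f else - integral {x..0} f)" for x
  have I: "f integrable_on {a..b}" for a b :: real
    using c continuous_on_subset integrable_continuous_interval by blast
  have "(F has_real_derivative f x) (at x)" for x
  proof -
    \<comment> \<open>A base point to the left of both 0 and x: near x, \<open>F\<close> differs by
      a constant from the integral starting at \<open>a\<close>, whatever the sign of x.\<close>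
    define a where "a = min x 0 - 1"
    define b where "b = \<bar>x\<bar> + 1"
    have ab: "a \<le> x" "x \<le> b" by (auto simp: a_def b_def)
    have a0: "a \<le> 0" by (simp add: a_def)
    have eq: "F y = integral {a..y} f - integral {a..0} f" if "y \<in> {a<..<b}" for y
    proof (cases "y \<ge> 0")
      case True
      then show ?thesis
        using Henstock_Kurzweil_Integration.integral_combine[OF _ True I, of a] a0
            by (simp add: F_def)
    next
      case False
      then show ?thesis
        using Henstock_Kurzweil_Integration.integral_combine[OF _ _ I, of a y 0] that
            by (simp add: F_def)
    qed
    have "((\<lambda>y. integral {a..y} f - integral {a..0} f) has_real_derivative f x) (at x within
        {a..b})"
      using integral_has_real_derivative[of a b f x] continuous_on_subset[OF c, of "{a..b}"] ab
      by (auto intro!: derivative_eq_intros)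
    then have "((\<lambda>y. integral {a..y} f - integral {a..0} f) has_real_derivative f x) (at x)"
      using at_within_Icc_at[of a x b] by (auto simp: a_def b_def)
    then show ?thesis
      by (rule has_field_derivative_transform_within_open[of _ _ _ "{a<..<b}"])
        (auto simp: eq a_def b_def)
  qed
  then show ?thesis using smooth_on_antiderivative[OF open_UNIV assms] by blast
qed

subsection \<open>Two variables\<close>

lemma smooth_on_slice:
  fixes F :: "real \<times> real \<Rightarrow> real"
  assumes "smooth_on (UNIV \<times> T) F" "t \<in> T"
  shows "smooth_on UNIV (\<lambda>x. F (x, t))"
proof -
  have "Ck_on k UNIV (\<lambda>x. F (x, t))" if "Ck_on k (UNIV \<times> T) F" for k
    using that
  proof (induction k arbitrary: F)
    case 0
    then show ?case
      by (auto intro!: continuous_on_compose2[of "UNIV \<times> T" F] continuous_intros assms(2))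
  next
    case (Suc k)
    show ?case
    proof (rule Ck_on_SucI[OF open_UNIV, where f' = "\<lambda>x v. frechet_derivative F (at (x, t)) (v,
        0)"])
      fix x
      have *: "(F has_derivative frechet_derivative F (at (x, t))) (at (x, t))"
        using Suc.prems assms(2) unfolding frechet_derivative_works[symmetric] by auto
      have "((\<lambda>x. (x, t)) has_derivative (\<lambda>v. (v, 0))) (at x)"
        by (auto intro!: derivative_eq_intros)
      from diff_chain_at[OF this] *
      show "((\<lambda>x. F (x, t)) has_derivative (\<lambda>v. frechet_derivative F (at (x, t)) (v, 0))) (at x)"
        by (simp add: o_def)
    next
      fix v :: real
      show "Ck_on k UNIV (\<lambda>x. frechet_derivative F (at (x, t)) (v, 0))"
        by (rule Suc.IH) (use Suc.prems in auto)
    qed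
  qed
  then show ?thesis using assms(1) unfolding smooth_on_def by blast
qed

lemma smooth_on_partial_x_raw:
  fixes F :: "real \<times> real \<Rightarrow> real"
  assumes "smooth_on (UNIV \<times> T) F" "t \<in> T"
  shows "((\<lambda>y. F (y, t)) has_real_derivative frechet_derivative F (at (x, t)) (1, 0)) (at x)"
proof -
  let ?D = "frechet_derivative F (at (x, t))"
  have *: "(F has_derivative ?D) (at (x, t))"
    using smooth_on_has_derivative assms by blast
  have "((\<lambda>x. (x, t)) has_derivative (\<lambda>v. (v, 0))) (at x)"
    by (auto intro!: derivative_eq_intros)
  from diff_chain_at[OF this *]
  have "((\<lambda>x. F (x, t)) has_derivative (\<lambda>v. ?D (v, 0))) (at x)"
    by (simp add: o_def)
  moreover have "(\<lambda>v. ?D (v, 0)) = (*) (?D (1, 0))"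
  proof
    show "?D (v, 0) = ?D (1, 0) * v" for v
      using linear_cmul[OF has_derivative_linear[OF *], of v "(1, 0)"] by simp
  qed
  ultimately show ?thesis unfolding has_field_derivative_def by metis
qed

lemma smooth_on_partial_t_raw:
  fixes F :: "real \<times> real \<Rightarrow> real"
  assumes "smooth_on (UNIV \<times> T) F" "t \<in> T"
  shows "((\<lambda>s. F (x, s)) has_real_derivative frechet_derivative F (at (x, t)) (0, 1)) (at t)"
proof -
  let ?D = "frechet_derivative F (at (x, t))"
  have *: "(F has_derivative ?D) (at (x, t))"
    using smooth_on_has_derivative assms by blast
  have "((\<lambda>s. (x, s)) has_derivative (\<lambda>v. (0, v))) (at t)"
    by (auto intro!: derivative_eq_intros)
  from diff_chain_at[OF this *]
  have "((\<lambda>s. F (x, s)) has_derivative (\<lambda>v. ?D (0, v))) (at t)"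
    by (simp add: o_def)
  moreover have "(\<lambda>v. ?D (0, v)) = (*) (?D (0, 1))"
  proof
    show "?D (0, v) = ?D (0, 1) * v" for v
      using linear_cmul[OF has_derivative_linear[OF *], of v "(0, 1)"] by simp
  qed
  ultimately show ?thesis unfolding has_field_derivative_def by metis
qed

definition smooth2 :: "real set \<Rightarrow> (real \<Rightarrow> real \<Rightarrow> real) \<Rightarrow> bool" where
  "smooth2 T F \<longleftrightarrow> smooth_on (UNIV \<times> T) (\<lambda>(x, t). F x t)"

lemma smooth2_slice: "smooth2 T F \<Longrightarrow> t \<in> T \<Longrightarrow> smooth_on UNIV (\<lambda>x. F x t)"
  unfolding smooth2_def using smooth_on_slice by fastforce

lemma smooth2_dx:
  assumes "open T" "smooth2 T F"
  shows "smooth2 T (\<lambda>x t. deriv (\<lambda>y. F y t) x)"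
  unfolding smooth2_def
proof (rule smooth_on_cong[OF _ smooth_on_directional[OF assms(2)[unfolded smooth2_def], of
    "(1, 0)"]])
  show "open (UNIV \<times> T :: (real \<times> real) set)" using assms(1) by (simp add: open_Times)
  fix p :: "real \<times> real" assume "p \<in> UNIV \<times> T"
  then show "frechet_derivative (\<lambda>(x, t). F x t) (at p) (1, 0) =
      (case p of (x, t) \<Rightarrow> deriv (\<lambda>y. F y t) x)"
    using DERIV_imp_deriv[OF smooth_on_partial_x_raw[OF assms(2)[unfolded smooth2_def], of "snd p"
        "fst p"]]
    by (auto simp: case_prod_unfold)
qed

lemma smooth2_dt:
  assumes "open T" "smooth2 T F"
  shows "smooth2 T (\<lambda>x t. deriv (\<lambda>s. F x s) t)"
  unfolding smooth2_def
proof (rule smooth_on_cong[OF _ smooth_on_directional[OF assms(2)[unfolded smooth2_def], of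
    "(0, 1)"]])
  show "open (UNIV \<times> T :: (real \<times> real) set)" using assms(1) by (simp add: open_Times)
  fix p :: "real \<times> real" assume "p \<in> UNIV \<times> T"
  then show "frechet_derivative (\<lambda>(x, t). F x t) (at p) (0, 1) =
      (case p of (x, t) \<Rightarrow> deriv (\<lambda>s. F x s) t)"
    using DERIV_imp_deriv[OF smooth_on_partial_t_raw[OF assms(2)[unfolded smooth2_def], of "snd p"
        "fst p"]]
    by (auto simp: case_prod_unfold)
qed

lemma smooth2_has_dx:
  assumes "smooth2 T F" "t \<in> T"
  shows "((\<lambda>y. F y t) has_real_derivative deriv (\<lambda>y. F y t) x) (at x)"
  using smooth2_slice[OF assms] smooth_on_has_deriv by blast

lemma smooth2_has_dt:
  assumes "smooth2 T F" "t \<in> T"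
  shows "((\<lambda>s. F x s) has_real_derivative deriv (\<lambda>s. F x s) t) (at t)"
  using smooth_on_partial_t_raw[OF assms(1)[unfolded smooth2_def] assms(2), of x] DERIV_imp_deriv
  by fastforce

lemma smooth2_dx_iterate:
  assumes "open T" "smooth2 T F"
  shows "smooth2 T (\<lambda>x t. (deriv ^^ m) (\<lambda>y. F y t) x)"
proof (induction m)
  case (Suc m)
  from smooth2_dx[OF assms(1) this] show ?case by (simp add: o_def)
qed (simp add: assms)

lemma smooth2_const: "smooth2 T (\<lambda>x t. c)"
  by (simp add: smooth2_def case_prod_unfold smooth_on_const)

lemma smooth2_diff:
  assumes "open T" "smooth2 T F" "smooth2 T G"
  shows "smooth2 T (\<lambda>x t. F x t - G x t)"
  using smooth_on_diff[OF _ assms(2,3)[unfolded smooth2_def]] assms(1)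
  by (simp add: smooth2_def case_prod_unfold open_Times)

lemma smooth2_minus:
  assumes "open T" "smooth2 T F"
  shows "smooth2 T (\<lambda>x t. - F x t)"
  using smooth_on_minus[OF _ assms(2)[unfolded smooth2_def]] assms(1)
  by (simp add: smooth2_def case_prod_unfold open_Times)

lemma smooth2_mult:
  assumes "open T" "smooth2 T F" "smooth2 T G"
  shows "smooth2 T (\<lambda>x t. F x t * G x t)"
  using smooth_on_mult[OF _ assms(2,3)[unfolded smooth2_def]] assms(1)
  by (simp add: smooth2_def case_prod_unfold open_Times)

lemma smooth2_sum:
  assumes "open T" "\<And>i. i \<in> I \<Longrightarrow> smooth2 T (F i)"
  shows "smooth2 T (\<lambda>x t. \<Sum>i\<in>I. F i x t)"
  using smooth_on_sum[of "UNIV \<times> T" I "\<lambda>i (x, t). F i x t"] assms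
  by (simp add: smooth2_def case_prod_unfold open_Times)

lemma smooth2_prod:
  assumes "open T" "\<And>i. i \<in> I \<Longrightarrow> smooth2 T (F i)"
  shows "smooth2 T (\<lambda>x t. \<Prod>i\<in>I. F i x t)"
  using smooth_on_prod[of "UNIV \<times> T" I "\<lambda>i (x, t). F i x t"] assms
  by (simp add: smooth2_def case_prod_unfold open_Times)

lemma smooth2_cong:
  assumes "open T" "smooth2 T F" "\<And>x t. t \<in> T \<Longrightarrow> F x t = G x t"
  shows "smooth2 T G"
  unfolding smooth2_def
  by (rule smooth_on_cong[OF _ assms(2)[unfolded smooth2_def]]) (use assms in \<open>auto simp:
      open_Times\<close>)

text \<open>Integrating the x-derivative in x recovers F up to its value at a base point;
  differentiating under the integral sign in t and then in x exchanges the two derivatives.\<close>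

lemma smooth2_mixed:
  assumes T: "open T" "t \<in> T" and F: "smooth2 T F"
  shows "deriv (\<lambda>s. deriv (\<lambda>y. F y s) x) t = deriv (\<lambda>y. deriv (\<lambda>s. F y s) t) x"
proof -
  define G where "G = (\<lambda>y s. deriv (\<lambda>y. F y s) y)"
  define H where "H = (\<lambda>y s. deriv (\<lambda>s. G y s) s)"
  have G: "smooth2 T G" unfolding G_def by (rule smooth2_dx[OF T(1) F])
  have H: "smooth2 T H" unfolding H_def by (rule smooth2_dt[OF T(1) G])
  obtain e where e: "e > 0" "ball t e \<subseteq> T"
    using T by (auto simp: open_contains_ball)
  define a where "a = x - 1"
  have *: "deriv (\<lambda>s. F y s) t - deriv (\<lambda>s. F a s) t = integral {a..y} (\<lambda>z. H z t)" if "y > a" for y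
  proof -
    have FTC: "((\<lambda>z. G z s) has_integral (F y s - F a s)) {a..y}" if "s \<in> T" for s
    proof (rule fundamental_theorem_of_calculus)
      show "((\<lambda>y. F y s) has_vector_derivative G z s) (at z within {a..y})" for z
        using smooth2_has_dx[OF F that, of z] unfolding G_def
        by (simp add: has_real_derivative_iff_has_vector_derivative has_vector_derivative_at_within)
    qed (use \<open>y > a\<close> in simp)
    have "((\<lambda>s. integral (cbox a y) (\<lambda>z. G z s)) has_field_derivative integral (cbox a y) (\<lambda>z. H z
        t))
        (at t within ball t e)"
    proof (rule leibniz_rule_field_derivative)
      show "((\<lambda>s. G z s) has_real_derivative H z s) (at s within ball t e)"
          if "s \<in> ball t e" for z s
        using has_field_derivative_at_within[OF smooth2_has_dt[OF G, of s z]] that e(2)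
        unfolding H_def by blast
      show "(\<lambda>z. G z s) integrable_on cbox a y" if "s \<in> ball t e" for s
        using has_integral_integrable[OF FTC, of s] that e(2) by auto
      have "continuous_on (UNIV \<times> T) (\<lambda>(x, t). H x t)"
        using H by (simp add: smooth2_def smooth_on_continuous_on)
      then have "continuous_on (ball t e \<times> cbox a y) (\<lambda>p. (\<lambda>(x, t). H x t) (snd p, fst p))"
        by (rule continuous_on_compose2) (use e(2) in \<open>auto intro!: continuous_intros\<close>)
      then show "continuous_on (ball t e \<times> cbox a y) (\<lambda>(s, z). H z s)"
        by (simp add: case_prod_unfold)
    qed (use e in auto)
    then have "((\<lambda>s. integral (cbox a y) (\<lambda>z. G z s)) has_field_derivative integral (cbox a y)
        (\<lambda>z. H z t)) (at t)"
      using e(1) by (simp add: at_within_open[of t "ball t e"])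
    then have "((\<lambda>s. F y s - F a s) has_field_derivative integral (cbox a y) (\<lambda>z. H z t)) (at t)"
      by (rule has_field_derivative_transform_within_open[of _ _ _ "T"])
        (use integral_unique[OF FTC] T in auto)
    moreover have "((\<lambda>s. F y s - F a s) has_field_derivative deriv (\<lambda>s. F y s) t
        - deriv (\<lambda>s. F a s) t) (at t)"
      using smooth2_has_dt[OF F T(2)] by (auto intro!: derivative_intros)
    ultimately show ?thesis using DERIV_unique by fastforce
  qed
  have "((\<lambda>y. integral {a..y} (\<lambda>z. H z t)) has_real_derivative H x t) (at x within {a..x+1})"
    by (rule integral_has_real_derivative)
      (use smooth_on_continuous_on[OF smooth2_slice[OF H T(2)]] in
        \<open>auto simp: a_def intro: continuous_on_subset\<close>)
  then have "((\<lambda>y. integral {a..y} (\<lambda>z. H z t)) has_real_derivative H x t) (at x)"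
    using at_within_Icc_at[of a x "x+1"] by (simp add: a_def)
  then have "((\<lambda>y. integral {a..y} (\<lambda>z. H z t) + deriv (\<lambda>s. F a s) t)
      has_real_derivative H x t) (at x)"
    by (auto intro!: derivative_eq_intros)
  then have "((\<lambda>y. deriv (\<lambda>s. F y s) t) has_real_derivative H x t) (at x)"
    by (rule has_field_derivative_transform_within_open[of _ _ _ "{a<..}"])
      (use *[symmetric] in \<open>auto simp: a_def\<close>)
  from DERIV_imp_deriv[OF this] show ?thesis by (simp add: H_def G_def)
qed

section \<open>Derivations\<close>

text \<open>Abstract, because the gauge identities are needed twice: for smooth functions and for
  Laurent series over them.\<close>

locale derivation =
  fixes D :: "'a::comm_ring_1 \<Rightarrow> 'a"
  assumes D_add: "D (a + b) = D a + D b"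
    and D_mult: "D (a * b) = D a * b + a * D b"
begin

lemma D_0 [simp]: "D 0 = 0"
  using D_add[of 0 0] by simp

lemma D_1 [simp]: "D 1 = 0"
  using D_mult[of 1 1] by simp

lemma D_minus: "D (- a) = - D a"
  using D_add[of a "- a"] by (simp add: add_eq_0_iff)

lemma D_diff: "D (a - b) = D a - D b"
  using D_add[of a "- b"] by (simp add: D_minus)

lemma D_sum: "D (\<Sum>i\<in>I. f i) = (\<Sum>i\<in>I. D (f i))"
  by (induction I rule: infinite_finite_induct) (auto simp: D_add)

lemma D_of_nat [simp]: "D (of_nat m) = 0"
  by (induction m) (auto simp: D_add)

lemma D_prod:
  "finite I \<Longrightarrow> D (\<Prod>i\<in>I. f i) = (\<Sum>i\<in>I. D (f i) * (\<Prod>l\<in>I - {i}. f l))"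
proof (induction I rule: finite_induct)
  case (insert a I)
  have "(\<Prod>l\<in>insert a I - {i}. f l) = f a * (\<Prod>l\<in>I - {i}. f l)" if "i \<in> I" for i
  proof -
    have "insert a I - {i} = insert a (I - {i})" using insert that by auto
    then show ?thesis using insert by simp
  qed
  then show ?case using insert
    by (simp add: D_mult sum_distrib_left mult_ac)
qed auto

abbreviation mD :: "'a mat \<Rightarrow> 'a mat" where "mD \<equiv> map_mat D"

lemma mD_diff: "A \<in> carrier_mat m n \<Longrightarrow> B \<in> carrier_mat m n \<Longrightarrow> mD (A - B) = mD A - mD B"
  by (intro eq_matI) (auto simp: D_diff)

lemma mD_mult:
  assumes "A \<in> carrier_mat m n" "B \<in> carrier_mat n l"
  shows "mD (A * B) = mD A * B + A * mD B"
  using assms by (intro eq_matI) (auto simp: scalar_prod_def D_sum D_mult sum.distrib)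

lemma mD_one [simp]: "mD (1\<^sub>m n) = 0\<^sub>m n n"
  by (intro eq_matI) auto

end

section \<open>Coefficientwise maps of Laurent series\<close>

text \<open>The result is a Laurent series only if \<phi> maps 0 to 0; otherwise the coefficients do
  not vanish towards negative indices.\<close>

definition fls_map :: "('a::zero \<Rightarrow> 'b::zero) \<Rightarrow> 'a fls \<Rightarrow> 'b fls" where
  "fls_map \<phi> f = Abs_fls (\<lambda>i. \<phi> (fls_nth f i))"

lemma fls_map_nth [simp]:
  assumes "\<phi> 0 = 0"
  shows "fls_nth (fls_map \<phi> f) i = \<phi> (fls_nth f i)"
proof -
  obtain N where "\<forall>m<N. fls_nth f m = 0" by (rule fls_nth_vanishes_belowE)
  then show ?thesis
    unfolding fls_map_def using assms by (intro nth_Abs_fls_lower_bound[of N]) auto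
qed

text \<open>The range of summation is independent of the subdegrees, which a coefficientwise map can
  raise. The two sides of a Leibniz rule or of a homomorphism law then run over the same
  indices.\<close>

lemma fls_mult_nth_bounded:
  fixes f g :: "'a::comm_ring_1 fls"
  assumes f: "\<And>i. i < a \<Longrightarrow> fls_nth f i = 0" and g: "\<And>i. i < b \<Longrightarrow> fls_nth g i = 0"
  shows "fls_nth (f * g) m = (\<Sum>i=a..m - b. fls_nth f i * fls_nth g (m - i))"
proof (cases "f = 0 \<or> g = 0")
  case False
  have "a \<le> fls_subdegree f" "b \<le> fls_subdegree g"
    using f g False nth_fls_subdegree_nonzero by (metis not_le_imp_less)+
  then show ?thesis
    unfolding fls_times_nth(2)
    by (intro sum.mono_neutral_left) (auto simp: not_le fls_eq0_below_subdegree)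
qed auto

lemma fls_common_bound:
  fixes f g :: "'a::zero fls"
  obtains a where "\<And>i. i < a \<Longrightarrow> fls_nth f i = 0" "\<And>i. i < a \<Longrightarrow> fls_nth g i = 0"
proof -
  obtain a where a: "\<forall>m<a. fls_nth f m = 0" by (rule fls_nth_vanishes_belowE)
  obtain b where b: "\<forall>m<b. fls_nth g m = 0" by (rule fls_nth_vanishes_belowE)
  show ?thesis using that[of "min a b"] a b by auto
qed

context derivation begin

lemma derivation_fls: "derivation (fls_map D)"
proof
  fix f g :: "'a fls"
  show "fls_map D (f + g) = fls_map D f + fls_map D g"
    by (intro fls_eqI) (simp add: D_add)
  obtain a where a: "\<And>i. i < a \<Longrightarrow> fls_nth f i = 0" "\<And>i. i < a \<Longrightarrow> fls_nth g i = 0"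
    by (rule fls_common_bound[of f g]) blast
  show "fls_map D (f * g) = fls_map D f * g + f * fls_map D g"
    by (intro fls_eqI)
      (simp add: fls_mult_nth_bounded[of a _ a] a D_sum D_mult sum.distrib)
qed

end

lemma (in comm_ring_hom) comm_ring_hom_fls: "comm_ring_hom (fls_map hom)"
proof
  fix f g :: "'a fls"
  show "fls_map hom (f + g) = fls_map hom f + fls_map hom g"
    by (intro fls_eqI) (simp add: hom_add)
  obtain a where a: "\<And>i. i < a \<Longrightarrow> fls_nth f i = 0" "\<And>i. i < a \<Longrightarrow> fls_nth g i = 0"
    by (rule fls_common_bound[of f g]) blast
  show "fls_map hom (f * g) = fls_map hom f * fls_map hom g"
    by (intro fls_eqI) (simp add: fls_mult_nth_bounded[of a _ a] a hom_sum hom_mult)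
  show "fls_map hom 1 = 1" "fls_map hom 0 = 0"
    by (auto intro!: fls_eqI)
qed

lemma fls_X_inv_mult_nth:
  fixes f :: "'a::comm_ring_1 fls"
  shows "fls_nth (fls_X_inv * f) i = fls_nth f (i + 1)" "fls_nth (f * fls_X_inv) i =
      fls_nth f (i + 1)"
  by (simp_all add: fls_X_inv_times_conv_shift)

section \<open>The differential ring of smooth functions\<close>

text \<open>As a type, smooth functions can be entries of matrices and coefficients of series;
  evaluation at a point is then a ring homomorphism that commutes with all algebraic
  constructions.\<close>

typedef sfun = "{f :: real \<Rightarrow> real. smooth_on UNIV f}"
  morphisms sapp Sfun
  using smooth_on_const by blast

setup_lifting type_definition_sfun

instantiation sfun :: comm_ring_1
begin

lift_definition zero_sfun :: sfun is "\<lambda>x. 0" by (rule smooth_on_const)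
lift_definition one_sfun :: sfun is "\<lambda>x. 1" by (rule smooth_on_const)
lift_definition plus_sfun :: "sfun \<Rightarrow> sfun \<Rightarrow> sfun" is "\<lambda>f g x. f x + g x"
  by (rule smooth_on_add[OF open_UNIV])
lift_definition minus_sfun :: "sfun \<Rightarrow> sfun \<Rightarrow> sfun" is "\<lambda>f g x. f x - g x"
  by (rule smooth_on_diff[OF open_UNIV])
lift_definition uminus_sfun :: "sfun \<Rightarrow> sfun" is "\<lambda>f x. - f x"
  by (rule smooth_on_minus[OF open_UNIV])
lift_definition times_sfun :: "sfun \<Rightarrow> sfun \<Rightarrow> sfun" is "\<lambda>f g x. f x * g x"
  by (rule smooth_on_mult[OF open_UNIV])

instance
  by standard (transfer; force simp: algebra_simps fun_eq_iff)+

end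

lift_definition sD :: "sfun \<Rightarrow> sfun" is deriv by (rule smooth_on_deriv[OF open_UNIV])

lift_definition sC :: "real \<Rightarrow> sfun" is "\<lambda>c x. c" by (rule smooth_on_const)

lemma sapp_smooth: "smooth_on UNIV (sapp a)"
  using sapp by blast

lemma sapp_simps [simp]:
  "sapp 0 x = 0" "sapp 1 x = 1" "sapp (a + b) x = sapp a x + sapp b x"
  "sapp (a - b) x = sapp a x - sapp b x" "sapp (- a) x = - sapp a x"
  "sapp (a * b) x = sapp a x * sapp b x" "sapp (sC c) x = c" "sapp (sD a) x = deriv (sapp a) x"
  by (transfer; simp)+

lemma sapp_has_deriv: "(sapp a has_real_derivative sapp (sD a) x) (at x)"
  using smooth_on_has_deriv[OF sapp_smooth] by simp

lemma sfun_eqI: "(\<And>x. sapp a x = sapp b x) \<Longrightarrow> a = b"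
  using sapp_inject by blast

lemma sapp_Sfun: "smooth_on UNIV f \<Longrightarrow> sapp (Sfun f) = f"
  by (simp add: Sfun_inverse)

interpretation sapp: comm_ring_hom "\<lambda>a. sapp a x" for x
  by standard auto

interpretation sapp_fls: comm_ring_hom "fls_map (\<lambda>a. sapp a x)" for x
  by (rule sapp.comm_ring_hom_fls)

interpretation sD: derivation sD
proof
  fix a b
  show "sD (a + b) = sD a + sD b"
    by (intro sfun_eqI) (auto intro!: DERIV_imp_deriv derivative_eq_intros sapp_has_deriv simp:
        plus_sfun.rep_eq[abs_def])
  show "sD (a * b) = sD a * b + a * sD b"
    by (intro sfun_eqI) (auto intro!: DERIV_imp_deriv derivative_eq_intros sapp_has_deriv simp:
        times_sfun.rep_eq[abs_def])
qed

interpretation sDf: derivation "fls_map sD"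
  by (rule sD.derivation_fls)

lemma sD_sC [simp]: "sD (sC c) = 0"
  by (intro sfun_eqI) (simp add: sC.rep_eq)

lemma sC_simps [simp]: "sC 0 = 0" "sC 1 = 1"
  by (auto intro: sfun_eqI)

lemma sapp_of_nat [simp]: "sapp (of_nat m) x = real m"
  by (induction m) auto

lemma sfun_of_nat_cancel: "n > 0 \<Longrightarrow> of_nat n * (a::sfun) = 0 \<Longrightarrow> a = 0"
proof (rule sfun_eqI)
  fix x assume "n > 0" "of_nat n * a = 0"
  from arg_cong[OF this(2), of "\<lambda>a. sapp a x"] this(1) show "sapp a x = sapp 0 x" by simp
qed

text \<open>The constants of integration are left to choice. They affect the dressing matrix but not
  the series Y, which is unique.\<close>

definition sI :: "sfun \<Rightarrow> sfun" where "sI a = (SOME b. sD b = a)"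

lemma sD_sI [simp]: "sD (sI a) = a"
proof -
  obtain F where F: "smooth_on UNIV F" "\<And>x. (F has_real_derivative sapp a x) (at x)"
    using smooth_antiderivative_ex[OF sapp_smooth] by blast
  have "sD (Sfun F) = a"
    by (intro sfun_eqI) (simp add: sapp_Sfun F DERIV_imp_deriv[OF F(2)])
  then show ?thesis unfolding sI_def by (rule someI)
qed

section \<open>Square matrices\<close>

lemma sq_carrier:
  assumes "A \<in> carrier_mat n n" "B \<in> carrier_mat n n"
  shows "A * B \<in> carrier_mat n n" "A + B \<in> carrier_mat n n"
      "(A::'a::ring mat) - B \<in> carrier_mat n n"
  using assms by auto

lemma sq_simps:
  fixes A B C :: "'a::ring mat"
  assumes "A \<in> carrier_mat n n" "B \<in> carrier_mat n n" "C \<in> carrier_mat n n"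
  shows "(A * B) * C = A * (B * C)" "(A + B) * C = A * C + B * C" "A * (B + C) = A * B + A * C"
    "(A - B) * C = A * C - B * C" "A * (B - C) = A * B - A * C"
  by (rule assoc_mult_mat[OF assms] add_mult_distrib_mat[OF assms] mult_add_distrib_mat[OF assms]
      minus_mult_distrib_mat[OF assms] mult_minus_distrib_mat[OF assms])+

lemma sq_move:
  fixes A B C :: "'a::ring mat"
  assumes "A \<in> carrier_mat n n" "B \<in> carrier_mat n n" "A + B = C"
  shows "A = C - B"
  using assms by (intro eq_matI) auto

lemma sq_add_eq_0:
  fixes A B :: "'a::ring mat"
  assumes "A \<in> carrier_mat n n" "B \<in> carrier_mat n n" "C \<in> carrier_mat n n" "A + (B - C) = 0\<^sub>m n n"
  shows "A = C - B"
proof (rule eq_matI)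
  fix i j assume ij: "i < dim_row (C - B)" "j < dim_col (C - B)"
  have "(A + (B - C)) $$ (i, j) = 0" using ij assms(2) unfolding assms(4) by simp
  then show "A $$ (i, j) = (C - B) $$ (i, j)" using ij assms(1-3) by (simp add: algebra_simps)
qed (use assms in auto)

lemma sq_pow_conj:
  fixes P Q Y :: "'a::comm_ring_1 mat"
  assumes "P \<in> carrier_mat n n" "Q \<in> carrier_mat n n" "Y \<in> carrier_mat n n" "P * Q = 1\<^sub>m n" "Q * P =
      1\<^sub>m n"
  shows "(P * Y * Q) ^\<^sub>m m = P * Y ^\<^sub>m m * Q"
proof (induction m)
  case (Suc m)
  have c: "Y ^\<^sub>m m \<in> carrier_mat n n" using assms by simp
  have "P * Y ^\<^sub>m m * Q * (P * Y * Q) = P * (Y ^\<^sub>m m * ((Q * P) * (Y * Q)))"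
    using assms(1-3) c by (simp add: sq_simps[of _ n] sq_carrier)
  also have "\<dots> = P * (Y ^\<^sub>m m * Y) * Q"
    unfolding assms(5) using assms(1-3) c by (simp add: sq_simps[of _ n] sq_carrier)
  finally show ?case using Suc by simp
qed (use assms in simp)

lemma sq_cancel:
  fixes A B X :: "'a::comm_ring_1 mat"
  assumes "A \<in> carrier_mat n n" "B \<in> carrier_mat n n" "X \<in> carrier_mat n n" "A * B = 1\<^sub>m n"
  shows "A * (B * X) = X"
  using assoc_mult_mat[OF assms(1-3)] assms(3,4) by simp

lemma sq_mult_index:
  assumes "A \<in> carrier_mat n n" "B \<in> carrier_mat n n" "r < n" "c < n"
  shows "(A * B) $$ (r, c) = (\<Sum>s<n. A $$ (r, s) * B $$ (s, c))"
  using assms by (simp add: scalar_prod_def lessThan_atLeast0)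

lemma mat_trace_comm:
  fixes A B :: "'a::comm_ring_1 mat"
  assumes "A \<in> carrier_mat n n" "B \<in> carrier_mat n n"
  shows "mat_trace (A * B) = mat_trace (B * A)"
proof -
  have "mat_trace (A * B) = (\<Sum>i<n. \<Sum>l<n. A $$ (i, l) * B $$ (l, i))"
    using assms by (simp add: mat_trace_def scalar_prod_def lessThan_atLeast0)
  also have "\<dots> = (\<Sum>l<n. \<Sum>i<n. B $$ (l, i) * A $$ (i, l))"
    by (subst sum.swap) (simp add: mult.commute)
  also have "\<dots> = mat_trace (B * A)"
    using assms by (simp add: mat_trace_def scalar_prod_def lessThan_atLeast0)
  finally show ?thesis .
qed

section \<open>Companion matrices\<close>

text \<open>The matrix J + u with \<open>l\<close> in place of \<lambda>: it is b + u for
  \<open>l = 0\<close> and J for \<open>a = 0\<close>. Over arbitrary rings it covers real matrices,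
  smooth functions and series alike.\<close>

definition comp_mat :: "nat \<Rightarrow> 'a::comm_ring_1 \<Rightarrow> (nat \<Rightarrow> 'a) \<Rightarrow> 'a mat" where
  "comp_mat n l a = mat n n (\<lambda>(r, c). (if r = c + 1 then 1 else 0) +
     (if c = n - 1 then (if r = 0 then l else 0) + (if r < n - 1 then a r else 0) else 0))"

definition last_col :: "nat \<Rightarrow> (nat \<Rightarrow> 'a::zero) \<Rightarrow> 'a mat" where
  "last_col n a = mat n n (\<lambda>(r, c). if r < n - 1 \<and> c = n - 1 then a r else 0)"

lemma comp_mat_carrier [simp]: "comp_mat n l a \<in> carrier_mat n n"
  "dim_row (comp_mat n l a) = n" "dim_col (comp_mat n l a) = n"
  by (simp_all add: comp_mat_def)

lemma last_col_carrier [simp]: "last_col n a \<in> carrier_mat n n"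
  "dim_row (last_col n a) = n" "dim_col (last_col n a) = n"
  by (simp_all add: last_col_def)

lemma V_space_iff: "A \<in> V_space n \<longleftrightarrow> (\<exists>a. A = last_col n a)"
proof
  assume "A \<in> V_space n"
  then obtain a where a: "A = mat1 n (\<lambda>r c. if r < n \<and> c = n then a r else 0)"
    by (auto simp: V_space_def)
  have "A = last_col n (\<lambda>r. a (Suc r))"
    unfolding a mat1_def last_col_def by (intro eq_matI) auto
  then show "\<exists>a. A = last_col n a" by blast
next
  assume "\<exists>a. A = last_col n a"
  then obtain a where a: "A = last_col n a" by blast
  have "A = mat1 n (\<lambda>r c. if r < n \<and> c = n then a (r - 1) else 0)"
    unfolding a mat1_def last_col_def by (intro eq_matI) auto
  then show "A \<in> V_space n" by (auto simp: V_space_def)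
qed

lemma J_mat_plus_last_col:
  fixes l :: "'a::comm_ring_1"
  shows "J_mat n l + last_col n a = comp_mat n l a"
  by (intro eq_matI) (auto simp: J_mat_def e_mat_def b_mat_def mat1_def last_col_def comp_mat_def)

lemma b_mat_plus_last_col: "b_mat n + last_col n a = comp_mat n 0 a"
  by (intro eq_matI) (auto simp: b_mat_def mat1_def last_col_def comp_mat_def)

lemma comp_mat_mult_vec_index:
  assumes "v \<in> carrier_vec n" "r < n"
  shows "(comp_mat n l a *\<^sub>v v) $ r =
    (if r = 0 then l * v $ (n - 1) else v $ (r - 1)) + (if r < n - 1 then a r * v $ (n - 1) else 0)"
proof -
  have "(comp_mat n l a *\<^sub>v v) $ r = (\<Sum>c<n. (if r = c + 1 then v $ c else 0)) +
     (\<Sum>c<n. if c = n - 1 then ((if r = 0 then l else 0) +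
         (if r < n - 1 then a r else 0)) * v $ c else 0)"
  proof -
    have "(comp_mat n l a *\<^sub>v v) $ r = (\<Sum>c<n. comp_mat n l a $$ (r, c) * v $ c)"
      using assms by (simp add: scalar_prod_def lessThan_atLeast0)
    also have "\<dots> = (\<Sum>c<n. (if r = c + 1 then v $ c else 0) +
        (if c = n - 1 then ((if r = 0 then l else 0) + (if r < n
            - 1 then a r else 0)) * v $ c else 0))"
      by (intro sum.cong) (use assms(2) in \<open>auto simp: comp_mat_def algebra_simps\<close>)
    finally show ?thesis by (simp only: sum.distrib)
  qed
  also have "(\<Sum>c<n. (if r = c + 1 then v $ c else 0)) = (if r = 0 then 0 else v $ (r - 1))"
    using assms(2) sum.delta[of "{..<n}" "r - 1" "\<lambda>c. v $ c"]
    by (cases r) (auto cong: if_cong)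
  also have "(\<Sum>c<n. if c = n - 1 then ((if r = 0 then l else 0) +
      (if r < n - 1 then a r else 0)) * v $ c else 0)
      = ((if r = 0 then l else 0) + (if r < n - 1 then a r else 0)) * v $ (n - 1)"
    using assms(2) by (subst sum.delta) auto
  finally show ?thesis by (auto simp: algebra_simps)
qed

lemma comp_mat_mult_index:
  assumes "M \<in> carrier_mat n m" "r < n" "c < m"
  shows "(comp_mat n l a * M) $$ (r, c) =
    (if r = 0 then l * M $$ (n - 1, c) else M $$ (r - 1, c)) +
        (if r < n - 1 then a r * M $$ (n - 1, c) else 0)"
  using comp_mat_mult_vec_index[of "col M c" n r l a] assms by auto

lemma mult_comp_mat_index:
  assumes "M \<in> carrier_mat m n" "r < m" "c < n"
  shows "(M * comp_mat n l a) $$ (r, c) =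
    (if c < n - 1 then M $$ (r, c + 1) else l * M $$ (r, 0) + (\<Sum>i<n - 1. a i * M $$ (r, i)))"
proof -
  have "(M * comp_mat n l a) $$ (r, c) = (\<Sum>i<n. M $$ (r, i) * comp_mat n l a $$ (i, c))"
    using assms by (auto simp: scalar_prod_def lessThan_atLeast0)
  also have "\<dots> = (if c < n - 1 then M $$ (r, c + 1) else l * M $$ (r, 0) +
      (\<Sum>i<n - 1. a i * M $$ (r, i)))"
  proof (cases "c < n - 1")
    case True
    then have "(\<Sum>i<n. M $$ (r, i) * comp_mat n l a $$ (i, c)) = (\<Sum>i<n. if i =
        c + 1 then M $$ (r, i) else 0)"
      using assms by (intro sum.cong) (auto simp: comp_mat_def)
    also have "\<dots> = M $$ (r, c + 1)" using True by (subst sum.delta) auto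
    finally show ?thesis using True by simp
  next
    case False
    then have c: "c = n - 1" "n > 0" using assms by auto
    have "(\<Sum>i<n. M $$ (r, i) * comp_mat n l a $$ (i, c)) =
       (\<Sum>i<n. (if i = 0 then l * M $$ (r, i) else 0) + (if i < n
           - 1 then a i * M $$ (r, i) else 0))"
      using assms c by (intro sum.cong) (auto simp: comp_mat_def algebra_simps)
    also have "\<dots> = l * M $$ (r, 0) + (\<Sum>i<n. if i < n - 1 then a i * M $$ (r, i) else 0)"
      unfolding sum.distrib using c(2) by (subst sum.delta) auto
    also have "(\<Sum>i<n. if i < n - 1 then a i * M $$ (r, i) else 0) = (\<Sum>i<n - 1. a i * M $$ (r, i))"
      by (rule sum.mono_neutral_cong_right) auto
    finally show ?thesis using False by simp
  qed
  finally show ?thesis .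
qed

lemma (in comm_ring_hom) map_comp_mat: "map_mat hom (comp_mat n l a) =
    comp_mat n (hom l) (\<lambda>i. hom (a i))"
  by (intro eq_matI) (auto simp: comp_mat_def hom_distribs)

lemma (in derivation) mD_comp_mat:
  "D l = 0 \<Longrightarrow> mD (comp_mat n l a) = last_col n (\<lambda>i. D (a i))"
  by (intro eq_matI) (auto simp: comp_mat_def last_col_def D_add)

lemma comp_mat_power:
  assumes "m \<le> n"
  shows "comp_mat n l (\<lambda>_. 0) ^\<^sub>m m = mat n n (\<lambda>(r, c). if r = c + m then 1 else if r + n =
      c + m then l else 0)"
  using assms
proof (induction m)
  case 0
  then show ?case by (intro eq_matI) auto
next
  case (Suc m)
  let ?J = "comp_mat n l (\<lambda>_. 0)"
  have IH: "?J ^\<^sub>m m = mat n n (\<lambda>(r, c). if r = c + m then 1 else if r + n = c + m then l else 0)"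
    using Suc by simp
  show ?case
    using Suc.prems mult_comp_mat_index[of "?J ^\<^sub>m m" n n _ _ l "\<lambda>_. 0"]
    by (intro eq_matI) (auto simp: IH)
qed

lemma comp_mat_power_n: "comp_mat n l (\<lambda>_. 0) ^\<^sub>m n = l \<cdot>\<^sub>m 1\<^sub>m n"
  by (subst comp_mat_power) (auto intro!: eq_matI)

section \<open>Dressing matrices\<close>

text \<open>\<open>dress a c m\<close> is the coefficient of \<open>z^(-m)\<close> in \<open>(\<partial> + z)^c\<close> applied to
  \<open>a\<^sub>0 + a\<^sub>1 z^(-1) + a\<^sub>2 z^(-2) + \<dots>\<close>.\<close>

primrec dress :: "(nat \<Rightarrow> sfun) \<Rightarrow> nat \<Rightarrow> int \<Rightarrow> sfun" where
  "dress a 0 = (\<lambda>m. if m < 0 then 0 else a (nat m))"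
| "dress a (Suc c) = (\<lambda>m. sD (dress a c m) + dress a c (m + 1))"

lemma dress_add: "dress (\<lambda>i. a i + b i) c m = dress a c m + dress b c m"
  by (induction c arbitrary: m) (auto simp: sD.D_add)

lemma dress_low:
  assumes "\<And>i. i < \<mu> \<Longrightarrow> a i = 0" "m + int c < int \<mu>"
  shows "dress a c m = 0"
  using assms(2) by (induction c arbitrary: m) (auto simp: assms(1) nat_less_iff)

lemma dress_lead:
  assumes "\<And>i. i < \<mu> \<Longrightarrow> a i = 0"
  shows "dress a c (int \<mu> - int c) = a \<mu>"
proof (induction c)
  case (Suc c)
  have "dress a c (int \<mu> - int (Suc c)) = 0" by (rule dress_low[OF assms]) auto
  then show ?case using Suc by (simp add: algebra_simps)
qed simp

text \<open>From (\<partial> + z)^c = z^c + c z^(c-1) \<partial> + ...: the second coefficient is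
  the first place where the derivative of \<open>a \<mu>\<close> occurs. For c = n this is the term
  that gets integrated.\<close>

lemma dress_sublead:
  assumes "\<And>i. i < \<mu> \<Longrightarrow> a i = 0"
  shows "dress a c (int \<mu> + 1 - int c) = a (Suc \<mu>) + of_nat c * sD (a \<mu>)"
proof (induction c)
  case (Suc c)
  have "dress a (Suc c) (int \<mu> + 1 - int (Suc c)) = sD (dress a c (int \<mu> - int c)) +
      dress a c (int \<mu> + 1 - int c)"
    by (simp add: algebra_simps)
  moreover have "dress a c (int \<mu> - int c) = a \<mu>" by (rule dress_lead) (rule assms)
  ultimately show ?case unfolding Suc by (simp add: algebra_simps)
qed (simp add: nat_add_distrib)

text \<open>The formal wave function exp(x z) (a_0 + a_1 z^(-1) + ...) solves \<partial>^n \<psi> =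
  \<Sum> U_i \<partial>^i \<psi> + z^n \<psi>. In the coefficient of z^(n-1-\<mu>) the term
  a_(\<mu>+1) cancels and n a_\<mu>' is expressed by earlier coefficients, because the operator has
  no term of order n - 1. One antiderivative per coefficient remains.\<close>

lemma wave_function_exists:
  fixes U :: "nat \<Rightarrow> sfun"
  assumes n: "n > 0"
  obtains a where "a 0 = 1"
    "\<And>m. dress a n m = dress a 0 (m + int n) + (\<Sum>i<n - 1. U i * dress a i m)"
proof -
  \<comment> \<open>Truncation below \<mu> makes the right-hand side depend on earlier coefficients
    only, so that well-founded recursion applies.\<close>
  define cut :: "(nat \<Rightarrow> sfun) \<Rightarrow> nat \<Rightarrow> nat \<Rightarrow> sfun"
    where "cut a \<mu> = (\<lambda>i. if i < \<mu> then a i else 0)" for a \<mu>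
  define rhs where "rhs a \<mu> = (\<Sum>i<n - 1. U i * dress (cut a \<mu>) i (int \<mu> + 1 - int n))
      - dress (cut a \<mu>) n (int \<mu> + 1 - int n)" for a \<mu>
  define \<Phi> where "\<Phi> a \<mu> = (if \<mu> = 0 then 1 else sI (sC (1 / real n) * rhs a \<mu>))" for a \<mu>
  have "adm_wf less_than \<Phi>"
  proof (unfold adm_wf_def, intro allI impI)
    fix f g :: "nat \<Rightarrow> sfun" and \<mu>
    assume "\<forall>z. (z, \<mu>) \<in> less_than \<longrightarrow> f z = g z"
    then have "cut f \<mu> = cut g \<mu>" by (auto simp: cut_def)
    then show "\<Phi> f \<mu> = \<Phi> g \<mu>" by (simp add: \<Phi>_def rhs_def)
  qed
  from wfrec_fixpoint[OF wf_less_than this] obtain a where a: "a = \<Phi> a" by metis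
  have a0: "a 0 = 1" using a by (metis \<Phi>_def)
  have Da: "of_nat n * sD (a \<mu>) = rhs a \<mu>" for \<mu>
  proof (cases "\<mu> = 0")
    case True
    \<comment> \<open>\<open>a 0 = 1\<close> is a normalization and not an antiderivative, so the
      equation at \<mu> = 0 is checked separately: both sides vanish.\<close>
    have "dress (cut a 0) c m = 0" for c m
      by (rule dress_low[of "nat (m + int c) + 1"]) (auto simp: cut_def)
    then show ?thesis using True a0 by (simp add: rhs_def)
  next
    case False
    then have "a \<mu> = sI (sC (1 / real n) * rhs a \<mu>)" using a by (metis \<Phi>_def)
    then show ?thesis using n by (auto intro!: sfun_eqI)
  qed
  have "dress a n m = dress a 0 (m + int n) + (\<Sum>i<n - 1. U i * dress a i m)" for m
  \<comment> \<open>These are the powers z^n and above: at z^n both sides equal \<open>a 0\<close>,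
    beyond it they are 0.\<close>
  proof (cases "m + int n - 1 < 0")
    case True
    have z: "dress a i m = 0" if "m + int i < 0" for i
      using that by (intro dress_low[of 0]) auto
    have s: "(\<Sum>i<n - 1. U i * dress a i m) = 0"
      using True by (intro sum.neutral) (auto simp: z)
    show ?thesis
    proof (cases "m + int n < 0")
      case False
      with True have "m = int 0 - int n" by simp
      then show ?thesis using s dress_lead[of 0 a n] by simp
    qed (use s z in simp)
  next
    case False
    define \<mu> where "\<mu> = nat (m + int n - 1)"
    have m: "m = int \<mu> + 1 - int n" using False by (simp add: \<mu>_def)
    \<comment> \<open>The tail from \<mu> on reaches this power only through orders at least n - 1.
      It is therefore invisible in the sum over U, and on the left it gives the two terms of
      \<open>dress_sublead\<close>.\<close>
    define r where "r i = (if i < \<mu> then 0 else a i)" for i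
    have ar: "a = (\<lambda>i. cut a \<mu> i + r i)" by (auto simp: cut_def r_def)
    have split: "dress a c m' = dress (cut a \<mu>) c m' + dress r c m'" for c m'
      by (subst ar, rule dress_add)
    have r: "r i = 0" if "i < \<mu>" for i using that by (simp add: r_def)
    have "dress a n m = dress (cut a \<mu>) n m + (a (Suc \<mu>) + of_nat n * sD (a \<mu>))"
      unfolding split m using dress_sublead[of \<mu> r n, OF r] by (simp add: r_def)
    moreover have "dress a i m = dress (cut a \<mu>) i m" if "i < n - 1" for i
      unfolding split using that dress_low[of \<mu> r m i, OF r] by (simp add: m)
    moreover have "dress a 0 (m + int n) = a (Suc \<mu>)"
      by (simp add: m nat_add_distrib)
    ultimately show ?thesis unfolding Da rhs_def by (simp add: m)
  qed
  with a0 that show ?thesis by blast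
qed

text \<open>A power series with constant term 1 is a unit over any commutative ring, so the adjugate
  can be divided by the determinant.\<close>

lemma fps_mat_unit:
  fixes P :: "'a::comm_ring_1 fps mat"
  assumes P: "P \<in> carrier_mat n n" and d: "fps_nth (det P) 0 = 1"
  obtains Q where "Q \<in> carrier_mat n n" "P * Q = 1\<^sub>m n" "Q * P = 1\<^sub>m n"
proof -
  define q where "q = fps_right_inverse (det P) 1"
  have q: "det P * q = 1" unfolding q_def using d by (intro fps_right_inverse) simp
  note A = adj_mat[OF P]
  have "P * (q \<cdot>\<^sub>m adj_mat P) = 1\<^sub>m n" "(q \<cdot>\<^sub>m adj_mat P) * P = 1\<^sub>m n"
    using A q P by (auto simp: mult_smult_distrib[OF P] smult_smult_assoc[symmetric] mult.commute
        mult_smult_assoc_mat[OF A(1) P] intro!: eq_matI)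
  then show ?thesis using that[of "q \<cdot>\<^sub>m adj_mat P"] A(1) by simp
qed

interpretation fps_to_fls: comm_ring_hom "fps_to_fls :: 'a::comm_ring_1 fps \<Rightarrow> 'a fls"
  by standard (auto simp: fls_times_fps_to_fls)

interpretation fps_nth_0: comm_ring_hom "\<lambda>f :: 'a::comm_ring_1 fps. fps_nth f 0"
  by standard auto

text \<open>Column c of P comes from (\<partial> + z)^c a, sorted by residues of the powers of z: it
  is \<Sum> z^r P_rc with P_rc a series in \<lambda> = z^n. The row (1, z, ..., z^(n-1)) is a left
  eigenvector of J with eigenvalue z, so P_x + J P applies \<partial> + z once more, which moves
  each column to the next; in the last column the wave equation supplies J + u.\<close>

lemma dressing_exists:
  fixes U :: "nat \<Rightarrow> sfun"
  assumes n: "n > 0"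
  obtains P Q :: "sfun fps mat" where
    "P \<in> carrier_mat n n" "Q \<in> carrier_mat n n" "P * Q = 1\<^sub>m n" "Q * P = 1\<^sub>m n"
    "\<And>r. r < n \<Longrightarrow> fps_nth (P $$ (r, 0)) 0 = (if r = 0 then 1 else 0)"
    "\<And>c. c < n \<Longrightarrow> fps_nth (P $$ (n - 1, c)) 0 = (if c = n - 1 then 1 else 0)"
    "map_mat (fls_map sD) (map_mat fps_to_fls P) + comp_mat n fls_X_inv (\<lambda>_. 0) *
        map_mat fps_to_fls P
      = map_mat fps_to_fls P * comp_mat n fls_X_inv (\<lambda>i. fls_const (U i))"
proof -
  obtain a where a0: "a 0 = 1" and a: "\<And>m. dress a n m = dress a 0 (m + int n) +
      (\<Sum>i<n - 1. U i * dress a i m)"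
    using wave_function_exists[OF n, of U] by blast
  define P where "P = mat n n (\<lambda>(r, c). Abs_fps (\<lambda>i. dress a c (int n * int i - int r)))"
  define P' where "P' = map_mat fps_to_fls P"
  have P: "P \<in> carrier_mat n n" by (simp add: P_def)
  have P': "P' \<in> carrier_mat n n" by (simp add: P'_def P_def)
  have P'_nth: "fls_nth (P' $$ (r, c)) i = dress a c (int n * i - int r)"
      if "r < n" "c < n" for r c i
  proof (cases "i < 0")
    case True
    then have "int n * i \<le> int n * (-1)" by (intro mult_left_mono) auto
    then have "dress a c (int n * i - int r) = 0"
      using that by (intro dress_low[of 0]) auto
    then show ?thesis using that True by (simp add: P'_def P_def)
  qed (use that in \<open>simp add: P'_def P_def\<close>)
  \<comment> \<open>At order 0 in 1/\<lambda> the matrix is unipotent upper triangular, since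
    (\<partial> + z)^c a has degree c in z with leading coefficient \<open>a 0 = 1\<close>.\<close>
  have P0: "fps_nth (P $$ (r, c)) 0 = (if r = c then 1 else 0)" if "r < n" "c \<le> r" for r c
    using that dress_low[of 0 a "- int r" c] dress_lead[of 0 a c] a0 by (auto simp: P_def)
  have "fps_nth (det P) 0 = 1"
  proof -
    let ?M = "map_mat (\<lambda>f. fps_nth f 0) P"
    have "upper_triangular ?M" using P P0 by (auto simp: upper_triangular_def)
    then have "det ?M = prod_list (diag_mat ?M)" using P by (intro det_upper_triangular) auto
    also have "diag_mat ?M = map (\<lambda>i. 1) [0..<n]"
      using P P0 by (auto simp: diag_mat_def intro!: map_cong)
    also have "prod_list \<dots> = 1" by (simp add: map_replicate_const)
    finally show ?thesis by (simp add: fps_nth_0.hom_det)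
  qed
  then obtain Q where Q: "Q \<in> carrier_mat n n" "P * Q = 1\<^sub>m n" "Q * P = 1\<^sub>m n"
    using fps_mat_unit[OF P] by blast
  have "map_mat (fls_map sD) P' + comp_mat n fls_X_inv (\<lambda>_. 0) * P'
      = P' * comp_mat n fls_X_inv (\<lambda>i. fls_const (U i))" (is "?L = ?R")
  proof (rule eq_matI)
    fix r c assume "r < dim_row ?R" "c < dim_col ?R"
    then have rc: "r < n" "c < n" using P' by auto
    show "?L $$ (r, c) = ?R $$ (r, c)"
    proof (rule fls_eqI)
      fix i
      have *: "fls_nth (?L $$ (r, c)) i = dress a (Suc c) (int n * i - int r)"
      proof (cases "r = 0")
        case True
        have m: "int n * (i + 1) - (int n - 1) = int n * i + 1" by (simp add: algebra_simps)
        show ?thesis using rc P' True n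
          by (simp add: comp_mat_mult_index[OF P'] P'_nth fls_X_inv_mult_nth of_nat_diff m del:
              index_mult_mat(1))
      next
        case False
        then show ?thesis using rc P'
          by (simp add: comp_mat_mult_index[OF P'] P'_nth of_nat_diff algebra_simps del:
              index_mult_mat(1))
      qed
      have **: "fls_nth (?R $$ (r, c)) i = dress a (Suc c) (int n * i - int r)"
      proof (cases "c < n - 1")
        case True
        then show ?thesis using rc P'_nth[of r "c + 1" i]
            by (simp add: mult_comp_mat_index[OF P'] del: index_mult_mat(1))
      next
        case False
        then have c: "Suc c = n" using rc by simp
        have "fls_nth (?R $$ (r, c)) i = dress a 0 (int n * (i + 1) - int r) +
            (\<Sum>i'<n - 1. U i' * dress a i' (int n * i - int r))"
          using rc False by (simp add: mult_comp_mat_index[OF P'] P'_nth fls_X_inv_mult_nth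
              fls_nth_sum
              del: dress.simps index_mult_mat(1))
        then show ?thesis unfolding c a by (simp add: algebra_simps)
      qed
      show "fls_nth (?L $$ (r, c)) i = fls_nth (?R $$ (r, c)) i" unfolding * ** ..
    qed
  qed (use P' in auto)
  then show ?thesis
    using that[OF P Q(1,2,3)] P0 n by (auto simp: P'_def)
qed

section \<open>The centralizer of the cyclic element\<close>

lemma int_pred_div_mod:
  fixes p :: int assumes "n > 0"
  shows "(p - 1) div int n = (if p mod int n = 0 then p div int n - 1 else p div int n)"
    "(p - 1) mod int n = (if p mod int n = 0 then int n - 1 else p mod int n - 1)"
proof -
  define q r where "q = p div int n" and "r = p mod int n"
  have p: "p = int n * q + r" "0 \<le> r" "r < int n" using assms by (auto simp: q_def r_def)
  show "(p - 1) div int n = (if p mod int n = 0 then p div int n - 1 else p div int n)"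
    unfolding q_def[symmetric] r_def[symmetric]
    by (cases "r = 0") (rule int_div_pos_eq[of _ _ _ "if r =
        0 then int n - 1 else r - 1"]; use p in \<open>simp add: algebra_simps\<close>)+
  show "(p - 1) mod int n = (if p mod int n = 0 then int n - 1 else p mod int n - 1)"
    unfolding r_def[symmetric]
    by (cases "r = 0") (rule int_mod_pos_eq[of _ _ "if r =
        0 then q - 1 else q"]; use p in \<open>simp add: algebra_simps\<close>)+
qed

text \<open>A matrix of Laurent series is an \<open>n\<close>-periodic matrix indexed by the integers, with the
  cyclic element acting as the shift; along each diagonal the equation telescopes over a period.\<close>

lemma centralizer:
  fixes C :: "sfun fls mat"
  assumes n: "n > 0" and C: "C \<in> carrier_mat n n"
    and eq: "map_mat (fls_map sD) C + comp_mat n fls_X_inv (\<lambda>_. 0) * C =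
        C * comp_mat n fls_X_inv (\<lambda>_. 0)"
  shows "comp_mat n fls_X_inv (\<lambda>_. 0) * C = C * comp_mat n fls_X_inv (\<lambda>_. 0)"
proof -
  let ?J = "comp_mat n fls_X_inv (\<lambda>_. 0) :: sfun fls mat"
  \<comment> \<open>The periodic matrix: row p and column q are reduced modulo n, and the difference
    of the two quotients is the power of 1/\<lambda>.\<close>
  define G where "G p q = fls_nth (C $$ (nat (p mod int n), nat (q mod int n))) (q div int n
      - p div int n)"
    for p q :: int
  have G_eq: "sD (G p q) + G (p - 1) q = G p (q + 1)" for p q
  proof -
    define r c i where "r = nat (p mod int n)" and "c = nat (q mod int n)" and "i =
        q div int n - p div int n"
    have rc: "r < n" "c < n" using n by (auto simp: r_def c_def nat_less_iff)
    have r: "p mod int n = int r" and c: "q mod int n = int c" using n by (auto simp: r_def c_def)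
    have L: "fls_nth ((?J * C) $$ (r, c)) i = G (p - 1) q"
      using rc n unfolding comp_mat_mult_index[OF C rc]
      by (auto simp: G_def int_pred_div_mod[OF n] r c fls_X_inv_mult_nth nat_diff_distrib i_def
          algebra_simps)
    have c': "q mod int n = (if int n dvd q + 1 then int n - 1 else (q + 1) mod int n - 1)"
        "q div int n = (if int n dvd q + 1 then (q + 1) div int n - 1 else (q + 1) div int n)"
      using int_pred_div_mod[OF n, of "q + 1"] by (simp_all add: dvd_eq_mod_eq_0)
    have R: "fls_nth ((C * ?J) $$ (r, c)) i = G p (q + 1)"
    proof (cases "int n dvd q + 1")
      case True
      then have "c = n - 1" "(q + 1) div int n = q div int n + 1" "(q + 1) mod int n = 0"
        using c' c n by auto
      then show ?thesis using rc unfolding mult_comp_mat_index[OF C rc]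
        by (simp add: G_def r fls_X_inv_mult_nth i_def algebra_simps)
    next
      case False
      then have c'': "(q + 1) mod int n = int (c + 1)" "(q + 1) div int n = q div int n"
          using c' c by auto
      then have "c + 1 < n" using pos_mod_bound[of "int n" "q + 1"] n by linarith
      then show ?thesis using rc c'' unfolding mult_comp_mat_index[OF C rc]
        by (simp add: G_def r i_def nat_add_distrib)
    qed
    have "fls_nth ((map_mat (fls_map sD) C + ?J * C) $$ (r, c)) i =
        sD (G p q) + fls_nth ((?J * C) $$ (r, c)) i"
      using C rc by (simp add: G_def r_def c_def i_def)
    then show ?thesis unfolding eq L R by simp
  qed
  \<comment> \<open>All diagonals q - p = m with m < N vanish, which starts the induction over
    diagonals.\<close>
  obtain N where N: "\<And>p q. q - p < N \<Longrightarrow> G p q = 0"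
  proof -
    define B where "B = Min ((\<lambda>rc. fls_subdegree (C $$ rc)) ` ({..<n} \<times> {..<n}))"
    have B: "fls_nth (C $$ (r, c)) i = 0" if "r < n" "c < n" "i < B" for r c i
    proof (rule fls_eq0_below_subdegree)
      have "B \<le> fls_subdegree (C $$ (r, c))" unfolding B_def using that by (intro Min_le) auto
      then show "i < fls_subdegree (C $$ (r, c))" using that by simp
    qed
    show ?thesis
    proof (rule that[of "int n * (B - 1)"])
      fix p q :: int assume pq: "q - p < int n * (B - 1)"
      have "int n * (q div int n - p div int n) = (q - q mod int n) - (p - p mod int n)"
        unfolding minus_mod_eq_mult_div by (simp add: algebra_simps)
      moreover have "q mod int n \<ge> 0" "p mod int n < int n" using n by auto
      moreover have "int n * (B - 1) = int n * B - int n" by (simp add: algebra_simps)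
      ultimately have "int n * (q div int n - p div int n) < int n * B"
        using pq by linarith
      then have "q div int n - p div int n < B" using n by simp
      then show "G p q = 0" unfolding G_def using n by (intro B) (auto simp: nat_less_iff)
    qed
  qed
  have per: "G (p + int n) (q + int n) = G p q" for p q
    using n by (simp add: G_def)
  \<comment> \<open>On a constant diagonal the n derivatives over one period add up to
    \<open>K (n - 1) - K (- 1)\<close>, and this is 0 by periodicity.\<close>
  have zero: "sD (G p (p + m)) = 0" if H: "\<And>p. G p (p + m) = G 0 m" for m p
  proof -
    define K where "K p = G p (p + m + 1)" for p
    have K: "sD (G p (p + m)) = K p - K (p - 1)" for p
      using G_eq[of p "p + m"] by (simp add: K_def algebra_simps)
    have "(\<Sum>i<n'. sD (G (int i) (int i + m))) = K (int n' - 1) - K (- 1)" for n'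
      unfolding K by (induction n') (auto simp: algebra_simps)
    moreover have "K (int n - 1) = K (- 1)"
      using per[of "-1" "m"] by (simp add: K_def algebra_simps)
    ultimately have "(\<Sum>i<n. sD (G (int i) (int i + m))) = 0" by simp
    then have "of_nat n * sD (G 0 m) = 0" unfolding H by simp
    then show ?thesis unfolding H using sfun_of_nat_cancel[OF n] by blast
  qed
  \<comment> \<open>Induction over m: once diagonal m is constant along its length, its x-derivative
    vanishes, and the equation says that diagonal m + 1 is constant along its length too.\<close>
  have H: "\<forall>p. G p (p + m) = G 0 m" for m
  proof (cases "m < N")
    case False
    then have "N - 1 \<le> m" by simp
    then show ?thesis
    proof (induction m rule: int_ge_induct)
      case (step m)
      have s: "G p (p + (m + 1)) = G (p - 1) ((p - 1) + (m + 1))" for p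
        using G_eq[of p "p + m"] zero[of m p] step by (simp add: algebra_simps)
      show ?case
      proof
        fix p show "G p (p + (m + 1)) = G 0 (m + 1)"
        proof (induction p rule: int_induct[of _ 0])
          case (step1 i)
          then show ?case using s[of "i + 1"] by simp
        next
          case (step2 i)
          then show ?case using s[of i] by simp
        qed simp
      qed
    qed (use N in auto)
  qed (use N in auto)
  have "map_mat (fls_map sD) C = 0\<^sub>m n n"
  proof (rule eq_matI)
    fix r c assume "r < dim_row (0\<^sub>m n n :: sfun fls mat)" "c < dim_col (0\<^sub>m n n :: sfun fls mat)"
    then have rc: "r < n" "c < n" by auto
    have "sD (fls_nth (C $$ (r, c)) i) = 0" for i
      using zero[of "int c + int n * i - int r" "int r"] H rc n by (simp add: G_def)
    then show "map_mat (fls_map sD) C $$ (r, c) = 0\<^sub>m n n $$ (r, c)"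
      using rc C by (auto intro!: fls_eqI)
  qed (use C in auto)
  moreover have "?J * C \<in> carrier_mat n n" using C by (intro mult_carrier_mat[of _ n n]) auto
  ultimately show ?thesis using eq by simp
qed

section \<open>The series \<open>Y\<close>\<close>

abbreviation (input) cyc :: "nat \<Rightarrow> 'a::comm_ring_1 fls mat" where
  "cyc n \<equiv> comp_mat n fls_X_inv (\<lambda>_. 0)"

abbreviation (input) lax :: "nat \<Rightarrow> (nat \<Rightarrow> 'a::comm_ring_1) \<Rightarrow> 'a fls mat" where
  "lax n U \<equiv> comp_mat n fls_X_inv (\<lambda>i. fls_const (U i))"

text \<open>P carries the Lax operator \<partial> + J + u to \<partial> + J. The first column and
  the last row at order 0 are recorded because they fix the leading coefficient of Y.\<close>

definition dressing :: "nat \<Rightarrow> (nat \<Rightarrow> sfun) \<Rightarrow> sfun fls mat \<Rightarrow> sfun fls mat \<Rightarrow> bool" where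
  "dressing n U P Q \<longleftrightarrow> P \<in> carrier_mat n n \<and> Q \<in> carrier_mat n n \<and> P * Q = 1\<^sub>m n \<and> Q * P = 1\<^sub>m n \<and>
     (\<forall>r<n. \<forall>c<n. \<forall>i<0. fls_nth (P $$ (r, c)) i = 0 \<and> fls_nth (Q $$ (r, c)) i = 0) \<and>
     (\<forall>r<n. fls_nth (P $$ (r, 0)) 0 = (if r = 0 then 1 else 0)) \<and>
     (\<forall>c<n. fls_nth (P $$ (n - 1, c)) 0 = (if c = n - 1 then 1 else 0)) \<and>
     map_mat (fls_map sD) P + cyc n * P = P * lax n U"

lemma dressing_ex:
  assumes "n > 0"
  shows "\<exists>P Q. dressing n U P Q"
proof -
  obtain P Q :: "sfun fps mat" where *: "P \<in> carrier_mat n n" "Q \<in> carrier_mat n n" "P * Q =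
      1\<^sub>m n" "Q * P = 1\<^sub>m n"
    "\<And>r. r < n \<Longrightarrow> fps_nth (P $$ (r, 0)) 0 = (if r = 0 then 1 else 0)"
    "\<And>c. c < n \<Longrightarrow> fps_nth (P $$ (n - 1, c)) 0 = (if c = n - 1 then 1 else 0)"
    "map_mat (fls_map sD) (map_mat fps_to_fls P) + cyc n * map_mat fps_to_fls P =
        map_mat fps_to_fls P * lax n U"
    using dressing_exists[OF assms, of U] by blast
  have "dressing n U (map_mat fps_to_fls P) (map_mat fps_to_fls Q)"
    unfolding dressing_def
    using * assms fps_to_fls.mat_hom_mult[OF *(1,2)] fps_to_fls.mat_hom_mult[OF *(2,1)]
    by (auto simp: fps_to_fls.mat_hom_one)
  then show ?thesis by blast
qed

lemma sDf_X_inv [simp]: "fls_map sD fls_X_inv = 0"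
  by (intro fls_eqI) auto

lemma sDf_const [simp]: "fls_map sD (fls_const a) = fls_const (sD a)"
  by (intro fls_eqI) auto

lemma sDf_cyc: "map_mat (fls_map sD) (cyc n) = 0\<^sub>m n n"
  by (subst sDf.mD_comp_mat) (auto simp: last_col_def intro!: eq_matI)

context
  fixes n U P Q
  assumes dr: "dressing n U P Q"
begin

private lemma C: "P \<in> carrier_mat n n" "Q \<in> carrier_mat n n" "P * Q = 1\<^sub>m n" "Q * P = 1\<^sub>m n"
  using dr by (auto simp: dressing_def)

private lemmas cancel = sq_cancel[OF C(1,2) _ C(3)] sq_cancel[OF C(2,1) _ C(4)]

lemma dressing_D:
  "map_mat (fls_map sD) P = P * lax n U - cyc n * P"
  using dr C by (intro sq_move) (auto simp: dressing_def sq_carrier)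

lemma dressing_D_inverse:
  "map_mat (fls_map sD) Q = Q * cyc n - lax n U * Q"
proof -
  let ?D = "map_mat (fls_map sD)"
  have c: "?D P \<in> carrier_mat n n" "?D Q \<in> carrier_mat n n" using C by auto
  have "?D P * Q + P * ?D Q = 0\<^sub>m n n"
    using sDf.mD_mult[OF C(1,2)] C(3) by simp
  then have "P * ?D Q + ?D P * Q = 0\<^sub>m n n"
    using c C by (simp add: comm_add_mat[of "P * ?D Q" n n])
  then have "P * ?D Q = 0\<^sub>m n n - ?D P * Q" using c C by (intro sq_move) (auto simp: sq_carrier)
  then have "Q * (P * ?D Q) = Q * (0\<^sub>m n n - ?D P * Q)" by simp
  also have "Q * (P * ?D Q) = ?D Q"
    using C c by (simp flip: assoc_mult_mat[of Q n n P n _ n])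
  also have "Q * (0\<^sub>m n n - ?D P * Q) = 0\<^sub>m n n - Q * (?D P * Q)"
    using C c by (simp add: sq_simps[of _ n] sq_carrier)
  also have "Q * (?D P * Q) = lax n U * Q - Q * cyc n"
    unfolding dressing_D using C by (simp add: sq_simps[of _ n] sq_carrier cancel)
  also have "0\<^sub>m n n - (lax n U * Q - Q * cyc n) = Q * cyc n - lax n U * Q"
    using C by (intro eq_matI) (auto simp del: index_mult_mat(1))
  finally show ?thesis .
qed

lemma Y_conj_carrier: "Q * cyc n * P \<in> carrier_mat n n"
  using C by (auto simp: sq_carrier)

text \<open>J is constant in x and hence commutes with \<partial> + J; conjugation by P turns this
  into the equation for \<partial> + J + u.\<close>

lemma Y_conj_flat:
  "map_mat (fls_map sD) (Q * cyc n * P) = (Q * cyc n * P) * lax n U - lax n U * (Q * cyc n * P)"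
proof -
  have "map_mat (fls_map sD) (Q * cyc n * P) =
      (map_mat (fls_map sD) Q * cyc n) * P + (Q * cyc n) * map_mat (fls_map sD) P"
    using C by (simp add: sDf.mD_mult[of _ n n _ n] sDf_cyc sq_carrier)
  also have "\<dots> = (Q * cyc n * P) * lax n U - lax n U * (Q * cyc n * P)"
    unfolding dressing_D dressing_D_inverse using C
    by (simp add: sq_simps[of _ n] sq_carrier) (intro eq_matI; auto simp del: index_mult_mat(1))
  finally show ?thesis .
qed

lemma Y_conj_power: "(Q * cyc n * P) ^\<^sub>m n = fls_X_inv \<cdot>\<^sub>m 1\<^sub>m n"
proof -
  have "(Q * cyc n * P) ^\<^sub>m n = Q * (fls_X_inv \<cdot>\<^sub>m 1\<^sub>m n) * P"
    using C by (subst sq_pow_conj) (auto simp: comp_mat_power_n)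
  also have "Q * (fls_X_inv \<cdot>\<^sub>m 1\<^sub>m n) = fls_X_inv \<cdot>\<^sub>m Q"
    using mult_smult_distrib[OF C(2) one_carrier_mat, of fls_X_inv] C(2) by simp
  also have "fls_X_inv \<cdot>\<^sub>m Q * P = fls_X_inv \<cdot>\<^sub>m (Q * P)"
    by (rule mult_smult_assoc_mat[OF C(2,1)])
  finally show ?thesis using C by simp
qed

lemma Y_conj_trace:
  assumes n: "n \<ge> 2"
  shows "mat_trace (Q * cyc n * P) = 0"
proof -
  have "mat_trace (Q * cyc n * P) = mat_trace (P * (Q * cyc n))"
    using C by (intro mat_trace_comm) (auto simp: sq_carrier)
  also have "P * (Q * cyc n) = cyc n"
    using C by (simp flip: assoc_mult_mat[of P n n Q n _ n])
  also have "mat_trace (cyc n :: sfun fls mat) = 0"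
    using n by (auto simp: mat_trace_def comp_mat_def intro!: sum.neutral)
  finally show ?thesis .
qed

text \<open>\<lambda> sits only in the corner of J, so the positive power in P^(-1) J P comes from
  column 0 of P^(-1) times row n - 1 of P, both unit vectors at order 0.\<close>

lemma Y_conj_leading:
  assumes n: "n \<ge> 2" and rc: "r < n" "c < n" and i: "i < 0"
  shows "fls_nth ((Q * cyc n * P) $$ (r, c)) i = (if r = 0 \<and> c = n - 1 \<and> i = -1 then 1 else 0)"
proof -
  have van: "fls_nth (f * g) m = 0" if "\<And>i. i < 0 \<Longrightarrow> fls_nth f i = 0" "\<And>i. i < 0 \<Longrightarrow>
      fls_nth g i = 0" "m < 0"
    for f g :: "sfun fls" and m
    using fls_mult_nth_bounded[of 0 f 0 g m] that by simp
  have at0: "fls_nth (f * g) 0 = fls_nth f 0 * fls_nth g 0"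
    if "\<And>i. i < 0 \<Longrightarrow> fls_nth f i = 0" "\<And>i. i < 0 \<Longrightarrow> fls_nth g i = 0"
    for f g :: "sfun fls"
    using fls_mult_nth_bounded[of 0 f 0 g 0] that by simp
  have PQ: "fls_nth (P $$ (r, c)) i = 0" "fls_nth (Q $$ (r, c)) i = 0"
      if "r < n" "c < n" "i < 0" for r c i
    using dr that by (auto simp: dressing_def)
  have CP: "cyc n * P \<in> carrier_mat n n" using C by (simp add: sq_carrier)
  have "Q * cyc n * P = Q * (cyc n * P)" using C by (simp add: sq_simps[of _ n])
  then have "(Q * cyc n * P) $$ (r, c) = (\<Sum>l<n. Q $$ (r, l) * (cyc n * P) $$ (l, c))"
    using rc C CP by (simp add: scalar_prod_def lessThan_atLeast0 del: index_mult_mat(1))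
      (simp add: index_mult_mat(1)[of r Q c "cyc n * P"] scalar_prod_def lessThan_atLeast0 del:
          index_mult_mat(1))
  also have "\<dots> = (\<Sum>l<n. if l = 0 then fls_X_inv * (Q $$ (r, 0) * P $$ (n
      - 1, c)) else Q $$ (r, l) * P $$ (l - 1, c))"
    using rc by (intro sum.cong) (simp_all add: comp_mat_mult_index[OF C(1)] del: index_mult_mat(1))
  also have "\<dots> = fls_X_inv * (Q $$ (r, 0) * P $$ (n - 1, c)) +
      (\<Sum>l\<in>{..<n} - {0}. Q $$ (r, l) * P $$ (l - 1, c))"
    using n by (subst sum.remove[of _ 0]) auto
  finally have *: "(Q * cyc n * P) $$ (r, c) = \<dots>" .
  have "fls_nth (\<Sum>l\<in>{..<n} - {0}. Q $$ (r, l) * P $$ (l - 1, c)) i = 0"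
    unfolding fls_nth_sum using rc i by (intro sum.neutral ballI van PQ) auto
  then have "fls_nth ((Q * cyc n * P) $$ (r, c)) i = fls_nth (Q $$ (r, 0) * P $$ (n - 1, c)) (i +
      1)"
    unfolding * by (simp add: fls_X_inv_mult_nth)
  also have "\<dots> = (if r = 0 \<and> c = n - 1 \<and> i = -1 then 1 else 0)"
  proof (cases "i = -1")
    case True
    \<comment> \<open>At order 0, \<open>Q * P = 1\<close> applied to the first unit vector: P fixes
      it, hence so does Q.\<close>
    have "fls_nth (Q $$ (r, 0)) 0 = (if r = 0 then 1 else 0)"
    proof -
      have "(if r = 0 then 1 else 0) = fls_nth ((Q * P) $$ (r, 0)) 0"
        unfolding C(4) using rc n by simp
      also have "(Q * P) $$ (r, 0) = (\<Sum>l<n. Q $$ (r, l) * P $$ (l, 0))"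
        using C(1,2) rc n by (simp add: scalar_prod_def lessThan_atLeast0)
      also have "fls_nth \<dots> 0 = (\<Sum>l<n. fls_nth (Q $$ (r, l)) 0 * fls_nth (P $$ (l, 0)) 0)"
        unfolding fls_nth_sum using rc n by (intro sum.cong at0 PQ) auto
      also have "\<dots> = (\<Sum>l<n. if l = 0 then fls_nth (Q $$ (r, l)) 0 else 0)"
        using dr by (intro sum.cong) (auto simp: dressing_def)
      also have "\<dots> = fls_nth (Q $$ (r, 0)) 0" using n by (subst sum.delta) auto
      finally show ?thesis ..
    qed
    moreover have "fls_nth (P $$ (n - 1, c)) 0 = (if c = n - 1 then 1 else 0)"
      using dr rc by (auto simp: dressing_def)
    ultimately show ?thesis
      using True rc n at0[of "Q $$ (r, 0)" "P $$ (n - 1, c)"] PQ by simp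
  next
    case False
    then have "i + 1 < 0" using i by simp
    then show ?thesis using False van[of "Q $$ (r, 0)" "P $$ (n - 1, c)" "i + 1"] PQ rc n by simp
  qed
  finally show ?thesis .
qed

end

section \<open>Roots in the centralizer\<close>

text \<open>For \<open>\<lambda> = z^n\<close> the row \<open>(1, z, \<dots>, z^(n-1))\<close> is a left eigenvector of the cyclic element, with
  eigenvalue \<open>z\<close>; \<open>zrow\<close> is the product of this row with a matrix.\<close>

definition zrow :: "nat \<Rightarrow> real fls mat \<Rightarrow> nat \<Rightarrow> real fls" where
  "zrow n A c = (\<Sum>r<n. fls_X_inv ^ r * fls_compose_power (A $$ (r, c)) n)"

definition zeigen :: "nat \<Rightarrow> real fls mat \<Rightarrow> real fls \<Rightarrow> bool" where
  "zeigen n A \<alpha> \<longleftrightarrow> (\<forall>c<n. zrow n A c = \<alpha> * fls_X_inv ^ c)"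

lemma fls_compose_power_sum: "fls_compose_power (\<Sum>i\<in>I. f i) d = (\<Sum>i\<in>I. fls_compose_power (f i) d)"
  by (induction I rule: infinite_finite_induct) auto

text \<open>For 0 \<le> r < n the exponents r - n i are distinct for distinct pairs (r, i), so no
  information is lost when a column of series in \<lambda> is folded into one series in z.\<close>

lemma zrow_nth:
  assumes "r < n" "A \<in> carrier_mat n n" "c < n"
  shows "fls_nth (zrow n A c) (int n * i - int r) = fls_nth (A $$ (r, c)) i"
proof -
  have n: "n > 0" using assms by simp
  have "fls_nth (zrow n A c) (int n * i - int r) =
    (\<Sum>r'<n. if r' = r then fls_nth (A $$ (r, c)) i else 0)"
    unfolding zrow_def fls_nth_sum
  proof (intro sum.cong refl)
    fix r' assume r': "r' \<in> {..<n}"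
    show "fls_nth (fls_X_inv ^ r' * fls_compose_power (A $$ (r', c)) n) (int n * i - int r) =
      (if r' = r then fls_nth (A $$ (r, c)) i else 0)"
    proof (cases "r' = r")
      case True
      then show ?thesis using n by (simp add: fls_X_inv_power_times_conv_shift
          fls_nth_compose_power)
    next
      case False
      have "\<not> int n dvd int n * i - int r + int r'"
      proof
        assume "int n dvd int n * i - int r + int r'"
        then have "int n dvd int n * i + (int r' - int r)" by (simp add: algebra_simps)
        then have *: "int n dvd int r' - int r" by (simp add: dvd_add_right_iff)
        have "\<bar>int r' - int r\<bar> < int n" using r' assms(1) by auto
        with * have "int r' - int r = 0" using dvd_imp_le_int[of "int r' - int r" "int n"] by auto
        then show False using False by simp
      qed
      then show ?thesis using False n by (simp add: fls_X_inv_power_times_conv_shift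
          fls_nth_compose_power)
    qed
  qed
  also have "\<dots> = fls_nth (A $$ (r, c)) i" using assms by (subst sum.delta) auto
  finally show ?thesis .
qed

lemma zrow_inject:
  assumes "A \<in> carrier_mat n n" "B \<in> carrier_mat n n" "\<And>c. c < n \<Longrightarrow> zrow n A c = zrow n B c"
  shows "A = B"
proof (rule eq_matI)
  fix r c assume "r < dim_row B" "c < dim_col B"
  then show "A $$ (r, c) = B $$ (r, c)"
    using assms zrow_nth[of r n A c] zrow_nth[of r n B c] by (auto intro!: fls_eqI)
qed (use assms in auto)

lemma zrow_mult:
  assumes "A \<in> carrier_mat n n" "B \<in> carrier_mat n n" "c < n" "zeigen n A \<alpha>"
  shows "zrow n (A * B) c = \<alpha> * zrow n B c"
proof -
  have "zrow n (A * B) c = (\<Sum>r<n. \<Sum>s<n. fls_X_inv ^ r * fls_compose_power (A $$ (r, s)) n *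
      fls_compose_power (B $$ (s, c)) n)"
    unfolding zrow_def using assms
    by (intro sum.cong) (auto simp: scalar_prod_def lessThan_atLeast0 fls_compose_power_sum
        sum_distrib_left mult.assoc)
  also have "\<dots> = (\<Sum>s<n. zrow n A s * fls_compose_power (B $$ (s, c)) n)"
    by (subst sum.swap) (simp add: zrow_def sum_distrib_right)
  also have "\<dots> = (\<Sum>s<n. \<alpha> * (fls_X_inv ^ s * fls_compose_power (B $$ (s, c)) n))"
    using assms(4) by (intro sum.cong) (auto simp: zeigen_def mult.assoc)
  finally show ?thesis by (simp add: zrow_def sum_distrib_left)
qed

lemma zeigen_mult:
  "A \<in> carrier_mat n n \<Longrightarrow> B \<in> carrier_mat n n \<Longrightarrow> zeigen n A \<alpha> \<Longrightarrow> zeigen n B \<beta> \<Longrightarrow>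
      zeigen n (A * B) (\<alpha> * \<beta>)"
  unfolding zeigen_def[of _ "A * B"] zeigen_def[of _ B] by (simp add: zrow_mult mult.assoc)

lemma zeigen_smult_one: "n > 0 \<Longrightarrow> zeigen n (\<alpha> \<cdot>\<^sub>m 1\<^sub>m n) (fls_compose_power \<alpha> n)"
proof (unfold zeigen_def zrow_def, intro allI impI)
  fix c assume "n > 0" "c < n"
  have "(\<Sum>r<n. fls_X_inv ^ r * fls_compose_power ((\<alpha> \<cdot>\<^sub>m 1\<^sub>m n) $$ (r, c)) n)
    = (\<Sum>r<n. if r = c then fls_X_inv ^ r * fls_compose_power \<alpha> n else 0)"
    using \<open>c < n\<close> by (intro sum.cong) auto
  also have "\<dots> = fls_compose_power \<alpha> n * fls_X_inv ^ c"
    using \<open>c < n\<close> by (subst sum.delta) auto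
  finally show "(\<Sum>r<n. fls_X_inv ^ r * fls_compose_power ((\<alpha> \<cdot>\<^sub>m 1\<^sub>m n) $$ (r, c)) n) =
      fls_compose_power \<alpha> n * fls_X_inv ^ c" .
qed

lemma zeigen_power:
  assumes "n > 0" "A \<in> carrier_mat n n" "zeigen n A \<alpha>"
  shows "zeigen n (A ^\<^sub>m m) (\<alpha> ^ m)"
proof (induction m)
  case 0
  have "(1::real fls) \<cdot>\<^sub>m 1\<^sub>m n = 1\<^sub>m n" by (intro eq_matI) auto
  then show ?case using zeigen_smult_one[OF assms(1), of 1] assms by simp
next
  case (Suc m)
  then show ?case using zeigen_mult[of "A ^\<^sub>m m" n A "\<alpha> ^ m" \<alpha>] assms by (simp add: mult.commute)
qed

lemma compose_power_X_inv: "n > 0 \<Longrightarrow> fls_compose_power (fls_X_inv :: real fls) n = fls_X_inv ^ n"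
  by (simp add: fls_X_inv_power_conv_shift_1)

lemma zeigen_cyc:
  assumes n: "n > 0"
  shows "zeigen n (cyc n) fls_X_inv"
  unfolding zeigen_def
proof (intro allI impI)
  fix c assume c: "c < n"
  show "zrow n (cyc n) c = fls_X_inv * fls_X_inv ^ c"
  proof (cases "c < n - 1")
    case True
    have "zrow n (cyc n) c = (\<Sum>r<n. if r = Suc c then fls_X_inv ^ r else 0)"
      unfolding zrow_def using c True n by (intro sum.cong) (auto simp: comp_mat_def)
    also have "\<dots> = fls_X_inv ^ Suc c" using True by (subst sum.delta) auto
    finally show ?thesis by simp
  next
    case False
    then have c': "c = n - 1" using c by simp
    have "zrow n (cyc n) c = (\<Sum>r<n. if r = 0 then fls_X_inv ^ r * fls_X_inv ^ n else 0)"
      unfolding zrow_def using c c' n by (intro sum.cong) (auto simp: comp_mat_def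
          compose_power_X_inv[OF n, symmetric])
    also have "\<dots> = fls_X_inv ^ n" using n by (subst sum.delta) auto
    also have "\<dots> = fls_X_inv * fls_X_inv ^ c" using n unfolding c' by (cases n) auto
    finally show ?thesis .
  qed
qed

text \<open>A matrix commuting with J acts on the row (1, z, ..., z^(n-1)) by one series \<eta>,
  which determines it. Here \<eta>^n = z^n, so \<eta>/z is an n-th root of unity in a field of
  Laurent series; it is constant, and the leading coefficient makes it 1.\<close>

lemma cyclic_root_unique:
  fixes X :: "real fls mat"
  assumes n: "n > 0" and X: "X \<in> carrier_mat n n" and comm: "cyc n * X = X * cyc n"
    and pow: "X ^\<^sub>m n = fls_X_inv \<cdot>\<^sub>m 1\<^sub>m n" and lead: "fls_nth (X $$ (0, n - 1)) (-1) = 1"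
  shows "X = cyc n"
proof -
  define \<eta> where "\<eta> = zrow n X 0"
  have step: "zrow n X (Suc c) = fls_X_inv * zrow n X c" if "Suc c < n" for c
  proof -
    have "zrow n X (Suc c) = zrow n (X * cyc n) c"
      unfolding zrow_def using that X
      by (intro sum.cong) (auto simp: mult_comp_mat_index[OF X] simp del: index_mult_mat(1))
    also have "\<dots> = fls_X_inv * zrow n X c"
      unfolding comm[symmetric] using that by (intro zrow_mult zeigen_cyc X n) auto
    finally show ?thesis .
  qed
  have zX: "zrow n X c = \<eta> * fls_X_inv ^ c" if "c < n" for c
    using that by (induction c) (auto simp: \<eta>_def step)
  then have eX: "zeigen n X \<eta>" by (simp add: zeigen_def)
  have "zeigen n (fls_X_inv \<cdot>\<^sub>m 1\<^sub>m n) (\<eta> ^ n)"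
    using zeigen_power[OF n X eX, of n] pow by simp
  moreover have "zeigen n (fls_X_inv \<cdot>\<^sub>m 1\<^sub>m n) (fls_X_inv ^ n)"
    using zeigen_smult_one[OF n, of fls_X_inv] by (simp add: compose_power_X_inv[OF n])
  ultimately have \<eta>n: "\<eta> ^ n = fls_X_inv ^ n" using n by (auto simp: zeigen_def)
  have XX: "(fls_X :: real fls) * fls_X_inv = 1" "(fls_X_inv :: real fls) * fls_X = 1"
    by (auto simp: fls_X_times_conv_shift fls_X_inv_times_conv_shift intro!: fls_eqI)
  define \<tau> where "\<tau> = \<eta> * fls_X"
  have \<tau>n: "\<tau> ^ n = 1"
    unfolding \<tau>_def power_mult_distrib \<eta>n power_mult_distrib[symmetric] XX by simp
  then have "\<tau> \<noteq> 0" using n by (auto simp: power_0_left)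
  \<comment> \<open>Differentiating \<tau>^n = 1 in the series variable leaves no choice but a
    constant \<tau>.\<close>
  have "of_nat n * \<tau> ^ (n - 1) * fls_deriv \<tau> = 0"
    using fls_deriv_power[of \<tau> n] \<tau>n by (simp add: mult_ac)
  then have "fls_deriv \<tau> = 0" using n \<open>\<tau> \<noteq> 0\<close> by auto
  then have \<tau>c: "\<tau> = fls_const (fls_nth \<tau> 0)" by (simp add: fls_deriv_eq_0_iff)
  \<comment> \<open>The \<lambda>-coefficient of the corner entry is the z^n-coefficient of \<eta>
    z^(n-1).\<close>
  have "fls_nth (zrow n X (n - 1)) (- int n) = 1"
    using zrow_nth[of 0 n X "n - 1" "-1"] n X lead by simp
  then have "fls_nth \<eta> (-1) = 1"
    using n zX[of "n - 1"] by (simp add: fls_X_inv_power_times_conv_shift of_nat_diff)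
  then have "fls_nth \<tau> 0 = 1" by (simp add: \<tau>_def fls_X_times_conv_shift)
  then have "\<tau> = 1" using \<tau>c by simp
  then have "\<eta> = fls_X_inv" using XX by (metis \<tau>_def mult.assoc mult.commute mult_1)
  then show ?thesis
    using zeigen_cyc[OF n] zX X by (intro zrow_inject) (auto simp: zeigen_def)
qed

lemma (in comm_ring_hom) map_mat_diff:
  "A \<in> carrier_mat m k \<Longrightarrow> B \<in> carrier_mat m k \<Longrightarrow> map_mat hom (A - B) = map_mat hom A - map_mat hom B"
  by (intro eq_matI) (auto simp: hom_minus)

lemma (in comm_ring_hom) map_mat_smult: "map_mat hom (a \<cdot>\<^sub>m A) = hom a \<cdot>\<^sub>m map_mat hom A"
  by (intro eq_matI) (auto simp: hom_mult)

definition Ysol :: "nat \<Rightarrow> (nat \<Rightarrow> sfun) \<Rightarrow> sfun fls mat \<Rightarrow> bool" where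
  "Ysol n U Y \<longleftrightarrow> Y \<in> carrier_mat n n \<and> map_mat (fls_map sD) Y = Y * lax n U - lax n U * Y \<and>
     Y ^\<^sub>m n = fls_X_inv \<cdot>\<^sub>m 1\<^sub>m n \<and>
     (\<forall>r<n. \<forall>c<n. \<forall>i<0. fls_nth (Y $$ (r, c)) i = (if r = 0 \<and> c = n - 1 \<and> i = -1 then 1 else 0))"

abbreviation evm :: "real \<Rightarrow> sfun mat \<Rightarrow> real mat" where
  "evm x \<equiv> map_mat (\<lambda>a. sapp a x)"

abbreviation evf :: "real \<Rightarrow> sfun fls mat \<Rightarrow> real fls mat" where
  "evf x \<equiv> map_mat (fls_map (\<lambda>a. sapp a x))"

lemma evf_inject:
  assumes "A \<in> carrier_mat n n" "B \<in> carrier_mat n n" "\<And>x. evf x A = evf x B"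
  shows "A = B"
proof (rule eq_matI)
  fix r c assume rc: "r < dim_row B" "c < dim_col B"
  have "sapp (fls_nth (A $$ (r, c)) i) x = sapp (fls_nth (B $$ (r, c)) i) x" for i x
    using arg_cong[OF assms(3)[of x], of "\<lambda>M. fls_nth (M $$ (r, c)) i"] rc assms(1,2) by auto
  then show "A $$ (r, c) = B $$ (r, c)" by (intro fls_eqI sfun_eqI)
qed (use assms in auto)

lemma evf_X_inv [simp]: "fls_map (\<lambda>a. sapp a x) fls_X_inv = fls_X_inv"
  by (intro fls_eqI) auto

lemma evf_const [simp]: "fls_map (\<lambda>a. sapp a x) (fls_const a) = fls_const (sapp a x)"
  by (intro fls_eqI) auto

lemma evf_cyc: "evf x (cyc n) = cyc n"
  by (simp add: sapp_fls.map_comp_mat)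

text \<open>X = P Y P^(-1) satisfies the equation of \<open>centralizer\<close>, so it commutes with
  J; it is also an n-th root of \<lambda> with the corner coefficient of J.\<close>

lemma Ysol_unique:
  assumes n: "n \<ge> 2" and dr: "dressing n U P Q" and Y: "Ysol n U Y"
  shows "Y = Q * cyc n * P"
proof -
  let ?D = "map_mat (fls_map sD)"
  have C: "P \<in> carrier_mat n n" "Q \<in> carrier_mat n n" "P * Q = 1\<^sub>m n" "Q * P = 1\<^sub>m n"
    using dr by (auto simp: dressing_def)
  note cancel = sq_cancel[OF C(1,2) _ C(3)] sq_cancel[OF C(2,1) _ C(4)]
  have Y': "Y \<in> carrier_mat n n" "?D Y = Y * lax n U - lax n U * Y" "Y ^\<^sub>m n = fls_X_inv \<cdot>\<^sub>m 1\<^sub>m n"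
    and Yl: "\<And>r c i. r < n \<Longrightarrow> c < n \<Longrightarrow> i < 0 \<Longrightarrow> fls_nth (Y $$ (r, c)) i = (if r = 0 \<and> c = n - 1 \<and>
        i = -1 then 1 else 0)"
    using Y by (auto simp: Ysol_def)
  define X where "X = P * Y * Q"
  have X: "X \<in> carrier_mat n n" using C Y' by (simp add: X_def sq_carrier)
  have "?D X = ?D P * Y * Q + (P * ?D Y * Q + P * Y * ?D Q)"
    unfolding X_def using C Y'(1)
    by (simp add: sDf.mD_mult[of _ n n _ n] sq_carrier sq_simps[of _ n])
  also have "\<dots> = X * cyc n - cyc n * X"
    unfolding dressing_D[OF dr] dressing_D_inverse[OF dr] Y'(2) X_def using C Y'(1)
    by (simp add: sq_simps[of _ n] sq_carrier) (intro eq_matI; auto simp del: index_mult_mat(1))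
  finally have DX: "?D X = X * cyc n - cyc n * X" .
  have "?D X + cyc n * X = X * cyc n"
    unfolding DX using X by (intro eq_matI) (auto simp del: index_mult_mat(1))
  then have comm: "cyc n * X = X * cyc n" using n X by (intro centralizer) auto
  have Xn: "X ^\<^sub>m n = fls_X_inv \<cdot>\<^sub>m 1\<^sub>m n"
  proof -
    have "X ^\<^sub>m n = P * (fls_X_inv \<cdot>\<^sub>m 1\<^sub>m n) * Q"
      unfolding X_def using C Y' by (subst sq_pow_conj) auto
    also have "P * (fls_X_inv \<cdot>\<^sub>m 1\<^sub>m n) = fls_X_inv \<cdot>\<^sub>m P"
      using mult_smult_distrib[OF C(1) one_carrier_mat, of fls_X_inv] C(1) by simp
    also have "fls_X_inv \<cdot>\<^sub>m P * Q = fls_X_inv \<cdot>\<^sub>m (P * Q)"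
      by (rule mult_smult_assoc_mat[OF C(1,2)])
    finally show ?thesis using C by simp
  qed
  \<comment> \<open>The \<lambda>-coefficient of Y is e_1n, so this value is the product of the
    entries \<open>P $$ (0, 0)\<close> and \<open>Q $$ (n - 1, n - 1)\<close> at order 0. The second
    one follows from the last row of P through \<open>P * Q = 1\<close>.\<close>
  have lead: "fls_nth (X $$ (0, n - 1)) (-1) = 1"
  proof -
    have PQ: "fls_nth (P $$ (r, c)) i = 0" "fls_nth (Q $$ (r, c)) i = 0"
        if "r < n" "c < n" "i < 0" for r c i
      using dr that by (auto simp: dressing_def)
    have Y1: "fls_nth (Y $$ (r, c)) i = 0" if "r < n" "c < n" "i < -1" for r c i
      using Yl that by auto
    have low: "fls_nth (f * g) (-1) = fls_nth f 0 * fls_nth g (-1)"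
      if "\<And>i. i < 0 \<Longrightarrow> fls_nth f i = 0" "\<And>i. i < -1 \<Longrightarrow> fls_nth g i = 0" for f g :: "sfun fls"
      using fls_mult_nth_bounded[of 0 f "-1" g "-1"] that by simp
    have low0: "fls_nth (f * g) (i) = 0"
      if "\<And>i. i < 0 \<Longrightarrow> fls_nth f i = 0" "\<And>i. i < -1 \<Longrightarrow> fls_nth g i = 0" "i < -1"
          for f g :: "sfun fls" and i
      using fls_mult_nth_bounded[of 0 f "-1" g i] that by simp
    have YQ: "(Y * Q) $$ (r, c) = (\<Sum>s<n. Q $$ (s, c) * Y $$ (r, s))" if "r < n" "c < n" for r c
      using that C Y' by (simp add: scalar_prod_def lessThan_atLeast0 mult.commute)
    have YQ1: "fls_nth ((Y * Q) $$ (r, c)) i = 0" if "r < n" "c < n" "i < -1" for r c i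
      unfolding YQ[OF that(1,2)] fls_nth_sum using that by (intro sum.neutral ballI low0 PQ Y1) auto
    have Q0: "fls_nth (Q $$ (n - 1, n - 1)) 0 = 1"
    proof -
      have "1 = fls_nth ((P * Q) $$ (n - 1, n - 1)) 0" unfolding C(3) using n by simp
      also have "(P * Q) $$ (n - 1, n - 1) = (\<Sum>l<n. P $$ (n - 1, l) * Q $$ (l, n - 1))"
        using C(1,2) n by (simp add: scalar_prod_def lessThan_atLeast0)
      also have "fls_nth \<dots> 0 = (\<Sum>l<n. fls_nth (P $$ (n - 1, l)) 0 * fls_nth (Q $$ (l, n - 1)) 0)"
        unfolding fls_nth_sum
      proof (intro sum.cong refl)
        fix l assume "l \<in> {..<n}"
        then show "fls_nth (P $$ (n - 1, l) * Q $$ (l, n - 1)) 0 =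
            fls_nth (P $$ (n - 1, l)) 0 * fls_nth (Q $$ (l, n - 1)) 0"
          using PQ fls_mult_nth_bounded[of 0 "P $$ (n - 1, l)" 0 "Q $$ (l, n - 1)" 0] by simp
      qed
      also have "\<dots> = (\<Sum>l<n. if l = n - 1 then fls_nth (Q $$ (l, n - 1)) 0 else 0)"
        using dr by (intro sum.cong) (auto simp: dressing_def)
      also have "\<dots> = fls_nth (Q $$ (n - 1, n - 1)) 0" using n by (subst sum.delta) auto
      finally show ?thesis ..
    qed
    have n1: "n - 1 < n" using n by simp
    have YQ2: "fls_nth ((Y * Q) $$ (r, n - 1)) (-1) = (if r = 0 then 1 else 0)" if "r < n" for r
    proof -
      have "fls_nth ((Y * Q) $$ (r, n - 1)) (-1) = (\<Sum>s<n. fls_nth (Q $$ (s, n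
          - 1)) 0 * fls_nth (Y $$ (r, s)) (-1))"
        unfolding YQ[OF that n1] fls_nth_sum
        using that n by (intro sum.cong low PQ Y1) auto
      also have "\<dots> = (\<Sum>s<n. if s = n - 1 then (if r = 0 then fls_nth (Q $$ (s, n
          - 1)) 0 else 0) else 0)"
        using that by (intro sum.cong) (auto simp: Yl)
      also have "\<dots> = (if r = 0 then 1 else 0)" using n Q0 by (subst sum.delta) auto
      finally show ?thesis .
    qed
    have "X = P * (Y * Q)" unfolding X_def using C Y' by (simp add: sq_simps[of _ n])
    then have "X $$ (0, n - 1) = (\<Sum>s<n. P $$ (0, s) * (Y * Q) $$ (s, n - 1))"
      using sq_mult_index[of P n "Y * Q" 0 "n - 1"] C(1,2) Y'(1) n
          by (simp add: sq_carrier del: index_mult_mat(1))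
    then have "fls_nth (X $$ (0, n - 1)) (-1) = (\<Sum>s<n. fls_nth (P $$ (0, s) * (Y * Q) $$ (s, n
        - 1)) (-1))"
      by (simp add: fls_nth_sum)
    also have "\<dots> = (\<Sum>s<n. fls_nth (P $$ (0, s)) 0 * fls_nth ((Y * Q) $$ (s, n - 1)) (-1))"
      using n by (intro sum.cong low PQ YQ1) auto
    also have "\<dots> = (\<Sum>s<n. if s = 0 then fls_nth (P $$ (0, s)) 0 else 0)"
      by (intro sum.cong) (auto simp: YQ2[unfolded One_nat_def] simp del: index_mult_mat(1))
    also have "\<dots> = fls_nth (P $$ (0, 0)) 0" using n by (subst sum.delta) auto
    also have "\<dots> = 1" using dr n by (auto simp: dressing_def)
    finally show ?thesis .
  qed
  \<comment> \<open>Uniqueness of the root needs coefficients in a field, hence the evaluation at a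
    point.\<close>
  have "evf x X = evf x (cyc n)" for x
    unfolding evf_cyc
  proof (rule cyclic_root_unique)
    show "cyc n * evf x X = evf x X * cyc n"
      using arg_cong[OF comm, of "evf x"] X
      by (simp add: sapp_fls.mat_hom_mult[of _ n n _ n] evf_cyc)
    show "evf x X ^\<^sub>m n = fls_X_inv \<cdot>\<^sub>m 1\<^sub>m n"
      using arg_cong[OF Xn, of "evf x"] X
      by (simp add: sapp_fls.mat_hom_pow[of _ n] sapp_fls.map_mat_smult sapp_fls.mat_hom_one)
    show "fls_nth (evf x X $$ (0, n - 1)) (-1) = 1"
      using lead X n by simp
  qed (use n X in auto)
  then have "X = cyc n" using X by (intro evf_inject) auto
  then have "Q * X * P = Q * cyc n * P" by simp
  moreover have "Q * X * P = Y" unfolding X_def using C Y'(1)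
      by (simp add: sq_simps[of _ n] sq_carrier cancel)
  ultimately show ?thesis by simp
qed

lemma Ysol_exists:
  assumes n: "n \<ge> 2" and dr: "dressing n U P Q"
  shows "Ysol n U (Q * cyc n * P)"
  unfolding Ysol_def
  using Y_conj_carrier[OF dr] Y_conj_flat[OF dr] Y_conj_power[OF dr] Y_conj_leading[OF dr n]
  by blast

definition Ycan :: "nat \<Rightarrow> (nat \<Rightarrow> sfun) \<Rightarrow> sfun fls mat" where
  "Ycan n U = (THE Y. Ysol n U Y)"

text \<open>Every dressing pair gives the same series, so P and P^(-1) may be chosen afresh in each
  later argument.\<close>

lemma Ycan_eq:
  assumes "n \<ge> 2" "dressing n U P Q"
  shows "Ycan n U = Q * cyc n * P"
  unfolding Ycan_def using Ysol_unique[OF assms] Ysol_exists[OF assms] by blast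

lemma Ysol_Ycan:
  assumes "n \<ge> 2" shows "Ysol n U (Ycan n U)"
  using dressing_ex[of n U] assms Ycan_eq Ysol_exists by fastforce

lemma mat_trace_Ycan:
  assumes "n \<ge> 2" shows "mat_trace (Ycan n U) = 0"
  using dressing_ex[of n U] assms Ycan_eq Y_conj_trace by fastforce

section \<open>Passage between matrices over smooth functions and real matrices at each x\<close>

section \<open>Evaluation\<close>

definition umat :: "nat \<Rightarrow> (nat \<Rightarrow> sfun) \<Rightarrow> real \<Rightarrow> real mat" where
  "umat n U x = last_col n (\<lambda>i. sapp (U i) x)"

definition fls_coeffs :: "int \<Rightarrow> 'a::zero fls mat \<Rightarrow> 'a mat" where
  "fls_coeffs m Y = map_mat (\<lambda>f. fls_nth f m) Y"

lemma fls_coeffs_carrier [simp]: "Y \<in> carrier_mat n n \<Longrightarrow> fls_coeffs m Y \<in> carrier_mat n n"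
  by (simp add: fls_coeffs_def)

lemma lam_coeff_evf: "lam_coeff i (evf x Y) = evm x (fls_coeffs (- i) Y)"
  by (intro eq_matI) (auto simp: lam_coeff_def fls_coeffs_def)

lemma mat_deriv_evm: "M \<in> carrier_mat n n \<Longrightarrow> mat_deriv n (\<lambda>y. evm y M) x = evm x (map_mat sD M)"
  by (intro eq_matI) (auto simp: mat_deriv_def)

lemma smooth_mat_evm: "M \<in> carrier_mat n n \<Longrightarrow> smooth_mat n (\<lambda>x. evm x M)"
  by (auto simp: smooth_mat_def sapp_smooth)

lemma smooth_mat_lift:
  assumes "smooth_mat n A"
  obtains M where "M \<in> carrier_mat n n" "A = (\<lambda>x. evm x M)"
proof
  let ?M = "mat n n (\<lambda>(r, c). Sfun (\<lambda>x. A x $$ (r, c)))"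
  show "?M \<in> carrier_mat n n" by simp
  show "A = (\<lambda>x. evm x ?M)"
    using assms by (intro ext eq_matI) (auto simp: smooth_mat_def sapp_Sfun)
qed

lemma lax_evf: "J_mat n lam + map_mat fls_const (umat n U x) = evf x (lax n U)"
proof -
  have "map_mat fls_const (umat n U x) = last_col n (\<lambda>i. fls_const (sapp (U i) x))"
    by (intro eq_matI) (auto simp: umat_def last_col_def)
  then show ?thesis by (simp add: J_mat_plus_last_col sapp_fls.map_comp_mat)
qed

lemma b_plus_umat: "b_mat n + umat n U x = evm x (comp_mat n 0 U)"
  by (simp add: umat_def b_mat_plus_last_col sapp.map_comp_mat)

lemma flat_evf:
  assumes Y: "Y \<in> carrier_mat n n"
  shows "mat_deriv n (\<lambda>y. lam_coeff i (evf y Y)) x +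
      lam_coeff i (commutator (J_mat n lam + map_mat fls_const (umat n U x)) (evf x Y))
    = evm x (fls_coeffs (- i) (map_mat (fls_map sD) Y + (lax n U * Y - Y * lax n U)))"
proof -
  have c: "lax n U * Y \<in> carrier_mat n n" "Y * lax n U \<in> carrier_mat n n"
      using Y by (auto simp: sq_carrier)
  have "commutator (J_mat n lam + map_mat fls_const (umat n U x)) (evf x Y)
      = evf x (lax n U * Y) - evf x (Y * lax n U)"
    unfolding lax_evf commutator_def using Y by (simp add: sapp_fls.mat_hom_mult[of _ n n _ n])
  also have "\<dots> = evf x (lax n U * Y - Y * lax n U)"
    by (rule sapp_fls.map_mat_diff[OF c, symmetric])
  finally have *: "commutator (J_mat n lam + map_mat fls_const (umat n U x)) (evf x Y)
      = evf x (lax n U * Y - Y * lax n U)" .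
  show ?thesis
    unfolding * lam_coeff_evf mat_deriv_evm[OF fls_coeffs_carrier[OF Y]] using c Y
    by (intro eq_matI) (auto simp: fls_coeffs_def simp del: index_mult_mat(1))
qed

lemma is_Y_series_Ysol:
  assumes n: "n \<ge> 2" and Y: "Ysol n U Y" and tr: "mat_trace Y = 0"
  shows "is_Y_series n (umat n U) (\<lambda>x. evf x Y)"
proof -
  have C: "Y \<in> carrier_mat n n" and eq: "map_mat (fls_map sD) Y = Y * lax n U - lax n U * Y"
    and pow: "Y ^\<^sub>m n = fls_X_inv \<cdot>\<^sub>m 1\<^sub>m n"
    and lead: "\<And>r c i. r < n \<Longrightarrow> c < n \<Longrightarrow> i < 0 \<Longrightarrow> fls_nth (Y $$ (r, c)) i = (if r = 0 \<and> c = n - 1 \<and>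
        i = -1 then 1 else 0)"
    using Y by (auto simp: Ysol_def)
  have "map_mat (fls_map sD) Y + (lax n U * Y - Y * lax n U) = 0\<^sub>m n n"
    unfolding eq using C by (intro eq_matI) (auto simp del: index_mult_mat(1))
  moreover have "evm x (fls_coeffs i (0\<^sub>m n n)) = 0\<^sub>m n n" for x i
    by (intro eq_matI) (auto simp: fls_coeffs_def)
  ultimately have "mat_deriv n (\<lambda>y. lam_coeff i (evf y Y)) x +
      lam_coeff i (commutator (J_mat n lam + map_mat fls_const (umat n U x)) (evf x Y)) = 0\<^sub>m n n"
          for i x
    unfolding flat_evf[OF C] by simp
  moreover have "mat_trace (evm x (fls_coeffs (- i) Y)) = 0" for i x
  proof -
    have "mat_trace (evm x (fls_coeffs (- i) Y)) = sapp (fls_nth (mat_trace Y) (- i)) x"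
      using C by (simp add: mat_trace_def fls_coeffs_def fls_nth_sum sapp.hom_sum)
    then show ?thesis by (simp add: tr)
  qed
  moreover have "evm x (fls_coeffs (- 1) Y) = e_mat n 1 n" for x
    using C n by (intro eq_matI) (auto simp: fls_coeffs_def lead e_mat_def mat1_def)
  moreover have "evm x (fls_coeffs (- i) Y) = 0\<^sub>m n n" if "i > 1" for i x
    using C n that by (intro eq_matI) (auto simp: fls_coeffs_def lead)
  moreover have "evf x Y ^\<^sub>m n = lam \<cdot>\<^sub>m 1\<^sub>m n" for x
    using arg_cong[OF pow, of "evf x"] C
    by (simp add: sapp_fls.mat_hom_pow[of _ n] sapp_fls.map_mat_smult sapp_fls.mat_hom_one)
  ultimately show ?thesis
    unfolding is_Y_series_def using C by (auto simp: lam_coeff_evf intro!: smooth_mat_evm)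
qed

text \<open>The bound 1 on the power of \<lambda> is the same for all x. The coefficient functions
  therefore assemble into one Laurent series over smooth functions, and uniqueness there transfers
  to families given point by point.\<close>

lemma is_Y_series_lift:
  assumes n: "n \<ge> 2" and Y: "is_Y_series n (umat n U) Y"
  obtains Y' where "Ysol n U Y'" "Y = (\<lambda>x. evf x Y')"
proof -
  have sm: "smooth_mat n (\<lambda>x. lam_coeff i (Y x))" for i using Y by (simp add: is_Y_series_def)
  have dimY: "Y x \<in> carrier_mat n n" for x
  proof -
    have "lam_coeff 0 (Y x) \<in> carrier_mat n n" using sm[of 0] by (simp add: smooth_mat_def)
    then show ?thesis by (simp add: lam_coeff_def)
  qed
  have sme: "smooth_on UNIV (\<lambda>x. fls_nth (Y x $$ (r, c)) i)" if "r < n" "c < n" for r c i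
  proof -
    have "(\<lambda>x. fls_nth (Y x $$ (r, c)) i) = (\<lambda>x. lam_coeff (- i) (Y x) $$ (r, c))"
    proof
      show "fls_nth (Y x $$ (r, c)) i = lam_coeff (- i) (Y x) $$ (r, c)" for x
        using dimY[of x] that by (simp add: lam_coeff_def)
    qed
    then show ?thesis using sm[of "- i"] that by (simp add: smooth_mat_def)
  qed
  have lead1: "fls_nth (Y x $$ (r, c)) i = 0" if "r < n" "c < n" "i < -1" for r c i x
  proof -
    have "lam_coeff (- i) (Y x) = 0\<^sub>m n n" using Y that unfolding is_Y_series_def by auto
    from arg_cong[OF this, of "\<lambda>M. M $$ (r, c)"] show ?thesis
      using that dimY[of x] by (simp add: lam_coeff_def)
  qed
  have lead2: "fls_nth (Y x $$ (r, c)) (-1) = (if r = 0 \<and> c = n - 1 then 1 else 0)"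
      if "r < n" "c < n" for r c x
  proof -
    have "lam_coeff 1 (Y x) = e_mat n 1 n" using Y unfolding is_Y_series_def by auto
    from arg_cong[OF this, of "\<lambda>M. M $$ (r, c)"] show ?thesis
      using that dimY[of x] by (auto simp: lam_coeff_def e_mat_def mat1_def)
  qed
  define Y' where "Y' = mat n n (\<lambda>(r, c). Abs_fls (\<lambda>i. Sfun (\<lambda>x. fls_nth (Y x $$ (r, c)) i)))"
  have Y': "Y' \<in> carrier_mat n n" by (simp add: Y'_def)
  have S0: "Sfun (\<lambda>x. 0) = 0" by (simp add: zero_sfun_def)
  have nth: "fls_nth (Y' $$ (r, c)) i = Sfun (\<lambda>x. fls_nth (Y x $$ (r, c)) i)"
      if "r < n" "c < n" for r c i
    using that unfolding Y'_def
    by (simp, intro nth_Abs_fls_lower_bound[of "-1"]) (auto simp: lead1 S0)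
  have ev: "Y = (\<lambda>x. evf x Y')"
  proof
    fix x show "Y x = evf x Y'"
    proof (rule eq_matI)
      fix r c assume "r < dim_row (evf x Y')" "c < dim_col (evf x Y')"
      then have rc: "r < n" "c < n" using Y' by auto
      then show "Y x $$ (r, c) = evf x Y' $$ (r, c)"
        using Y' by (intro fls_eqI) (simp add: nth sapp_Sfun[OF sme])
    qed (use Y' dimY[of x] in auto)
  qed
  have "Ysol n U Y'"
    unfolding Ysol_def
  proof (intro conjI allI impI)
    let ?E = "map_mat (fls_map sD) Y' + (lax n U * Y' - Y' * lax n U)"
    have cE: "lax n U * Y' \<in> carrier_mat n n" "Y' * lax n U \<in> carrier_mat n n"
        using Y' by (auto simp: sq_carrier)
    have z: "evm x (fls_coeffs i ?E) = 0\<^sub>m n n" for i x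
    proof -
      have "mat_deriv n (\<lambda>y. lam_coeff (- i) (Y y)) x +
        lam_coeff (- i) (commutator (J_mat n lam + map_mat fls_const (umat n U x)) (Y x)) = 0\<^sub>m n n"
        using Y unfolding is_Y_series_def by blast
      then show ?thesis unfolding ev flat_evf[OF Y'] by simp
    qed
    have "?E = 0\<^sub>m n n"
    proof (rule eq_matI)
      fix r c assume rc: "r < dim_row (0\<^sub>m n n :: sfun fls mat)"
          "c < dim_col (0\<^sub>m n n :: sfun fls mat)"
      have "sapp (fls_nth (?E $$ (r, c)) i) x = sapp (fls_nth (0\<^sub>m n n $$ (r, c)) i) x" for i x
        using arg_cong[OF z[of x i], of "\<lambda>M. M $$ (r, c)"] rc cE Y'
            by (auto simp: fls_coeffs_def simp del: index_mult_mat(1))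
      then show "?E $$ (r, c) = 0\<^sub>m n n $$ (r, c)" by (intro fls_eqI sfun_eqI)
    qed (use cE in auto)
    then show "map_mat (fls_map sD) Y' = Y' * lax n U - lax n U * Y'"
      using cE Y' by (intro sq_add_eq_0) auto
    have "evf x (Y' ^\<^sub>m n) = evf x (fls_X_inv \<cdot>\<^sub>m 1\<^sub>m n)" for x
      using Y Y' unfolding is_Y_series_def ev
      by (simp add: sapp_fls.mat_hom_pow[of _ n] sapp_fls.map_mat_smult sapp_fls.mat_hom_one)
    then show "Y' ^\<^sub>m n = fls_X_inv \<cdot>\<^sub>m 1\<^sub>m n" using Y' by (intro evf_inject[of _ n]) auto
    fix r c and i :: int assume rc: "r < n" "c < n" "i < 0"
    have S1: "Sfun (\<lambda>x. 1) = 1" by (simp add: one_sfun_def)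
    show "fls_nth (Y' $$ (r, c)) i = (if r = 0 \<and> c = n - 1 \<and> i = -1 then 1 else 0)"
    proof (cases "i = -1")
      case True
      then show ?thesis using rc by (auto simp: nth lead2 S0 S1)
    next
      case False
      then show ?thesis using rc by (auto simp: nth lead1 S0)
    qed
  qed (rule Y')
  then show ?thesis using that ev by blast
qed

lemma Y_series_eq:
  assumes n: "n \<ge> 2"
  shows "Y_series n (umat n U) = (\<lambda>x. evf x (Ycan n U))"
  unfolding Y_series_def
proof (rule the_equality)
  show "is_Y_series n (umat n U) (\<lambda>x. evf x (Ycan n U))"
    by (rule is_Y_series_Ysol[OF n Ysol_Ycan[OF n] mat_trace_Ycan[OF n]])
  fix Y assume "is_Y_series n (umat n U) Y"
  from is_Y_series_lift[OF n this] obtain Y' where Y': "Ysol n U Y'" "Y = (\<lambda>x. evf x Y')" .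
  obtain P Q where "dressing n U P Q" using dressing_ex[of n U] n by auto
  from Ysol_unique[OF n this Y'(1)] Ycan_eq[OF n this] have "Y' = Ycan n U" by simp
  then show "Y = (\<lambda>x. evf x (Ycan n U))" using Y'(2) by simp
qed

section \<open>The matrices \<open>Z\<close>\<close>

lemma e_mat_carrier [simp]: "e_mat n i j \<in> carrier_mat n n" "dim_row (e_mat n i j) =
    n" "dim_col (e_mat n i j) = n"
  by (simp_all add: e_mat_def mat1_def)

lemma e1n_mult_index:
  fixes M :: "'a::comm_ring_1 mat"
  assumes "M \<in> carrier_mat n n" "r < n" "c < n"
  shows "(e_mat n 1 n * M) $$ (r, c) = (if r = 0 then M $$ (n - 1, c) else 0)"
proof -
  have "(e_mat n 1 n * M) $$ (r, c) = (\<Sum>s<n. if s = n - 1 then (if r =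
      0 then M $$ (s, c) else 0) else 0)"
    unfolding sq_mult_index[OF e_mat_carrier(1) assms]
    using assms by (intro sum.cong) (auto simp: e_mat_def mat1_def)
  also have "\<dots> = (if r = 0 then M $$ (n - 1, c) else 0)" using assms by (subst sum.delta) auto
  finally show ?thesis .
qed

lemma mult_e1n_index:
  fixes M :: "'a::comm_ring_1 mat"
  assumes "M \<in> carrier_mat n n" "r < n" "c < n"
  shows "(M * e_mat n 1 n) $$ (r, c) = (if c = n - 1 then M $$ (r, 0) else 0)"
proof -
  have "(M * e_mat n 1 n) $$ (r, c) = (\<Sum>s<n. if s = 0 then (if c =
      n - 1 then M $$ (r, s) else 0) else 0)"
    unfolding sq_mult_index[OF assms(1) e_mat_carrier(1) assms(2,3)]
    using assms by (intro sum.cong) (auto simp: e_mat_def mat1_def)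
  also have "\<dots> = (if c = n - 1 then M $$ (r, 0) else 0)" using assms by (subst sum.delta) auto
  finally show ?thesis .
qed

lemma comp_mat_mult_split:
  fixes M :: "'a::comm_ring_1 mat"
  assumes "M \<in> carrier_mat n n" "r < n" "c < n"
  shows "(comp_mat n l a * M) $$ (r, c) = (comp_mat n 0 a * M) $$ (r, c) +
      l * (e_mat n 1 n * M) $$ (r, c)"
    "(M * comp_mat n l a) $$ (r, c) = (M * comp_mat n 0 a) $$ (r, c) +
        l * (M * e_mat n 1 n) $$ (r, c)"
  using assms by (auto simp: comp_mat_mult_index mult_comp_mat_index e1n_mult_index[unfolded
      One_nat_def] mult_e1n_index[unfolded One_nat_def]
      simp del: index_mult_mat(1))

text \<open>Index m stands for the power \<lambda>^(-m), so the factor \<lambda> in front of e_1n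
  raises the index by 1.\<close>

lemma fls_coeffs_lax:
  assumes M: "M \<in> carrier_mat n n"
  shows "fls_coeffs m (lax n U * M) = comp_mat n 0 U * fls_coeffs m M +
      e_mat n 1 n * fls_coeffs (m + 1) M" (is "?L = ?R")
    "fls_coeffs m (M * lax n U) = fls_coeffs m M * comp_mat n 0 U + fls_coeffs (m +
        1) M * e_mat n 1 n" (is "?L' = ?R'")
proof -
  have c: "fls_coeffs i M \<in> carrier_mat n n" for i using M by simp
  have d: "dim_row (fls_coeffs i M) = n" "dim_col (fls_coeffs i M) = n" for i
      using M by (auto simp: fls_coeffs_def)
  have e: "fls_coeffs i M $$ (r, c) = fls_nth (M $$ (r, c)) i" if "r < n" "c < n" for i r c
    using that M by (simp add: fls_coeffs_def)
  show "?L = ?R"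
  proof (rule eq_matI)
    fix r c assume "r < dim_row ?R" "c < dim_col ?R"
    then have rc: "r < n" "c < n" using M by (auto simp: fls_coeffs_def)
    then have "?L $$ (r, c) = fls_nth ((lax n U * M) $$ (r, c)) m"
        using M by (simp add: fls_coeffs_def del: index_mult_mat(1))
    then show "?L $$ (r, c) = ?R $$ (r, c)" using rc c M
      by (auto simp: d comp_mat_mult_index[OF c] comp_mat_mult_index[OF M] e1n_mult_index[OF c,
          unfolded One_nat_def] e fls_X_inv_mult_nth
          simp del: index_mult_mat(1))
  qed (use M in \<open>auto simp: fls_coeffs_def\<close>)
  show "?L' = ?R'"
  proof (rule eq_matI)
    fix r c assume "r < dim_row ?R'" "c < dim_col ?R'"
    then have rc: "r < n" "c < n" using M by (auto simp: fls_coeffs_def)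
    then have "?L' $$ (r, c) = fls_nth ((M * lax n U) $$ (r, c)) m"
        using M by (simp add: fls_coeffs_def del: index_mult_mat(1))
    then show "?L' $$ (r, c) = ?R' $$ (r, c)" using rc c M
      by (auto simp: d mult_comp_mat_index[OF c] mult_comp_mat_index[OF M] mult_e1n_index[OF c,
          unfolded One_nat_def] e fls_X_inv_mult_nth fls_nth_sum
          simp del: index_mult_mat(1))
  qed (use M in \<open>auto simp: fls_coeffs_def\<close>)
qed

lemma trace_sum_comm:
  fixes A B :: "'a::comm_ring_1 mat"
  assumes "A \<in> carrier_mat n n" "B \<in> carrier_mat n n"
  shows "(\<Sum>r<n. (A * B) $$ (r, r)) = (\<Sum>r<n. (B * A) $$ (r, r))"
  using mat_trace_comm[OF assms] assms by (simp add: mat_trace_def del: index_mult_mat(1))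

text \<open>The operator [\<partial>_x + J + u, C], with \<open>l\<close> in place of
  \<lambda>.\<close>

definition cov :: "nat \<Rightarrow> (nat \<Rightarrow> sfun) \<Rightarrow> sfun \<Rightarrow> sfun mat \<Rightarrow> sfun mat" where
  "cov n U l C = map_mat sD C + (comp_mat n l U * C - C * comp_mat n l U)"

lemma cov_carrier [simp]: "C \<in> carrier_mat n n \<Longrightarrow> cov n U l C \<in> carrier_mat n n"
  by (simp add: cov_def sq_carrier)

lemma cov_index:
  assumes "C \<in> carrier_mat n n" "r < n" "c < n"
  shows "cov n U l C $$ (r, c) = sD (C $$ (r, c)) + (comp_mat n l U * C) $$ (r, c)
      - (C * comp_mat n l U) $$ (r, c)"
  using assms by (simp add: cov_def del: index_mult_mat(1))

lemma cov_diff: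
  assumes "A \<in> carrier_mat n n" "B \<in> carrier_mat n n"
  shows "cov n U l (A - B) = cov n U l A - cov n U l B"
  unfolding cov_def using assms
  by (simp add: sD.mD_diff[of _ n n] sq_simps[of _ n] sq_carrier) (intro eq_matI; auto simp del:
      index_mult_mat(1))

lemma cov_trace:
  assumes "C \<in> carrier_mat n n"
  shows "(\<Sum>r<n. cov n U l C $$ (r, r)) = sD (\<Sum>r<n. C $$ (r, r))"
  using assms trace_sum_comm[of "comp_mat n l U" n C]
  by (simp add: cov_index sum.distrib sum_subtractf sD.D_sum del: index_mult_mat(1))

lemma cov_evm:
  assumes "C \<in> carrier_mat n n"
  shows "mat_deriv n (\<lambda>y. evm y C) x + commutator (b_mat n + umat n U x) (evm x C) =
      evm x (cov n U 0 C)"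
proof -
  have c: "comp_mat n 0 U * C \<in> carrier_mat n n" "C * comp_mat n 0 U \<in> carrier_mat n n"
    using assms by (auto simp: sq_carrier)
  have "commutator (b_mat n + umat n U x) (evm x C) = evm x (comp_mat n 0 U * C
      - C * comp_mat n 0 U)"
    unfolding b_plus_umat commutator_def using assms c
    by (simp add: sapp.mat_hom_mult[of _ n n _ n] sapp.map_mat_diff[of _ n n])
  then show ?thesis using assms c
    by (simp add: mat_deriv_evm cov_def) (intro eq_matI; auto simp del: index_mult_mat(1))
qed

definition mpoly :: "nat \<Rightarrow> nat \<Rightarrow> (nat \<Rightarrow> sfun mat) \<Rightarrow> sfun \<Rightarrow> sfun mat" where
  "mpoly n j A l = mat n n (\<lambda>rc. \<Sum>i\<le>j. A i $$ rc * l ^ i)"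

lemma mpoly_carrier [simp]: "mpoly n j A l \<in> carrier_mat n n" "dim_row (mpoly n j A l) =
    n" "dim_col (mpoly n j A l) = n"
  by (auto simp: mpoly_def)

lemma mpoly_mult_index:
  assumes "B \<in> carrier_mat n n" "\<And>i. A i \<in> carrier_mat n n" "r < n" "c < n"
  shows "(B * mpoly n j A l) $$ (r, c) = (\<Sum>i\<le>j. (B * A i) $$ (r, c) * l ^ i)"
    "(mpoly n j A l * B) $$ (r, c) = (\<Sum>i\<le>j. (A i * B) $$ (r, c) * l ^ i)"
proof -
  have "(B * mpoly n j A l) $$ (r, c) = (\<Sum>s<n. \<Sum>i\<le>j. B $$ (r, s) * A i $$ (s, c) * l ^ i)"
    using assms by (subst sq_mult_index[of _ n]) (auto simp: mpoly_def sum_distrib_left mult.assoc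
        intro!: sum.cong)
  also have "\<dots> = (\<Sum>i\<le>j. (B * A i) $$ (r, c) * l ^ i)"
    using assms by (subst sum.swap) (auto simp: sq_mult_index[of _ n] sum_distrib_right intro!:
        sum.cong simp del: index_mult_mat(1))
  finally show "(B * mpoly n j A l) $$ (r, c) = (\<Sum>i\<le>j. (B * A i) $$ (r, c) * l ^ i)" .
  have "(mpoly n j A l * B) $$ (r, c) = (\<Sum>s<n. \<Sum>i\<le>j. A i $$ (r, s) * B $$ (s, c) * l ^ i)"
    using assms by (subst sq_mult_index[of _ n]) (auto simp: mpoly_def sum_distrib_left mult_ac
        intro!: sum.cong)
  also have "\<dots> = (\<Sum>i\<le>j. (A i * B) $$ (r, c) * l ^ i)"
    using assms by (subst sum.swap) (auto simp: sq_mult_index[of _ n] sum_distrib_right intro!: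
        sum.cong simp del: index_mult_mat(1))
  finally show "(mpoly n j A l * B) $$ (r, c) = (\<Sum>i\<le>j. (A i * B) $$ (r, c) * l ^ i)" .
qed

text \<open>Here \<open>x i\<close> is the part of an identity free of \<lambda> at the coefficient
  i of a polynomial, and \<open>k i\<close> its e_1n part. The full series satisfies
  \<open>x (Suc i) + k i = 0\<close>; for the truncation only the two ends survive.\<close>

lemma telescope:
  fixes x k :: "nat \<Rightarrow> 'a::comm_ring_1"
  assumes "\<And>i. x (Suc i) = - k i"
  shows "(\<Sum>i\<le>j. (x i + l * k i) * l ^ i) = x 0 + k j * l ^ Suc j"
  by (induction j) (auto simp: assms algebra_simps)

definition Yj :: "nat \<Rightarrow> nat \<Rightarrow> (nat \<Rightarrow> sfun) \<Rightarrow> int \<Rightarrow> sfun mat" where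
  "Yj n j U i = fls_coeffs (- i) (Ycan n U ^\<^sub>m j)"

definition zsol :: "nat \<Rightarrow> nat \<Rightarrow> (nat \<Rightarrow> sfun) \<Rightarrow> sfun mat \<Rightarrow> bool" where
  "zsol n j U z \<longleftrightarrow> z \<in> carrier_mat n n \<and> (\<forall>r<n. \<forall>c\<le>r. z $$ (r, c) = 0) \<and>
     (\<exists>\<theta>. cov n U 0 (Yj n j U 0 - z) = last_col n \<theta>)"

text \<open>Column c of the condition on \<zeta>, solved for column c + 1. The given part
  [\<partial>_x + b + u, Y_(j,0)] is -[e_1n, Y_(j,-1)], which outside the last column lives in the
  first row; this is why only r = 0 carries a source term.\<close>

primrec zcol :: "nat \<Rightarrow> nat \<Rightarrow> (nat \<Rightarrow> sfun) \<Rightarrow> nat \<Rightarrow> nat \<Rightarrow> sfun" where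
  "zcol n j U 0 = (\<lambda>r. 0)"
| "zcol n j U (Suc c) = (\<lambda>r. sD (zcol n j U c r) + (if r = 0 then 0 else zcol n j U c (r - 1))
     - (if r = 0 then cov n U 0 (Yj n j U 0) $$ (0, c) else 0))"

definition zmat :: "nat \<Rightarrow> nat \<Rightarrow> (nat \<Rightarrow> sfun) \<Rightarrow> sfun mat" where
  "zmat n j U = mat n n (\<lambda>(r, c). zcol n j U c r)"

lemma zmat_carrier [simp]: "zmat n j U \<in> carrier_mat n n" "dim_row (zmat n j U) =
    n" "dim_col (zmat n j U) = n"
  by (auto simp: zmat_def)

lemma zmat_upper: assumes "r < n" "c \<le> r" shows "zmat n j U $$ (r, c) = 0"
proof -
  have "zcol n j U c r = 0" if "c \<le> r" for c r
    using that by (induction c arbitrary: r) auto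
  then show ?thesis using assms by (simp add: zmat_def)
qed

definition Zs :: "nat \<Rightarrow> nat \<Rightarrow> (nat \<Rightarrow> sfun) \<Rightarrow> real \<Rightarrow> sfun mat" where
  "Zs n j U l = mpoly n j (\<lambda>i. Yj n j U (int i)) (sC l) - zmat n j U"

lemma Zs_carrier [simp]: "Zs n j U l \<in> carrier_mat n n" "dim_row (Zs n j U l) =
    n" "dim_col (Zs n j U l) = n"
  by (auto simp: Zs_def)

context
  fixes n :: nat assumes n: "n \<ge> 2"
begin

lemma Ycan_carrier: "Ycan n U \<in> carrier_mat n n"
  using Ysol_Ycan[OF n] by (simp add: Ysol_def)

lemma Ycan_pow_carrier: "Ycan n U ^\<^sub>m j \<in> carrier_mat n n"
  using Ycan_carrier by simp

lemma Yj_carrier [simp]: "Yj n j U i \<in> carrier_mat n n"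
  by (simp add: Yj_def Ycan_pow_carrier)

lemma Yj_dim [simp]: "dim_row (Yj n j U i) = n" "dim_col (Yj n j U i) = n"
  using carrier_matD[OF Yj_carrier[of j U i]] by auto

lemma Y_coeff_eq: "Y_coeff n j i (umat n U) x = evm x (Yj n j U i)"
  unfolding Y_coeff_def Y_series_eq[OF n] Yj_def
  using Ycan_carrier[of U] by (simp add: sapp_fls.mat_hom_pow[symmetric] lam_coeff_evf)

lemma Ycan_pow_flat:
  "map_mat (fls_map sD) (Ycan n U ^\<^sub>m j) = Ycan n U ^\<^sub>m j * lax n U - lax n U * Ycan n U ^\<^sub>m j"
proof (induction j)
  case 0
  have d: "dim_row (Ycan n U) = n" using Ycan_carrier[of U] by simp
  have "1\<^sub>m n * lax n U = lax n U" "lax n U * 1\<^sub>m n = lax n U"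
      by (auto intro!: left_mult_one_mat right_mult_one_mat)
  then show ?case using d by (auto intro!: eq_matI)
next
  case (Suc j)
  let ?Y = "Ycan n U"
  note c = Ycan_pow_carrier[of U j] Ycan_carrier[of U]
  have Y: "map_mat (fls_map sD) ?Y = ?Y * lax n U - lax n U * ?Y"
    using Ysol_Ycan[OF n, of U] by (simp add: Ysol_def)
  have "map_mat (fls_map sD) (?Y ^\<^sub>m j * ?Y) = map_mat (fls_map sD) (?Y ^\<^sub>m j) * ?Y +
      ?Y ^\<^sub>m j * map_mat (fls_map sD) ?Y"
    by (rule sDf.mD_mult[OF c])
  also have "\<dots> = (?Y ^\<^sub>m j * ?Y) * lax n U - lax n U * (?Y ^\<^sub>m j * ?Y)"
    unfolding Suc Y using c
    by (simp add: sq_simps[of _ n] sq_carrier del: pow_mat.simps) (intro eq_matI; auto simp del: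
        index_mult_mat(1))
  finally show ?case by simp
qed

text \<open>The coefficient of \<lambda>^i in the equation of Y^j; neighbouring coefficients are
  linked by e_1n alone.\<close>

lemma Yj_flat:
  assumes "r < n" "c < n"
  shows "sD (Yj n j U i $$ (r, c)) + (comp_mat n 0 U * Yj n j U i) $$ (r, c)
      - (Yj n j U i * comp_mat n 0 U) $$ (r, c)
     = - ((e_mat n 1 n * Yj n j U (i - 1)) $$ (r, c) - (Yj n j U (i - 1) * e_mat n 1 n) $$ (r, c))"
proof -
  let ?M = "Ycan n U ^\<^sub>m j"
  note M = Ycan_pow_carrier[of U j]
  have c: "?M * lax n U \<in> carrier_mat n n" "lax n U * ?M \<in> carrier_mat n n"
      using M by (auto simp: sq_carrier)
  have "sD (Yj n j U i $$ (r, c)) = fls_nth (map_mat (fls_map sD) ?M $$ (r, c)) (- i)"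
    using carrier_matD[OF M] assms by (simp add: Yj_def fls_coeffs_def)
  also have "\<dots> = fls_coeffs (- i) (?M * lax n U) $$ (r, c)
      - fls_coeffs (- i) (lax n U * ?M) $$ (r, c)"
    unfolding Ycan_pow_flat using carrier_matD[OF c(1)] carrier_matD[OF c(2)] carrier_matD[OF M]
        assms
    by (simp add: fls_coeffs_def del: index_mult_mat(1))
  finally show ?thesis
    unfolding fls_coeffs_lax[OF M] using assms carrier_matD[OF M]
    by (simp add: Yj_def fls_coeffs_def[of _ "Ycan n U ^\<^sub>m j"] algebra_simps del: index_mult_mat(1))
qed

lemma Yj_top: assumes "i > int j" shows "Yj n j U i = 0\<^sub>m n n"
proof -
  have "fls_nth ((Ycan n U ^\<^sub>m j) $$ (r, c)) m = 0" if "r < n" "c < n" "m < - int j" for r c m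
    using that
  proof (induction j arbitrary: r c m)
    case 0
    then show ?case using Ycan_carrier[of U] by simp
  next
    case (Suc j)
    let ?Y = "Ycan n U"
    have l: "fls_nth (?Y $$ (r, c)) i = 0" if "r < n" "c < n" "i < -1" for r c i
      using Ysol_Ycan[OF n, of U] that by (auto simp: Ysol_def)
    have "(?Y ^\<^sub>m Suc j) $$ (r, c) = (\<Sum>s<n. (?Y ^\<^sub>m j) $$ (r, s) * ?Y $$ (s, c))"
      using sq_mult_index[OF Ycan_pow_carrier Ycan_carrier Suc.prems(1,2)] by simp
    moreover have "fls_nth ((?Y ^\<^sub>m j) $$ (r, s) * ?Y $$ (s, c)) m = 0" if "s < n" for s
      using fls_mult_nth_bounded[of "- int j" "(?Y ^\<^sub>m j) $$ (r, s)" "-1"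
          "?Y $$ (s, c)" m] Suc that l by simp
    ultimately show ?case by (simp add: fls_nth_sum)
  qed
  then show ?thesis using assms carrier_matD[OF Ycan_pow_carrier[of U j]]
    by (intro eq_matI) (auto simp: Yj_def fls_coeffs_def)
qed

text \<open>Strict upper triangularity makes column 0 vanish, and the condition off the last column
  determines each further column from the one before it.\<close>

lemma zsol_unique:
  assumes z: "zsol n j U z" and z': "zsol n j U z'"
  shows "z = z'"
proof -
  let ?A = "Yj n j U 0"
  have C: "z \<in> carrier_mat n n" "z' \<in> carrier_mat n n" using assms by (auto simp: zsol_def)
  have up: "z $$ (r, c) = 0" "z' $$ (r, c) = 0" if "r < n" "c \<le> r" for r c
    using assms that by (auto simp: zsol_def)
  have rec: "z'' $$ (r, Suc c) = sD (z'' $$ (r, c)) + (if r =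
      0 then 0 else z'' $$ (r - 1, c)) - cov n U 0 ?A $$ (r, c)"
    if zs: "zsol n j U z''" and "r < n" "Suc c < n" for z'' r c
  proof -
    have C: "z'' \<in> carrier_mat n n" and z: "z'' $$ (n - 1, c) = 0"
        using that by (auto simp: zsol_def)
    obtain \<theta> where "cov n U 0 (?A - z'') = last_col n \<theta>" using zs unfolding zsol_def by blast
    then have "cov n U 0 ?A - cov n U 0 z'' = last_col n \<theta>" using C by (simp add: cov_diff)
    from arg_cong[OF this, of "\<lambda>M. M $$ (r, c)"]
    have "cov n U 0 ?A $$ (r, c) = cov n U 0 z'' $$ (r, c)"
      using that C carrier_matD[OF cov_carrier[OF C, of U 0]]
          by (auto simp: last_col_def split: if_splits)
    then show ?thesis
      using that C z by (auto simp: cov_index[OF C] comp_mat_mult_index[OF C]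
          mult_comp_mat_index[OF C] simp del: index_mult_mat(1))
  qed
  have "\<forall>r<n. z $$ (r, c) = z' $$ (r, c)" if "c < n" for c
    using that
  proof (induction c)
    case 0
    then show ?case using up by simp
  next
    case (Suc c)
    then show ?case using rec[OF z, of _ c] rec[OF z', of _ c] by auto
  qed
  then show ?thesis using C by (intro eq_matI) auto
qed

text \<open>The recursion clears all columns but the last. There the corner entry must vanish too
  for the result to lie in V_n, and it equals the trace, which is handled through traces of
  commutators.\<close>

lemma zsol_zmat: "zsol n j U (zmat n j U)"
proof -
  let ?A = "Yj n j U 0" and ?z = "zmat n j U"
  have cA: "cov n U 0 ?A $$ (r, c) = - ((e_mat n 1 n * Yj n j U (- 1)) $$ (r, c)
      - (Yj n j U (- 1) * e_mat n 1 n) $$ (r, c))"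
    if "r < n" "c < n" for r c
    using Yj_flat[OF that, of j U 0] that by (simp add: cov_index del: index_mult_mat(1))
  have cz: "cov n U 0 ?z $$ (r, c) = (if r = 0 then cov n U 0 ?A $$ (r, c) else 0)"
      if "r < n" "Suc c < n" for r c
  proof -
    have "cov n U 0 ?z $$ (r, c) = sD (?z $$ (r, c)) + (if r =
        0 then 0 else ?z $$ (r - 1, c)) - ?z $$ (r, Suc c)"
      using that zmat_upper[of "n - 1" n c j U]
      by (auto simp: cov_index comp_mat_mult_index[of ?z n n] mult_comp_mat_index[of ?z n n] simp
          del: index_mult_mat(1))
    then show ?thesis using that by (auto simp: zmat_def)
  qed
  let ?C = "cov n U 0 (?A - ?z)"
  have C: "?C \<in> carrier_mat n n" by (intro cov_carrier) (auto simp: sq_carrier)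
  have Ce: "?C $$ (r, c) = cov n U 0 ?A $$ (r, c) - cov n U 0 ?z $$ (r, c)"
      if "r < n" "c < n" for r c
    using that carrier_matD[OF cov_carrier[OF zmat_carrier(1)[of n j U], of U 0]]
        by (simp add: cov_diff)
  have cols: "?C $$ (r, c) = 0" if "r < n" "Suc c < n" for r c
    using that Ce[of r c] cz[of r c] cA[of r c]
    by (auto simp: e1n_mult_index[unfolded One_nat_def] mult_e1n_index[unfolded One_nat_def] simp
        del: index_mult_mat(1))
  \<comment> \<open>Taking the trace of the \<lambda>^0 equation of Y^j leaves only the derivative,
    since both commutators are traceless. The correction by \<zeta> has no diagonal.\<close>
  have "sD (\<Sum>r<n. ?A $$ (r, r)) = 0"
  proof -
    have "(\<Sum>r<n. cov n U 0 ?A $$ (r, r)) = - ((\<Sum>r<n. (e_mat n 1 n * Yj n j U (- 1)) $$ (r, r))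
        - (\<Sum>r<n. (Yj n j U (- 1) * e_mat n 1 n) $$ (r, r)))"
      by (simp add: cA sum_negf[symmetric] sum_subtractf[symmetric] del: index_mult_mat(1))
    also have "\<dots> = 0" using trace_sum_comm[of "e_mat n 1 n" n "Yj n j U (- 1)"] by simp
    finally show ?thesis by (simp add: cov_trace)
  qed
  moreover have "(\<Sum>r<n. (?A - ?z) $$ (r, r)) = (\<Sum>r<n. ?A $$ (r, r))"
    by (intro sum.cong) (auto simp: zmat_upper)
  ultimately have "(\<Sum>r<n. ?C $$ (r, r)) = 0"
    using cov_trace[of "?A - ?z" n U 0] by (simp add: sq_carrier)
  moreover have "(\<Sum>r<n. ?C $$ (r, r)) = ?C $$ (n - 1, n - 1)"
  proof -
    have "(\<Sum>r\<in>{..<n} - {n - 1}. ?C $$ (r, r)) = 0"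
      by (intro sum.neutral ballI cols) auto
    then show ?thesis using n by (subst sum.remove[of _ "n - 1"]) auto
  qed
  ultimately have last: "?C $$ (n - 1, n - 1) = 0" by simp
  have "?C = last_col n (\<lambda>r. ?C $$ (r, n - 1))"
  proof (rule eq_matI)
    fix r c assume "r < dim_row (last_col n (\<lambda>r. ?C $$ (r, n - 1)))"
        "c < dim_col (last_col n (\<lambda>r. ?C $$ (r, n - 1)))"
    then have rc: "r < n" "c < n" by auto
    consider "Suc c < n" | "c = n - 1" "r < n - 1" | "c = n - 1" "r = n - 1" using rc by linarith
    then show "?C $$ (r, c) = last_col n (\<lambda>r. ?C $$ (r, n - 1)) $$ (r, c)"
      using rc cols last by cases (auto simp: last_col_def)
  qed (use C in auto)
  then show ?thesis unfolding zsol_def using zmat_upper by auto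
qed

lemma zeta_eq: "zeta n j (umat n U) = (\<lambda>x. evm x (zmat n j U))"
  unfolding zeta_def
proof (rule the_equality)
  have diff: "(\<lambda>y. Y_coeff n j 0 (umat n U) y - evm y z) = (\<lambda>y. evm y (Yj n j U 0 - z))"
      if "z \<in> carrier_mat n n" for z
    unfolding Y_coeff_eq using that by (simp add: sapp.map_mat_diff[of _ n n])
  have key: "mat_deriv n (\<lambda>y. Y_coeff n j 0 (umat n U) y - evm y z) x +
      commutator (b_mat n + umat n U x) (Y_coeff n j 0 (umat n U) x - evm x z) =
          evm x (cov n U 0 (Yj n j U 0 - z))"
    if "z \<in> carrier_mat n n" for z x
    using cov_evm[of "Yj n j U 0 - z" n x U] that fun_cong[OF diff[OF that], of x]
    unfolding diff[OF that] by (simp add: sq_carrier)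
  show "is_zeta n j (umat n U) (\<lambda>x. evm x (zmat n j U))"
    unfolding is_zeta_def
  proof (intro conjI allI)
    fix x
    show "evm x (zmat n j U) \<in> strictly_upper n" by (auto simp: strictly_upper_def zmat_upper)
    obtain \<theta> where "cov n U 0 (Yj n j U 0 - zmat n j U) = last_col n \<theta>"
        using zsol_zmat unfolding zsol_def by blast
    moreover have "evm x (last_col n \<theta>) = last_col n (\<lambda>r. sapp (\<theta> r) x)"
      by (intro eq_matI) (auto simp: last_col_def)
    ultimately show "mat_deriv n (\<lambda>y. Y_coeff n j 0 (umat n U) y - evm y (zmat n j U)) x +
      commutator (b_mat n + umat n U x) (Y_coeff n j 0 (umat n U) x
          - evm x (zmat n j U)) \<in> V_space n"
      unfolding key[OF zmat_carrier(1)] V_space_iff by metis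
  qed (simp add: smooth_mat_evm)
  fix z assume z: "is_zeta n j (umat n U) z"
  then obtain M where M: "M \<in> carrier_mat n n" "z = (\<lambda>x. evm x M)"
    using smooth_mat_lift by (auto simp: is_zeta_def)
  have "zsol n j U M"
    unfolding zsol_def
  proof (intro conjI allI impI M(1))
    fix r c assume "r < n" "c \<le> r"
    have "sapp (M $$ (r, c)) x = 0" for x
    proof -
      have "evm x M \<in> strictly_upper n" using z M by (simp add: is_zeta_def)
      then show ?thesis using \<open>r < n\<close> \<open>c \<le> r\<close> M(1) by (auto simp: strictly_upper_def)
    qed
    then show "M $$ (r, c) = 0" by (intro sfun_eqI) simp
  next
    let ?C = "cov n U 0 (Yj n j U 0 - M)"
    have C: "?C \<in> carrier_mat n n" using M by (intro cov_carrier) (auto simp: sq_carrier)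
    have V: "evm x ?C \<in> V_space n" for x
      using z unfolding is_zeta_def M(2) key[OF M(1)] by blast
    have "?C = last_col n (\<lambda>r. ?C $$ (r, n - 1))"
    proof (rule eq_matI)
      fix r c assume "r < dim_row (last_col n (\<lambda>r. ?C $$ (r, n - 1)))"
          "c < dim_col (last_col n (\<lambda>r. ?C $$ (r, n - 1)))"
      then have rc: "r < n" "c < n" by auto
      have "sapp (?C $$ (r, c)) x = 0" if "\<not> (r < n - 1 \<and> c = n - 1)" for x
      proof -
        obtain a where "evm x ?C = last_col n a" using V[of x] V_space_iff by blast
        from arg_cong[OF this, of "\<lambda>M. M $$ (r, c)"] show ?thesis
            using that rc C by (auto simp: last_col_def)
      qed
      then have "?C $$ (r, c) = 0" if "\<not> (r < n - 1 \<and> c = n - 1)"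
          using that by (intro sfun_eqI) simp
      then show "?C $$ (r, c) = last_col n (\<lambda>r. ?C $$ (r, n - 1)) $$ (r, c)"
        using rc by (auto simp: last_col_def)
    qed (use C in auto)
    then show "\<exists>\<theta>. ?C = last_col n \<theta>" by blast
  qed
  then have "M = zmat n j U" using zsol_zmat zsol_unique by blast
  then show "z = (\<lambda>x. evm x (zmat n j U))" using M by simp
qed

lemma Z_mat_eq: "Z_mat n j (umat n U) l x = evm x (Zs n j U l)"
proof -
  have "sapp (a ^ i) x = sapp a x ^ i" for a i by (induction i) auto
  then show ?thesis
    unfolding Z_mat_def zeta_eq Zs_def Y_coeff_eq
    by (intro eq_matI) (auto simp: mpoly_def sapp.hom_sum)
qed

text \<open>In the polynomial part all powers of \<lambda> cancel by telescoping, and e_1n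
  annihilates \<zeta> from both sides; what remains is the condition that defines \<zeta>, free of
  \<lambda>. Hence one \<theta> for all \<open>l\<close>.\<close>

lemma Zs_flat: "\<exists>\<theta>. \<forall>l. cov n U (sC l) (Zs n j U l) = last_col n \<theta>"
proof -
  obtain \<theta> where \<theta>: "cov n U 0 (Yj n j U 0 - zmat n j U) = last_col n \<theta>"
    using zsol_zmat unfolding zsol_def by blast
  have "cov n U (sC l) (Zs n j U l) = last_col n \<theta>" for l
  proof -
    let ?W = "mpoly n j (\<lambda>i. Yj n j U (int i)) (sC l)" and ?e = "e_mat n 1 n :: sfun mat"
    have W: "cov n U (sC l) ?W $$ (r, c) = cov n U 0 (Yj n j U 0) $$ (r, c)" if rc: "r < n"
        "c < n" for r c
    proof -
      define x where "x i = cov n U 0 (Yj n j U (int i)) $$ (r, c)" for i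
      define k where "k i = (?e * Yj n j U (int i)) $$ (r, c) - (Yj n j U (int i) * ?e) $$ (r, c)"
          for i
      have xk: "x (Suc i) = - k i" for i
        using Yj_flat[OF rc, of j U "int (Suc i)"] rc by (simp add: x_def k_def cov_index del:
            index_mult_mat(1))
      have sDl: "sD (a * sC l ^ i) = sD a * sC l ^ i" for a i
      proof -
        have "sD (sC l ^ i) = 0" by (induction i) (auto simp: sD.D_mult)
        then show ?thesis by (simp add: sD.D_mult)
      qed
      have "cov n U (sC l) ?W $$ (r, c) = (\<Sum>i\<le>j. (sD (Yj n j U (int i) $$ (r, c)) +
          (comp_mat n (sC l) U * Yj n j U (int i)) $$ (r, c)
              - (Yj n j U (int i) * comp_mat n (sC l) U) $$ (r, c)) * sC l ^ i)"
        using rc by (simp add: cov_index mpoly_mult_index algebra_simps sum.distrib sum_subtractf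
            del: index_mult_mat(1))
          (simp add: mpoly_def sD.D_sum sDl, simp add: mult.commute)
      also have "\<dots> = (\<Sum>i\<le>j. (x i + sC l * k i) * sC l ^ i)"
        using rc by (intro sum.cong)
          (auto simp: x_def k_def cov_index comp_mat_mult_split[where l =
              "sC l"] algebra_simps simp del: index_mult_mat(1))
      also have "\<dots> = x 0 + k j * sC l ^ Suc j" by (rule telescope[of x k, OF xk])
      \<comment> \<open>Y^j has degree j in \<lambda>, so its coefficient j + 1 vanishes and no term
        is left at the upper end.\<close>
      also have "k j = 0"
      proof -
        have "x (Suc j) = 0"
          using rc Yj_top[of j "int (Suc j)" U] by (simp add: x_def cov_index del: of_nat_Suc)
        then show ?thesis using xk[of j] by simp
      qed
      finally show ?thesis by (simp add: x_def)
    qed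
    have z: "cov n U (sC l) (zmat n j U) $$ (r, c) = cov n U 0 (zmat n j U) $$ (r, c)"
        if "r < n" "c < n" for r c
      using that by (auto simp: cov_index comp_mat_mult_split[where l =
          "sC l"] e1n_mult_index[unfolded One_nat_def] mult_e1n_index[unfolded One_nat_def]
          zmat_upper
          simp del: index_mult_mat(1))
    have "cov n U (sC l) (Zs n j U l) = cov n U (sC l) ?W - cov n U (sC l) (zmat n j U)"
      by (simp add: Zs_def cov_diff)
    also have "\<dots> = cov n U 0 (Yj n j U 0) - cov n U 0 (zmat n j U)"
      using W z carrier_matD[OF cov_carrier[OF zmat_carrier(1)[of n j U]]]
        carrier_matD[OF cov_carrier[OF mpoly_carrier(1)]] carrier_matD[OF cov_carrier[OF
            Yj_carrier]]
      by (intro eq_matI) auto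
    also have "\<dots> = last_col n \<theta>" unfolding \<theta>[symmetric] by (simp add: cov_diff)
    finally show ?thesis .
  qed
  then show ?thesis by blast
qed

end

section \<open>The first-order factor \<partial> + h and the intertwining of the two Lax
  operators\<close>

section \<open>The gauge matrix\<close>

lemma mult_mat_smult_vec:
  fixes A :: "'a::comm_ring_1 mat"
  assumes "A \<in> carrier_mat m n" "v \<in> carrier_vec n"
  shows "A *\<^sub>v (k \<cdot>\<^sub>v v) = k \<cdot>\<^sub>v (A *\<^sub>v v)"
  using assms by (intro eq_vecI) (auto simp: scalar_prod_def sum_distrib_left mult_ac)

context derivation begin

lemma D_of_nat_mult: "D (of_nat m * a) = of_nat m * D a"
  by (simp add: D_mult)

lemma mD_mult_vec:
  assumes "A \<in> carrier_mat m n" "v \<in> carrier_vec n"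
  shows "map_vec D (A *\<^sub>v v) = mD A *\<^sub>v v + A *\<^sub>v map_vec D v"
  using assms by (intro eq_vecI) (auto simp: scalar_prod_def D_sum D_mult sum.distrib)

text \<open>By the Leibniz rule column c lists the coefficients of the operator \<partial>^c h. In
  \<open>gauge\<close>, column c thus represents \<partial>^c (\<partial> + h), with \<partial>^n in
  the last column replaced through the new equation L' = \<lambda>.\<close>

definition bin_mat :: "nat \<Rightarrow> 'a \<Rightarrow> 'a mat" where
  "bin_mat n h = mat n n (\<lambda>(r, c). of_nat (c choose r) * (D ^^ (c - r)) h)"

lemma bin_mat_carrier [simp]: "bin_mat n h \<in> carrier_mat n n" "dim_row (bin_mat n h) =
    n" "dim_col (bin_mat n h) = n"
  by (auto simp: bin_mat_def)

text \<open>The new curvature u + s: the coefficients of Q (\<partial> + h) + k, rewritten with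
  those of (\<partial> + h) Q = L - k.\<close>

definition ut :: "nat \<Rightarrow> (nat \<Rightarrow> 'a) \<Rightarrow> (nat \<Rightarrow> 'a) \<Rightarrow> 'a \<Rightarrow> nat \<Rightarrow> 'a" where
  "ut n u w h r = u r + D (w r) - (\<Sum>c=Suc r..<n. of_nat (c choose r) * w c * (D ^^ (c - r)) h)"

definition gauge :: "nat \<Rightarrow> 'a \<Rightarrow> (nat \<Rightarrow> 'a) \<Rightarrow> 'a \<Rightarrow> 'a mat" where
  "gauge n l v h = comp_mat n l v + bin_mat n h"

lemma gauge_carrier [simp]: "gauge n l v h \<in> carrier_mat n n" "dim_row (gauge n l v h) =
    n" "dim_col (gauge n l v h) = n"
  by (auto simp: gauge_def)

text \<open>The factorization \<open>(\<partial> + h) (w\<^sub>1 + w\<^sub>2 \<partial> + \<dots> + w\<^sub>n \<partial>^(n-1)) = \<partial>^n - \<Sum> u\<^sub>i \<partial>^(i-1) - k\<close>,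
  with the coefficients of \<open>w\<close> and \<open>u\<close> numbered from 0.\<close>

definition bt :: "nat \<Rightarrow> (nat \<Rightarrow> 'a) \<Rightarrow> (nat \<Rightarrow> 'a) \<Rightarrow> 'a \<Rightarrow> 'a \<Rightarrow> bool" where
  "bt n u w h k \<longleftrightarrow> w (n - 1) = 1 \<and> D k = 0 \<and>
     (\<forall>r<n. D (w r) + (if r = 0 then 0 else w (r - 1)) + (if r < n - 1 then u r else 0) + h * w r
        = (if r = 0 then - k else 0))"

text \<open>This is (\<partial> + h) Q = L - k read modulo L - \<lambda>: the operator on the right
  becomes the constant \<lambda> - k.\<close>

lemma bt_vec:
  assumes n: "n \<ge> 2" and bt: "bt n u w h k"
  shows "map_vec D (vec n w) + comp_mat n l u *\<^sub>v vec n w =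
      (l - k) \<cdot>\<^sub>v unit_vec n 0 - h \<cdot>\<^sub>v vec n w"
proof (rule eq_vecI)
  fix r assume "r < dim_vec ((l - k) \<cdot>\<^sub>v unit_vec n 0 - h \<cdot>\<^sub>v vec n w)"
  then have r: "r < n" by simp
  from bt have w1: "w (n - 1) = 1" and
    e: "D (w r) + (if r = 0 then 0 else w (r - 1)) + (if r < n - 1 then u r else 0) + h * w r =
        (if r = 0 then - k else 0)"
    using r by (auto simp: bt_def)
  have "(map_vec D (vec n w) + comp_mat n l u *\<^sub>v vec n w) $ r =
     D (w r) + (if r = 0 then 0 else w (r - 1)) + (if r < n - 1 then u r else 0) + (if r =
         0 then l else 0)"
    using r n w1 by (auto simp: comp_mat_mult_vec_index simp del: index_mult_mat_vec)
  also have "\<dots> = (if r = 0 then - k else 0) - h * w r + (if r = 0 then l else 0)"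
    unfolding e[symmetric] by simp
  finally show "(map_vec D (vec n w) + comp_mat n l u *\<^sub>v vec n w) $ r =
      ((l - k) \<cdot>\<^sub>v unit_vec n 0 - h \<cdot>\<^sub>v vec n w) $ r"
    using r by auto
qed auto

text \<open>The vector w lists the coefficients of Q, and Q (\<partial> + h) = L' - k becomes
  \<lambda> - k modulo L' - \<lambda>.\<close>

lemma gauge_vec:
  assumes n: "n \<ge> 2" and bt: "bt n u w h k"
  shows "gauge n l (ut n u w h) h *\<^sub>v vec n w = (l - k) \<cdot>\<^sub>v unit_vec n 0"
proof (rule eq_vecI)
  fix r assume "r < dim_vec ((l - k) \<cdot>\<^sub>v unit_vec n 0)"
  then have r: "r < n" by simp
  from bt have w1: "w (n - 1) = 1" and
    e: "D (w r) + (if r = 0 then 0 else w (r - 1)) + (if r < n - 1 then u r else 0) + h * w r =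
        (if r = 0 then - k else 0)"
    using r by (auto simp: bt_def)
  let ?S = "\<Sum>c=Suc r..<n. of_nat (c choose r) * w c * (D ^^ (c - r)) h"
  have "(bin_mat n h *\<^sub>v vec n w) $ r = (\<Sum>c\<in>{0..<n}. of_nat (c choose r) * w c * (D ^^ (c - r)) h)"
    using r by (auto simp: bin_mat_def scalar_prod_def intro!: sum.cong)
  also have "\<dots> = (\<Sum>c\<in>{r..<n}. of_nat (c choose r) * w c * (D ^^ (c - r)) h)"
    by (rule sum.mono_neutral_right) (auto simp: not_le binomial_eq_0)
  also have "\<dots> = h * w r + ?S"
    using r by (subst sum.atLeast_Suc_lessThan) (auto simp: mult.commute)
  finally have B: "(bin_mat n h *\<^sub>v vec n w) $ r = h * w r + ?S" .
  have "(gauge n l (ut n u w h) h *\<^sub>v vec n w) $ r =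
      (comp_mat n l (ut n u w h) *\<^sub>v vec n w) $ r + (bin_mat n h *\<^sub>v vec n w) $ r"
    unfolding gauge_def using r by (subst add_mult_distrib_mat_vec[of _ n n]) auto
  also have "\<dots> = (if r = 0 then l else w (r - 1)) + (if r < n - 1 then ut n u w h r else 0) +
      h * w r + ?S"
    unfolding B using r n w1 by (auto simp: comp_mat_mult_vec_index simp del: index_mult_mat_vec)
  also have "\<dots> = D (w r) + (if r = 0 then 0 else w (r - 1)) + (if r < n - 1 then u r else 0) +
      h * w r + (if r = 0 then l else 0)"
  proof (cases "r < n - 1")
    case False
    then have "r = n - 1" using r by simp
    then have "D (w r) = 0" "?S = 0" using w1 r by auto
    then show ?thesis using False by simp
  qed (simp add: ut_def)
  also have "\<dots> = (if r = 0 then - k else 0) + (if r = 0 then l else 0)" unfolding e ..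
  finally show "(gauge n l (ut n u w h) h *\<^sub>v vec n w) $ r = ((l - k) \<cdot>\<^sub>v unit_vec n 0) $ r"
    using r by auto
qed auto

text \<open>Pascal's rule, which expresses \<partial>^(c+1) h = \<partial> (\<partial>^c h) in
  coefficients.\<close>

lemma bin_mat_pascal:
  assumes "r < n" "Suc c < n"
  shows "D (bin_mat n h $$ (r, c)) + (if r = 0 then 0 else bin_mat n h $$ (r - 1, c)) =
      bin_mat n h $$ (r, Suc c)"
proof (cases r)
  case 0
  then show ?thesis using assms by (simp add: bin_mat_def)
next
  case (Suc q)
  show ?thesis
  proof (cases "r \<le> c")
    case True
    then have "Suc (c - r) = c - q" using Suc by simp
    then have "D ((D ^^ (c - r)) h) = (D ^^ (c - q)) h" by (metis comp_apply funpow.simps(2))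
    then show ?thesis using assms Suc True by (simp add: bin_mat_def D_of_nat_mult algebra_simps)
  next
    case False
    then consider "q = c" | "q > c" using Suc by linarith
    then show ?thesis using assms Suc by cases (auto simp: bin_mat_def binomial_eq_0)
  qed
qed

text \<open>Let R be the difference of the two sides. Pascal's rule clears its first n - 1 columns.
  The last column, where the derivative of u' enters, is not computed: R w = 0 follows from the
  equations for w and f w, and the last component of w is 1.\<close>

lemma gauge_flat:
  assumes n: "n \<ge> 2" and bt: "bt n u w h k" and l: "D l = 0"
  defines "f \<equiv> gauge n l (ut n u w h) h"
  shows "mD f = f * comp_mat n l u - comp_mat n l (ut n u w h) * f"
proof -
  let ?v = "ut n u w h"
  let ?L = "comp_mat n l u" and ?L' = "comp_mat n l ?v" and ?w = "vec n w"
  have f: "f \<in> carrier_mat n n" by (simp add: f_def)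
  have c: "f * ?L \<in> carrier_mat n n" "?L' * f \<in> carrier_mat n n" using f by (auto simp: sq_carrier)
  \<comment> \<open>The last row of f has a single 1 in these columns, so u' enters the product only
    in column n - 2.\<close>
  have fl: "f $$ (n - 1, c) = (if c = n - 2 then 1 else 0)" if "c < n - 1" for c
    using that n by (auto simp: f_def gauge_def comp_mat_def bin_mat_def binomial_eq_0)
  define R where "R = mD f - (f * ?L - ?L' * f)"
  have R: "R \<in> carrier_mat n n" using f c by (auto simp: R_def sq_carrier)
  have cols: "R $$ (r, c) = 0" if rc: "r < n" "Suc c < n" for r c
  proof -
    have c1: "c < n - 1" using rc by simp
    have Lv: "?L' $$ (r, Suc c) = (if r = c + 2 then 1 else 0) +
        (if c = n - 2 then (if r = 0 then l else 0) + (if r < n - 1 then ?v r else 0) else 0)"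
      using rc by (auto simp: comp_mat_def)
    have "R $$ (r, c) = D (f $$ (r, c)) - f $$ (r, Suc c) + (?L' * f) $$ (r, c)"
      using rc c1 f c by (simp add: R_def mult_comp_mat_index[OF f] del: index_mult_mat(1))
    also have "(?L' * f) $$ (r, c) = (if r = 0 then 0 else f $$ (r - 1, c)) +
        ?L' $$ (r, Suc c) - (if r = c + 2 then 1 else 0)"
      unfolding comp_mat_mult_index[OF f rc(1) Suc_lessD[OF rc(2)]] Lv fl[OF c1] by auto
    also have "D (f $$ (r, c)) = D (bin_mat n h $$ (r, c))"
      using rc by (auto simp: f_def gauge_def comp_mat_def D_add)
    also have "f $$ (r, Suc c) = ?L' $$ (r, Suc c) + bin_mat n h $$ (r, Suc c)"
      using rc by (simp add: f_def gauge_def)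
    also have "(if r = 0 then 0 else f $$ (r - 1, c)) = (if r =
        0 then 0 else bin_mat n h $$ (r - 1, c)) + (if r = c + 2 then 1 else 0)"
      using rc by (auto simp: f_def gauge_def comp_mat_def)
    finally show ?thesis using bin_mat_pascal[OF rc, of h] by (simp add: algebra_simps)
  qed
  have w: "?w \<in> carrier_vec n" "map_vec D ?w \<in> carrier_vec n" "unit_vec n 0 \<in> carrier_vec n" by auto
  have Rw: "R *\<^sub>v ?w = 0\<^sub>v n"
  proof -
    have fw: "f *\<^sub>v ?w = (l - k) \<cdot>\<^sub>v unit_vec n 0" unfolding f_def by (rule gauge_vec[OF n bt])
    have Dw: "map_vec D ?w + ?L *\<^sub>v ?w = (l - k) \<cdot>\<^sub>v unit_vec n 0 - h \<cdot>\<^sub>v ?w"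
        by (rule bt_vec[OF n bt])
    have "D k = 0" using bt by (simp add: bt_def)
    then have "map_vec D ((l - k) \<cdot>\<^sub>v unit_vec n 0) = 0\<^sub>v n"
      using l by (intro eq_vecI) (auto simp: D_mult D_diff)
    then have eq0: "mD f *\<^sub>v ?w + f *\<^sub>v map_vec D ?w = 0\<^sub>v n"
      using mD_mult_vec[OF f w(1)] fw by simp
    have 1: "(mD f *\<^sub>v ?w) $ r = - (f *\<^sub>v map_vec D ?w) $ r" if "r < n" for r
    proof -
      have "(mD f *\<^sub>v ?w + f *\<^sub>v map_vec D ?w) $ r = 0" unfolding eq0 using that by simp
      then show ?thesis using that f by (simp add: eq_neg_iff_add_eq_0 del: index_mult_mat_vec)
    qed
    \<comment> \<open>This turns the term -h w in the equation of w into a cancellation: the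
      multiple h e_1 of f e_1 meets h f w = (\<lambda> - k) h e_1.\<close>
    have f0: "f *\<^sub>v unit_vec n 0 = ?L' *\<^sub>v unit_vec n 0 + h \<cdot>\<^sub>v unit_vec n 0"
    proof -
      have "bin_mat n h *\<^sub>v unit_vec n 0 = h \<cdot>\<^sub>v unit_vec n 0"
        using n by (intro eq_vecI) (auto simp: bin_mat_def scalar_prod_right_unit binomial_eq_0)
      then show ?thesis unfolding f_def gauge_def
        by (subst add_mult_distrib_mat_vec[of _ n n]) auto
    qed
    have 2: "(f *\<^sub>v map_vec D ?w) $ r + ((f * ?L) *\<^sub>v ?w) $ r =
        (l - k) * (?L' *\<^sub>v unit_vec n 0) $ r" if r: "r < n" for r
    proof -
      have "f *\<^sub>v map_vec D ?w + (f * ?L) *\<^sub>v ?w = f *\<^sub>v (map_vec D ?w + ?L *\<^sub>v ?w)"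
        using mult_add_distrib_mat_vec[OF f w(2) mult_mat_vec_carrier[OF comp_mat_carrier(1) w(1)]]
          assoc_mult_mat_vec[OF f comp_mat_carrier(1) w(1)] by simp
      also have "\<dots> = f *\<^sub>v ((l - k) \<cdot>\<^sub>v unit_vec n 0) - f *\<^sub>v (h \<cdot>\<^sub>v ?w)"
        unfolding Dw using f by (subst mult_minus_distrib_mat_vec[of _ n n]) auto
      also have "\<dots> = (l - k) \<cdot>\<^sub>v (f *\<^sub>v unit_vec n 0) - h \<cdot>\<^sub>v (f *\<^sub>v ?w)"
        using f by (simp add: mult_mat_smult_vec[of _ n n])
      also have "\<dots> = (l - k) \<cdot>\<^sub>v (?L' *\<^sub>v unit_vec n 0)"
        unfolding fw f0 by (intro eq_vecI) (auto simp: algebra_simps simp del: index_mult_mat_vec)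
      finally have "(f *\<^sub>v map_vec D ?w + (f * ?L) *\<^sub>v ?w) $ r =
          ((l - k) \<cdot>\<^sub>v (?L' *\<^sub>v unit_vec n 0)) $ r" by simp
      then show ?thesis using r f by (simp del: index_mult_mat_vec)
    qed
    have 3: "((?L' * f) *\<^sub>v ?w) $ r = (l - k) * (?L' *\<^sub>v unit_vec n 0) $ r" if "r < n" for r
    proof -
      have "(?L' * f) *\<^sub>v ?w = (l - k) \<cdot>\<^sub>v (?L' *\<^sub>v unit_vec n 0)"
        using f by (simp add: assoc_mult_mat_vec[of _ n n _ n] fw mult_mat_smult_vec[of _ n n])
      then show ?thesis using that by (simp del: index_mult_mat_vec)
    qed
    have RR: "R *\<^sub>v ?w = mD f *\<^sub>v ?w - ((f * ?L) *\<^sub>v ?w - (?L' * f) *\<^sub>v ?w)"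
      using minus_mult_distrib_mat_vec[of "mD f" n n "f * ?L
          - ?L' * f", OF _ sq_carrier(3)[OF c] w(1)]
        minus_mult_distrib_mat_vec[OF c w(1)] f unfolding R_def by simp
    have grp: "a - (c - e) = 0" if "a = - b" "b + c = d" "e = d" for a b c d e :: 'a
      using that by (auto simp: algebra_simps)
    show ?thesis
    proof (rule eq_vecI)
      fix r assume "r < dim_vec (0\<^sub>v n :: 'a vec)"
      then have r: "r < n" by simp
      show "(R *\<^sub>v ?w) $ r = 0\<^sub>v n $ r"
        unfolding RR using grp[OF 1[OF r] 2[OF r] 3[OF r]] r f by (simp del: index_mult_mat_vec)
    qed (use R in auto)
  qed
  have "R = 0\<^sub>m n n"
  proof (rule eq_matI)
    fix r c assume "r < dim_row (0\<^sub>m n n :: 'a mat)" "c < dim_col (0\<^sub>m n n :: 'a mat)"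
    then have rc: "r < n" "c < n" by auto
    have "(R *\<^sub>v ?w) $ r = (\<Sum>c<n. R $$ (r, c) * w c)"
      using rc R by (simp add: scalar_prod_def lessThan_atLeast0)
    also have "\<dots> = R $$ (r, n - 1) * w (n - 1) + (\<Sum>c\<in>{..<n} - {n - 1}. R $$ (r, c) * w c)"
      using n by (subst sum.remove[of _ "n - 1"]) auto
    also have "(\<Sum>c\<in>{..<n} - {n - 1}. R $$ (r, c) * w c) = 0"
      using rc by (intro sum.neutral ballI) (auto simp: cols)
    finally have "R $$ (r, n - 1) = 0" using Rw rc bt by (simp add: bt_def)
    then show "R $$ (r, c) = 0\<^sub>m n n $$ (r, c)"
      using rc cols[of r c] by (cases "Suc c < n") (auto simp: not_less_eq less_Suc_eq_le dest:
          le_antisym)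
  qed (use R in auto)
  then show ?thesis
    unfolding R_def using f c by (intro eq_matI) (auto simp: mat_eq_iff simp del: index_mult_mat(1))
qed

end

interpretation fls_const: comm_ring_hom "fls_const :: 'a::comm_ring_1 \<Rightarrow> 'a fls"
  by standard (auto simp: fls_plus_const fls_const_mult_const)

lemma funpow_sDf_const: "(fls_map sD ^^ i) (fls_const a) = fls_const ((sD ^^ i) a)"
  by (induction i) auto

lemma bin_mat_fls: "sDf.bin_mat n (fls_const h) = map_mat fls_const (sD.bin_mat n h)"
  by (intro eq_matI)
    (auto simp: sDf.bin_mat_def sD.bin_mat_def funpow_sDf_const fls_const.hom_mult
        fls_const.hom_of_nat)

lemma ut_fls: "sDf.ut n (\<lambda>i. fls_const (u i)) (\<lambda>i. fls_const (w i)) (fls_const h) =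
    (\<lambda>i. fls_const (sD.ut n u w h i))"
  by (intro ext) (simp only: sDf.ut_def sD.ut_def funpow_sDf_const sDf_const fls_const.hom_add
      fls_const.hom_minus
      fls_const.hom_sum fls_const.hom_mult fls_const.hom_of_nat)

lemma bt_fls:
  assumes "sD.bt n u w h k"
  shows "sDf.bt n (\<lambda>i. fls_const (u i)) (\<lambda>i. fls_const (w i)) (fls_const h) (fls_const k)"
  unfolding sDf.bt_def
proof (intro conjI allI impI)
  fix r assume "r < n"
  then have "sD (w r) + (if r = 0 then 0 else w (r - 1)) + (if r < n - 1 then u r else 0) +
      h * w r = (if r = 0 then - k else 0)"
    using assms by (auto simp: sD.bt_def)
  from arg_cong[OF this, of fls_const]
  show "fls_map sD (fls_const (w r)) + (if r = 0 then 0 else fls_const (w (r - 1))) +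
      (if r < n - 1 then fls_const (u r) else 0) + fls_const h * fls_const (w r) = (if r =
          0 then - fls_const k else 0)"
    by (simp only: sDf_const fls_const.hom_add fls_const.hom_mult fls_const.hom_uminus
        fls_const.hom_zero if_distrib[of fls_const])
qed (use assms in \<open>auto simp: sD.bt_def\<close>)

context
  fixes n :: nat and u w :: "nat \<Rightarrow> sfun" and h k :: sfun
  assumes n: "n \<ge> 2" and bt: "sD.bt n u w h k"
begin

private abbreviation (input) "v \<equiv> sD.ut n u w h"
private abbreviation (input) "B \<equiv> sD.bin_mat n h"
private abbreviation (input) "F \<equiv> lax n v + map_mat fls_const B"

lemma gauge_fls_flat: "map_mat (fls_map sD) F = F * lax n u - lax n v * F"
  using sDf.gauge_flat[OF n bt_fls[OF bt] sDf_X_inv]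
  unfolding sDf.gauge_def ut_fls bin_mat_fls .

lemma F_carrier: "F \<in> carrier_mat n n" by simp

text \<open>By \<open>gauge_flat\<close> f intertwines the two Lax operators, so P' f P^(-1) falls
  under \<open>centralizer\<close>; moving J past it gives the claim without an inverse of
  f.\<close>

lemma Y_intertwine: "Ycan n v * F = F * Ycan n u"
proof -
  let ?D = "map_mat (fls_map sD)"
  obtain P Q where dr: "dressing n u P Q" using dressing_ex[of n u] n by auto
  obtain P' Q' where dr': "dressing n v P' Q'" using dressing_ex[of n v] n by auto
  have C: "P \<in> carrier_mat n n" "Q \<in> carrier_mat n n" "P * Q = 1\<^sub>m n" "Q * P = 1\<^sub>m n"
    using dr by (auto simp: dressing_def)
  have C': "P' \<in> carrier_mat n n" "Q' \<in> carrier_mat n n" "P' * Q' = 1\<^sub>m n" "Q' * P' = 1\<^sub>m n"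
    using dr' by (auto simp: dressing_def)
  note cancel = sq_cancel[OF C(1,2) _ C(3)] sq_cancel[OF C(2,1) _ C(4)]
  note cancel' = sq_cancel[OF C'(2,1) _ C'(4)]
  define G where "G = F"
  have G: "G \<in> carrier_mat n n" unfolding G_def by (rule F_carrier)
  have DG: "?D G = G * lax n u - lax n v * G" unfolding G_def by (rule gauge_fls_flat)
  define X where "X = P' * (G * Q)"
  have X: "X \<in> carrier_mat n n" using C C' G by (simp add: X_def sq_carrier)
  have "?D X = ?D P' * (G * Q) + P' * (?D G * Q + G * ?D Q)"
    unfolding X_def using C(1,2) C'(1,2) G by (simp add: sDf.mD_mult[of _ n n _ n] sq_carrier)
  also have "\<dots> = X * cyc n - cyc n * X"
    unfolding dressing_D[OF dr'] dressing_D_inverse[OF dr] DG X_def using C(1,2) C'(1,2) G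
    by (simp add: sq_simps[of _ n] sq_carrier) (intro eq_matI; auto simp del: index_mult_mat(1))
  finally have DX: "?D X = X * cyc n - cyc n * X" .
  have "?D X + cyc n * X = X * cyc n"
    unfolding DX using X by (intro eq_matI) (auto simp del: index_mult_mat(1))
  then have comm: "cyc n * X = X * cyc n" using n X by (intro centralizer) auto
  have XP: "X * P = P' * G" unfolding X_def using C C' G by (simp add: sq_simps[of _ n] sq_carrier)
  have "Q' * (cyc n * (X * P)) = Q' * (cyc n * X * P)" using C C' X by (simp add: sq_simps[of _ n])
  also have "\<dots> = Q' * (P' * (G * (Q * (cyc n * P))))"
    unfolding comm unfolding X_def using C(1,2) C'(1,2) G by (simp add: sq_simps[of _ n] sq_carrier)
  also have "\<dots> = G * (Q * (cyc n * P))" using C C' G by (intro cancel') (auto simp: sq_carrier)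
  finally have "Q' * cyc n * P' * G = G * (Q * cyc n * P)"
    unfolding XP using C(1,2) C'(1,2) G by (simp add: sq_simps[of _ n] sq_carrier)
  then show ?thesis unfolding Ycan_eq[OF n dr] Ycan_eq[OF n dr'] G_def .
qed

lemma Y_pow_intertwine: "Ycan n v ^\<^sub>m j * F = F * Ycan n u ^\<^sub>m j"
proof (induction j)
  case 0
  have "dim_row (Ycan n u) = n" "dim_row (Ycan n v) = n" using Ycan_carrier[OF n] by auto
  then show ?case using left_mult_one_mat[OF F_carrier] right_mult_one_mat[OF F_carrier] by simp
next
  case (Suc j)
  note c = Ycan_pow_carrier[OF n, of u j] Ycan_carrier[OF n, of u] Ycan_pow_carrier[OF n, of v j]
      Ycan_carrier[OF n, of v] F_carrier
  have "Ycan n v ^\<^sub>m j * Ycan n v * F = Ycan n v ^\<^sub>m j * (Ycan n v * F)"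
      by (rule sq_simps(1)[OF c(3,4,5)])
  also have "\<dots> = Ycan n v ^\<^sub>m j * F * Ycan n u" unfolding Y_intertwine
      by (rule sq_simps(1)[OF c(3,5,2), symmetric])
  also have "\<dots> = F * (Ycan n u ^\<^sub>m j * Ycan n u)" unfolding Suc by (rule sq_simps(1)[OF c(5,1,2)])
  finally show ?case by simp
qed

lemma fls_coeffs_gauge:
  assumes M: "M \<in> carrier_mat n n"
  shows "fls_coeffs m (F * M) = comp_mat n 0 v * fls_coeffs m M + e_mat n 1 n * fls_coeffs (m +
      1) M + B * fls_coeffs m M"
    "fls_coeffs m (M * F) = fls_coeffs m M * comp_mat n 0 v + fls_coeffs (m + 1) M * e_mat n 1 n +
        fls_coeffs m M * B"
proof -
  have B: "fls_coeffs m (map_mat fls_const B * M) = B * fls_coeffs m M"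
    "fls_coeffs m (M * map_mat fls_const B) = fls_coeffs m M * B"
    using M by (auto intro!: eq_matI simp: fls_coeffs_def scalar_prod_def fls_nth_sum)
  have add: "fls_coeffs m (X + Y) = fls_coeffs m X + fls_coeffs m Y"
    if "X \<in> carrier_mat n n" "Y \<in> carrier_mat n n" for X Y :: "sfun fls mat"
    using that by (intro eq_matI) (auto simp: fls_coeffs_def)
  have Bc: "map_mat fls_const B \<in> carrier_mat n n" by simp
  show "fls_coeffs m (F * M) = comp_mat n 0 v * fls_coeffs m M + e_mat n 1 n * fls_coeffs (m +
      1) M + B * fls_coeffs m M"
    unfolding sq_simps(2)[OF comp_mat_carrier(1) Bc M] using M Bc
    by (simp add: add sq_carrier fls_coeffs_lax B)
  show "fls_coeffs m (M * F) = fls_coeffs m M * comp_mat n 0 v + fls_coeffs (m +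
      1) M * e_mat n 1 n + fls_coeffs m M * B"
    unfolding sq_simps(3)[OF M comp_mat_carrier(1) Bc] using M Bc
    by (simp add: add sq_carrier fls_coeffs_lax B)
qed

lemma Yj_intertwine:
  assumes rc: "r < n" "c < n"
  shows "(comp_mat n 0 v * Yj n j u i) $$ (r, c) + (B * Yj n j u i) $$ (r, c)
     - (Yj n j v i * comp_mat n 0 v) $$ (r, c) - (Yj n j v i * B) $$ (r, c)
   = - ((e_mat n 1 n * Yj n j u (i - 1)) $$ (r, c) - (Yj n j v (i - 1) * e_mat n 1 n) $$ (r, c))"
proof -
  have "fls_coeffs (- i) (Ycan n v ^\<^sub>m j * F) = fls_coeffs (- i) (F * Ycan n u ^\<^sub>m j)"
    by (simp add: Y_pow_intertwine)
  then have "Yj n j v i * comp_mat n 0 v + Yj n j v (i - 1) * e_mat n 1 n + Yj n j v i * B =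
      comp_mat n 0 v * Yj n j u i + e_mat n 1 n * Yj n j u (i - 1) + B * Yj n j u i"
    unfolding fls_coeffs_gauge(1)[OF Ycan_pow_carrier[OF n]] fls_coeffs_gauge(2)[OF
        Ycan_pow_carrier[OF n]] Yj_def
    by simp
  from arg_cong[OF this, of "\<lambda>M. M $$ (r, c)"] show ?thesis
    using rc Yj_dim[OF n] by (simp add: algebra_simps del: index_mult_mat(1))
qed

text \<open>The same telescoping as in \<open>Zs_flat\<close>, now for the coefficients of f Y^j =
  Y'^j f.\<close>

lemma gauge_Z:
  fixes l :: real
  shows "sD.gauge n (sC l) v h * Zs n j u l - Zs n j v l * sD.gauge n (sC l) v h
    = sD.gauge n 0 v h * Zs n j u 0 - Zs n j v 0 * sD.gauge n 0 v h"
proof -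
  note [simp] = Yj_dim[OF n] Yj_carrier[OF n]
  let ?e = "e_mat n 1 n :: sfun mat" and ?f0 = "sD.gauge n 0 v h"
  let ?W = "\<lambda>u l. mpoly n j (\<lambda>i. Yj n j u (int i)) (sC l)"
  let ?f = "\<lambda>l. sD.gauge n (sC l) v h"
  have gs: "(?f l * M) $$ (r, c) = (comp_mat n 0 v * M) $$ (r, c) + (B * M) $$ (r, c) +
      sC l * (?e * M) $$ (r, c)"
    "(M * ?f l) $$ (r, c) = (M * comp_mat n 0 v) $$ (r, c) + (M * B) $$ (r, c) +
        sC l * (M * ?e) $$ (r, c)"
    if "M \<in> carrier_mat n n" "r < n" "c < n" for M r c l
  proof -
    have "?f l * M = comp_mat n (sC l) v * M + B * M" "M * ?f l = M * comp_mat n (sC l) v + M * B"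
      unfolding sD.gauge_def using that by (auto intro!: sq_simps)
    then show "(?f l * M) $$ (r, c) = (comp_mat n 0 v * M) $$ (r, c) + (B * M) $$ (r, c) +
        sC l * (?e * M) $$ (r, c)"
      "(M * ?f l) $$ (r, c) = (M * comp_mat n 0 v) $$ (r, c) + (M * B) $$ (r, c) +
          sC l * (M * ?e) $$ (r, c)"
      using that comp_mat_mult_split[OF that, of "sC l" v]
          by (auto simp: algebra_simps simp del: index_mult_mat(1))
  qed
  note gs0 = gs[where l = 0, unfolded sC_simps]
  have key: "(?f l * ?W u l) $$ (r, c) - (?W v l * ?f l) $$ (r, c) =
       (?f 0 * Yj n j u 0) $$ (r, c) - (Yj n j v 0 * ?f 0) $$ (r, c)" if rc: "r < n" "c < n"
           for r c l
  proof -
    define x where "x i = (comp_mat n 0 v * Yj n j u (int i)) $$ (r, c) +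
        (B * Yj n j u (int i)) $$ (r, c)
       - (Yj n j v (int i) * comp_mat n 0 v) $$ (r, c) - (Yj n j v (int i) * B) $$ (r, c)" for i
    define \<kappa> where "\<kappa> i = (?e * Yj n j u (int i)) $$ (r, c) - (Yj n j v (int i) * ?e) $$ (r, c)"
        for i
    have xk: "x (Suc i) = - \<kappa> i" for i
      using Yj_intertwine[OF rc, of j "int (Suc i)"] by (simp add: x_def \<kappa>_def)
    have "(?f l * ?W u l) $$ (r, c) - (?W v l * ?f l) $$ (r, c) =
      (\<Sum>i\<le>j. ((?f l * Yj n j u (int i)) $$ (r, c) - (Yj n j v (int i) * ?f l) $$ (r, c)) *
          sC l ^ i)"
      using rc by (simp add: mpoly_mult_index sum_subtractf algebra_simps del: index_mult_mat(1))
    also have "\<dots> = (\<Sum>i\<le>j. (x i + sC l * \<kappa> i) * sC l ^ i)"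
      using rc by (intro sum.cong) (auto simp: gs x_def \<kappa>_def algebra_simps simp del:
          index_mult_mat(1))
    also have "\<dots> = x 0 + \<kappa> j * sC l ^ Suc j" by (rule telescope[of x \<kappa>, OF xk])
    also have "\<kappa> j = 0"
    proof -
      have "x (Suc j) = 0"
        using rc Yj_top[OF n, of j "int (Suc j)"] by (simp add: x_def del: of_nat_Suc)
      then show ?thesis using xk[of j] by simp
    qed
    finally show ?thesis using rc gs0[OF Yj_carrier[OF n] rc]
        by (simp add: x_def del: index_mult_mat(1))
  qed
  have Z: "(?f l * Zs n j u l - Zs n j v l * ?f l) $$ (r, c) =
      (?f 0 * Yj n j u 0) $$ (r, c) - (Yj n j v 0 * ?f 0) $$ (r, c)
      - (?f 0 * zmat n j u) $$ (r, c) + (zmat n j v * ?f 0) $$ (r, c)" if rc: "r < n" "c < n"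
          for r c l
  proof -
    \<comment> \<open>The last row and the first column of a strictly upper matrix vanish, so the
      \<zeta> terms acquire no \<lambda>.\<close>
    have e: "(?e * zmat n j u) $$ (r, c) = 0" "(zmat n j v * ?e) $$ (r, c) = 0"
      using rc zmat_upper by (auto simp: e1n_mult_index[unfolded One_nat_def]
          mult_e1n_index[unfolded One_nat_def] simp del: index_mult_mat(1))
    have "?f l * Zs n j u l = ?f l * ?W u l - ?f l * zmat n j u" "Zs n j v l * ?f l =
        ?W v l * ?f l - zmat n j v * ?f l"
      unfolding Zs_def by (auto intro!: sq_simps)
    then show ?thesis using rc key[OF rc, of l] e
      by (simp add: gs[of "zmat n j u"] gs[of "zmat n j v"] gs0[of "zmat n j u"] gs0[of
          "zmat n j v"] algebra_simps del: index_mult_mat(1))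
  qed
  show ?thesis
    using Z[of _ _ l] Z[of _ _ 0] by (intro eq_matI) (auto simp del: index_mult_mat(1)
        index_minus_mat(1))
qed

end

section \<open>Central affine curves\<close>

lemma (in derivation) D_det:
  assumes A: "A \<in> carrier_mat n n"
  shows "D (det A) = (\<Sum>c<n. det (mat n n (\<lambda>(i, j). if j =
      c then D (A $$ (i, j)) else A $$ (i, j))))"
proof -
  let ?S = "{p. p permutes {0..<n}}"
  let ?B = "\<lambda>c. mat n n (\<lambda>(i, j). if j = c then D (A $$ (i, j)) else A $$ (i, j))"
  have det_col: "det M = (\<Sum>p\<in>?S. signof p * (\<Prod>i\<in>{0..<n}. M $$ (p i, i)))" if M:
      "M \<in> carrier_mat n n" for M :: "'a mat"
  proof -
    have "det M = det (transpose_mat M)" using det_transpose[OF M] by simp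
    also have "\<dots> = (\<Sum>p\<in>?S. signof p * (\<Prod>i\<in>{0..<n}. transpose_mat M $$ (i, p i)))"
      using M by (intro det_def') auto
    also have "\<dots> = (\<Sum>p\<in>?S. signof p * (\<Prod>i\<in>{0..<n}. M $$ (p i, i)))"
      using M by (intro sum.cong arg_cong2[of _ _ _ _ "(*)"] prod.cong) (auto dest:
          permutes_in_image)
    finally show ?thesis .
  qed
  have sg: "D (signof p * a) = signof p * D a" for p a
    by (simp add: sign_def D_minus)
  have "D (det A) = (\<Sum>p\<in>?S. \<Sum>c\<in>{0..<n}. signof p * (D (A $$ (p c, c)) * (\<Prod>i\<in>{0..<n}
      - {c}. A $$ (p i, i))))"
    unfolding det_col[OF A] D_sum sg by (simp add: D_prod sum_distrib_left)
  also have "\<dots> = (\<Sum>c\<in>{0..<n}. \<Sum>p\<in>?S. signof p * (D (A $$ (p c, c)) * (\<Prod>i\<in>{0..<n}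
      - {c}. A $$ (p i, i))))"
    by (rule sum.swap)
  also have "\<dots> = (\<Sum>c\<in>{0..<n}. det (?B c))"
  proof (intro sum.cong refl)
    fix c assume c: "c \<in> {0..<n}"
    have "D (A $$ (p c, c)) * (\<Prod>i\<in>{0..<n} - {c}. A $$ (p i, i)) = (\<Prod>i\<in>{0..<n}. ?B c $$ (p i, i))"
        if "p \<in> ?S" for p
    proof -
      have p: "p i < n" if "i < n" for i using \<open>p \<in> ?S\<close> that permutes_in_image[of p
          "{0..<n}" i] by auto
      have "(\<Prod>i\<in>{0..<n}. ?B c $$ (p i, i)) = ?B c $$ (p c, c) * (\<Prod>i\<in>{0..<n}
          - {c}. ?B c $$ (p i, i))"
        using c by (intro prod.remove) auto
      also have "(\<Prod>i\<in>{0..<n} - {c}. ?B c $$ (p i, i)) = (\<Prod>i\<in>{0..<n} - {c}. A $$ (p i, i))"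
        using p by (intro prod.cong) auto
      finally show ?thesis using c p by simp
    qed
    then show "(\<Sum>p\<in>?S. signof p * (D (A $$ (p c, c)) * (\<Prod>i\<in>{0..<n} - {c}. A $$ (p i, i)))) =
        det (?B c)"
      using det_col[of "?B c"] by simp
  qed
  finally show ?thesis by (simp add: lessThan_atLeast0)
qed

text \<open>Cramer's rule gives the coefficients of the last column. It presents the curvature as a
  polynomial in derivatives of the curve, which later yields smoothness in t as well.\<close>

lemma (in derivation) unimodular_frame:
  assumes n: "n > 0" and G: "G \<in> carrier_mat n n" and det: "det G = 1"
    and cols: "\<And>r c. r < n \<Longrightarrow> Suc c < n \<Longrightarrow> D (G $$ (r, c)) = G $$ (r, Suc c)"
  shows "mD G = G * comp_mat n 0 (\<lambda>r. \<Sum>i<n. cofactor G i r * D (G $$ (i, n - 1)))"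
proof -
  let ?A = "adj_mat G" and ?U = "\<lambda>r. \<Sum>i<n. cofactor G i r * D (G $$ (i, n - 1))"
  have A: "?A \<in> carrier_mat n n" "G * ?A = 1\<^sub>m n" "?A * G = 1\<^sub>m n" using adj_mat[OF G] det by auto
  have Ae: "?A $$ (r, i) = cofactor G i r" if "r < n" "i < n" for r i
    using that G by (simp add: adj_mat_def)
  \<comment> \<open>In the columnwise derivative of det = 1, every term except the last has two
    equal columns; the last one is the cofactor expansion of \<open>?U (n - 1)\<close>.\<close>
  have last: "?U (n - 1) = 0"
  proof -
    let ?B = "\<lambda>c. mat n n (\<lambda>(i, j). if j = c then D (G $$ (i, j)) else G $$ (i, j))"
    have bc: "det (?B c) = 0" if "Suc c < n" for c
    proof (rule det_identical_columns[of _ n c "Suc c"])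
      show "col (?B c) c = col (?B c) (Suc c)" using that cols by (intro eq_vecI) auto
    qed (use that in auto)
    have "(\<Sum>c\<in>{..<n} - {n - 1}. det (?B c)) = 0" by (intro sum.neutral ballI bc) auto
    then have "det (?B (n - 1)) = 0"
      using D_det[OF G] det n by (simp add: sum.remove[of "{..<n}" "n - 1"])
    moreover have "det (?B (n - 1)) = (\<Sum>i<n. ?B (n - 1) $$ (i, n - 1) * cofactor (?B (n - 1)) i (n
        - 1))"
      using n by (intro laplace_expansion_column) auto
    moreover have "cofactor (?B (n - 1)) i (n - 1) = cofactor G i (n - 1)" if "i < n" for i
    proof -
      have "mat_delete (?B (n - 1)) i (n - 1) = mat_delete G i (n - 1)"
        using G n by (intro eq_matI) (auto simp: mat_delete_def)
      then show ?thesis by (simp add: cofactor_def)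
    qed
    ultimately show ?thesis using n by (simp add: mult.commute)
  qed
  have "?A * mD G = comp_mat n 0 ?U"
  proof (rule eq_matI)
    fix r c assume "r < dim_row (comp_mat n 0 ?U)" "c < dim_col (comp_mat n 0 ?U)"
    then have rc: "r < n" "c < n" by auto
    have "(?A * mD G) $$ (r, c) = (\<Sum>i<n. ?A $$ (r, i) * D (G $$ (i, c)))"
      using sq_mult_index[of ?A n "mD G" r c] A(1) G rc by simp
    also have "\<dots> = comp_mat n 0 ?U $$ (r, c)"
    proof (cases "Suc c < n")
      case True
      then have "(\<Sum>i<n. ?A $$ (r, i) * D (G $$ (i, c))) = (?A * G) $$ (r, Suc c)"
        using sq_mult_index[OF A(1) G rc(1) True] cols by simp
      then show ?thesis unfolding A(3) using rc True by (auto simp: comp_mat_def)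
    next
      case False
      then have c: "c = n - 1" using rc by simp
      have "(\<Sum>i<n. ?A $$ (r, i) * D (G $$ (i, c))) = ?U r"
        using rc c by (intro sum.cong) (auto simp: Ae)
      also have "\<dots> = comp_mat n 0 ?U $$ (r, c)"
        using rc c last by (cases "r = n - 1") (auto simp: comp_mat_def)
      finally show ?thesis .
    qed
    finally show "(?A * mD G) $$ (r, c) = comp_mat n 0 ?U $$ (r, c)" .
  qed (use A G in auto)
  then have "G * comp_mat n 0 ?U = G * (?A * mD G)" by simp
  also have "\<dots> = mD G"
    using A G assoc_mult_mat[of G n n ?A n "mD G" n] by simp
  finally show ?thesis ..
qed

lemma ca_frame_index: "r < n \<Longrightarrow> c < n \<Longrightarrow> ca_frame n \<gamma> x $$ (r, c) = (deriv ^^ c) (\<lambda>y. \<gamma> y $ r) x"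
  by (simp add: ca_frame_def mat_of_cols_index curve_deriv_def)

lemma ca_frame_carrier [simp]: "ca_frame n \<gamma> x \<in> carrier_mat n n"
  "dim_row (ca_frame n \<gamma> x) = n" "dim_col (ca_frame n \<gamma> x) = n"
  by (auto simp: ca_frame_def)

lemma deriv_iterate_sapp: "(deriv ^^ i) (sapp a) = sapp ((sD ^^ i) a)"
proof (induction i)
  case (Suc i)
  have "deriv (sapp b) = sapp (sD b)" for b by auto
  then show ?case by (simp only: funpow.simps o_apply Suc)
qed simp

definition sframe :: "nat \<Rightarrow> (nat \<Rightarrow> sfun) \<Rightarrow> sfun mat" where
  "sframe n \<Gamma> = mat n n (\<lambda>(r, c). (sD ^^ c) (\<Gamma> r))"

lemma sframe_carrier [simp]: "sframe n \<Gamma> \<in> carrier_mat n n" "dim_row (sframe n \<Gamma>) =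
    n" "dim_col (sframe n \<Gamma>) = n"
  by (auto simp: sframe_def)

lemma ca_frame_sframe:
  fixes \<gamma> :: "real \<Rightarrow> real vec"
  assumes "\<And>r. r < n \<Longrightarrow> (\<lambda>y. \<gamma> y $ r) = sapp (\<Gamma> r)"
  shows "ca_frame n \<gamma> x = evm x (sframe n \<Gamma>)"
  using assms by (intro eq_matI) (auto simp: ca_frame_index deriv_iterate_sapp sframe_def)

lemma umat_V: "umat n U x \<in> V_space n"
  by (auto simp: umat_def V_space_iff)

lemma ca_curvature_eq:
  assumes G: "G \<in> carrier_mat n n" and A: "A \<in> carrier_mat n n" "A * G = 1\<^sub>m n"
    and fr: "\<And>x. ca_frame n \<gamma> x = evm x G" and flat: "map_mat sD G = G * comp_mat n 0 U"
  shows "ca_curvature n \<gamma> = umat n U"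
proof
  fix x
  have fr': "ca_frame n \<gamma> = (\<lambda>x. evm x G)" using fr by auto
  have e: "mat_deriv n (ca_frame n \<gamma>) x = evm x G * (b_mat n + umat n U x)"
    unfolding fr' mat_deriv_evm[OF G] flat b_plus_umat using G
        by (simp add: sapp.mat_hom_mult[of _ n n _ n])
  have AG: "evm x A * evm x G = 1\<^sub>m n"
    using A G by (simp add: sapp.mat_hom_mult[of _ n n _ n, symmetric] sapp.mat_hom_one)
  show "ca_curvature n \<gamma> x = umat n U x"
    unfolding ca_curvature_def
  proof (rule the_equality)
    show "umat n U x \<in> V_space n \<and> mat_deriv n (ca_frame n \<gamma>) x =
        ca_frame n \<gamma> x * (b_mat n + umat n U x)"
      using e fr umat_V by simp
    fix u assume u: "u \<in> V_space n \<and> mat_deriv n (ca_frame n \<gamma>) x = ca_frame n \<gamma> x * (b_mat n + u)"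
    then obtain a where a: "u = last_col n a" using V_space_iff by blast
    have c: "b_mat n + u \<in> carrier_mat n n" "b_mat n + umat n U x \<in> carrier_mat n n"
      unfolding a umat_def b_mat_plus_last_col by auto
    have "evm x G * (b_mat n + u) = evm x G * (b_mat n + umat n U x)" using u e fr by simp
    then have "evm x A * (evm x G * (b_mat n + u)) = evm x A * (evm x G * (b_mat n +
        umat n U x))" by simp
    then have "(evm x A * evm x G) * (b_mat n + u) = (evm x A * evm x G) * (b_mat n + umat n U x)"
      using c A G by (simp add: assoc_mult_mat[of _ n n _ n _ n])
    then have "b_mat n + u = b_mat n + umat n U x" unfolding AG left_mult_one_mat[OF c(1)]
        left_mult_one_mat[OF c(2)] .
    then have *: "(b_mat n + u) $$ (r, c) = (b_mat n + umat n U x) $$ (r, c)" for r c by simp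
    show "u = umat n U x"
    proof (rule eq_matI)
      fix r c assume "r < dim_row (umat n U x)" "c < dim_col (umat n U x)"
      then show "u $$ (r, c) = umat n U x $$ (r, c)" using *[of r c]
          unfolding a by (simp add: umat_def)
    qed (auto simp: a umat_def)
  qed
qed

definition curv :: "nat \<Rightarrow> (nat \<Rightarrow> sfun) \<Rightarrow> nat \<Rightarrow> sfun" where
  "curv n \<Gamma> r = (\<Sum>i<n. cofactor (sframe n \<Gamma>) i r * (sD ^^ n) (\<Gamma> i))"

lemma ca_curve_lift:
  fixes \<gamma> :: "real \<Rightarrow> real vec"
  assumes n: "n > 0" and \<gamma>: "\<gamma> \<in> ca_curves n"
  defines "\<Gamma> \<equiv> \<lambda>r. Sfun (\<lambda>x. \<gamma> x $ r)"
  shows "\<And>r. r < n \<Longrightarrow> (\<lambda>y. \<gamma> y $ r) = sapp (\<Gamma> r)"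
    "\<And>x. ca_frame n \<gamma> x = evm x (sframe n \<Gamma>)"
    "det (sframe n \<Gamma>) = 1"
    "map_mat sD (sframe n \<Gamma>) = sframe n \<Gamma> * comp_mat n 0 (curv n \<Gamma>)"
    "ca_curvature n \<gamma> = umat n (curv n \<Gamma>)"
proof -
  show 1: "(\<lambda>y. \<gamma> y $ r) = sapp (\<Gamma> r)" if "r < n" for r
    using \<gamma> that by (auto simp: \<Gamma>_def ca_curves_def sapp_Sfun)
  show 2: "ca_frame n \<gamma> x = evm x (sframe n \<Gamma>)" for x using 1 by (rule ca_frame_sframe)
  show 3: "det (sframe n \<Gamma>) = 1"
  proof (rule sfun_eqI)
    fix x
    have "sapp (det (sframe n \<Gamma>)) x = det (ca_frame n \<gamma> x)" unfolding 2 by (simp add: sapp.hom_det)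
    then show "sapp (det (sframe n \<Gamma>)) x = sapp 1 x" using \<gamma> by (simp add: ca_curves_def)
  qed
  have "sD (sframe n \<Gamma> $$ (i, n - 1)) = (sD ^^ n) (\<Gamma> i)" if "i < n" for i
    using that n by (cases n) (auto simp: sframe_def)
  then have "curv n \<Gamma> = (\<lambda>r. \<Sum>i<n. cofactor (sframe n \<Gamma>) i r * sD (sframe n \<Gamma> $$ (i, n - 1)))"
    by (auto simp: curv_def intro!: sum.cong)
  then show 4: "map_mat sD (sframe n \<Gamma>) = sframe n \<Gamma> * comp_mat n 0 (curv n \<Gamma>)"
    using sD.unimodular_frame[OF n sframe_carrier(1) 3] by (simp add: sframe_def)
  have "adj_mat (sframe n \<Gamma>) \<in> carrier_mat n n" "adj_mat (sframe n \<Gamma>) * sframe n \<Gamma> = 1\<^sub>m n"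
    using adj_mat[OF sframe_carrier(1), of n \<Gamma>] 3 by auto
  from ca_curvature_eq[OF sframe_carrier(1) this 2 4] show "ca_curvature n \<gamma> = umat n (curv n \<Gamma>)" .
qed

section \<open>Translation of the Baecklund system\<close>

text \<open>The functions \<open>w\<^sub>i\<close> and \<open>u\<^sub>i\<close> appear here with the index \<open>r = i - 1\<close>.\<close>

fun swrev :: "nat \<Rightarrow> (nat \<Rightarrow> sfun) \<Rightarrow> sfun \<Rightarrow> nat \<Rightarrow> sfun" where
  "swrev n U H 0 = 1"
| "swrev n U H (Suc 0) = - H"
| "swrev n U H (Suc (Suc m)) = - sD (swrev n U H (Suc m)) - H * swrev n U H (Suc m) - U (n
    - Suc (Suc m))"

definition sw :: "nat \<Rightarrow> (nat \<Rightarrow> sfun) \<Rightarrow> sfun \<Rightarrow> nat \<Rightarrow> sfun" where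
  "sw n U H r = swrev n U H (n - Suc r)"

lemma ucoeff_umat: "r < n - 1 \<Longrightarrow> ucoeff n (umat n U x) (Suc r) = sapp (U r) x"
  by (simp add: ucoeff_def umat_def last_col_def)

lemma w_rev_sapp:
  assumes "n \<ge> 2" "m < n"
  shows "w_rev n (umat n U) (sapp H) m = sapp (swrev n U H m)"
  using assms(2)
proof (induction m rule: induct_nat_012)
  case (ge2 m)
  have i: "n - Suc m = Suc (n - Suc (Suc m))" using ge2.prems by simp
  have "n - Suc (Suc m) < n - 1" using assms(1) by simp
  moreover have "w_rev n (umat n U) (sapp H) (Suc m) = sapp (swrev n U H (Suc m))" using ge2 by simp
  ultimately show ?case using ucoeff_umat[of "n - Suc (Suc m)" n U] by (intro ext) (simp add: i)
qed (auto simp: fun_eq_iff)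

lemma w_fun_sapp:
  assumes "n \<ge> 2"
  shows "w_fun n (umat n U) (sapp H) (Suc r) = sapp (sw n U H r)"
  using w_rev_sapp[of n "n - Suc r" U H] assms by (simp add: w_fun_def sw_def)

lemma w_vec_sapp: "n \<ge> 2 \<Longrightarrow> w_vec n (umat n U) (sapp H) x =
    map_vec (\<lambda>a. sapp a x) (vec n (sw n U H))"
  by (intro eq_vecI) (auto simp: w_vec_def vec1_def w_fun_sapp)

text \<open>The n equations of \<open>bt\<close> are the recursion that defines w, for r > 0, and
  the first Baecklund equation, for r = 0.\<close>

lemma bt_sw:
  assumes n: "n \<ge> 2"
    and eq: "\<And>x. deriv (w_fun n (umat n U) (sapp H) 1) x +
        sapp H x * w_fun n (umat n U) (sapp H) 1 x
        + ucoeff n (umat n U x) 1 + k = 0"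
  shows "sD.bt n U (sw n U H) H (sC k)"
  unfolding sD.bt_def
proof (intro conjI allI impI)
  show "sw n U H (n - 1) = 1" using n by (simp add: sw_def)
  fix r assume r: "r < n"
  show "sD (sw n U H r) + (if r = 0 then 0 else sw n U H (r - 1)) + (if r < n - 1 then U r else 0) +
      H * sw n U H r
        = (if r = 0 then - sC k else 0)"
  proof (cases "r = 0")
    case True
    have "sD (sw n U H 0) + H * sw n U H 0 + U 0 + sC k = 0"
      using eq w_fun_sapp[OF n, of U H 0] ucoeff_umat[of 0 n U] n by (intro sfun_eqI) simp
    then show ?thesis using True n by (simp add: algebra_simps eq_neg_iff_add_eq_0)
  next
    case False
    show ?thesis
    proof (cases "r < n - 1")
      case True
      define m where "m = n - r - 2"
      have m: "n - r = Suc (Suc m)" "n - Suc r = Suc m" "n - Suc (Suc m) = r"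
          using True by (auto simp: m_def)
      show ?thesis using True False m by (simp add: sw_def)
    next
      case F: False
      then have "n - Suc r = 0" "n - r = Suc 0" using r by auto
      then show ?thesis using F False by (simp add: sw_def)
    qed
  qed
qed simp

text \<open>The summand h I is the diagonal of the binomial matrix, and the binomial terms of N are
  the part above it.\<close>

lemma f_mat_sapp:
  assumes n: "n \<ge> 2"
  shows "f_mat n (umat n U) (sapp H) x l = evm x (sD.gauge n (sC l) (sD.ut n U (sw n U H) H) H)"
      (is "?L = ?R")
proof (rule eq_matI)
  let ?w = "sw n U H"
  have s: "ucoeff n (umat n U x) (Suc r) + s_fun n (umat n U) (sapp H) (Suc r) x =
      sapp (sD.ut n U ?w H r) x"
    if r: "r < n - 1" for r
  proof -
    have "{Suc r..<n} = {Suc r..n - 1}" using n by auto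
    then have "(\<Sum>m=Suc r + 1..n. real ((m - 1) choose (Suc r
        - 1)) * w_fun n (umat n U) (sapp H) m x * (deriv ^^ (m - Suc r)) (sapp H) x)
      = (\<Sum>c=Suc r..<n. real (c choose r) * sapp (?w c) x * sapp ((sD ^^ (c - r)) H) x)"
      using n sum.shift_bounds_cl_Suc_ivl[of "\<lambda>m. real ((m - 1) choose (Suc r
          - 1)) * w_fun n (umat n U) (sapp H) m x * (deriv ^^ (m - Suc r)) (sapp H) x" "Suc r" "n
          - 1"]
      by (simp add: w_fun_sapp deriv_iterate_sapp)
    then show ?thesis
      unfolding s_fun_def sD.ut_def ucoeff_umat[OF r] w_fun_sapp[OF n] by (simp add: sapp.hom_sum)
  qed
  fix r c assume "r < dim_row ?R" "c < dim_col ?R"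
  then have rc: "r < n" "c < n" by auto
  have R: "?R $$ (r, c) = (if r = c + 1 then 1 else 0) + (if c = n - 1 then (if r =
      0 then l else 0) +
      (if r < n - 1 then sapp (sD.ut n U ?w H r) x else 0) else 0) +
          real (c choose r) * sapp ((sD ^^ (c - r)) H) x"
    using rc by (auto simp: sD.gauge_def comp_mat_def sD.bin_mat_def)
  have L: "?L $$ (r, c) = (if r = 0 \<and> c = n - 1 then l else 0) + (if r =
      c + 1 then 1 else 0) + (if r = c then sapp H x else 0)
     + N_mat n (umat n U) (sapp H) x $$ (r, c)"
    using rc by (auto simp: f_mat_def J_mat_def e_mat_def b_mat_def mat1_def N_mat_def)
  have N: "N_mat n (umat n U) (sapp H) x $$ (r, c) =
     (if r < c \<and> c < n - 1 then real (c choose r) * sapp ((sD ^^ (c - r)) H) x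
      else if r < n - 1 \<and> c = n - 1 then sapp (sD.ut n U ?w H r) x +
          real (c choose r) * sapp ((sD ^^ (c - r)) H) x else 0)"
    using rc s[of r] by (auto simp: N_mat_def mat1_def deriv_iterate_sapp)
  consider "r < c" | "r = c" | "r > c" by linarith
  then show "?L $$ (r, c) = ?R $$ (r, c)"
    unfolding L R N using rc by cases (auto simp: binomial_eq_0)
qed (auto simp: f_mat_def N_mat_def mat1_def)

section \<open>Determinant of the gauge matrix\<close>

text \<open>Multiplying on the right by a unipotent matrix with last column w turns the last column
  of f into (\<lambda> - k) e_1. The remaining minor is upper triangular with the subdiagonal ones
  of b on its diagonal.\<close>

lemma (in derivation) det_gauge:
  assumes n: "n \<ge> 2" and bt: "bt n u w h k"
  shows "det (gauge n l (ut n u w h) h) = (- 1) ^ (n - 1) * (l - k)"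
proof -
  let ?f = "gauge n l (ut n u w h) h"
  define E where "E = mat n n (\<lambda>(r, c). if c = n - 1 then w r else if r = c then 1 else 0)"
  have E: "E \<in> carrier_mat n n" by (simp add: E_def)
  have w1: "w (n - 1) = 1" using bt by (simp add: bt_def)
  have detE: "det E = 1"
  proof -
    have "upper_triangular E" by (auto simp: upper_triangular_def E_def)
    then have "det E = prod_list (diag_mat E)" by (rule det_upper_triangular[OF _ E])
    also have "diag_mat E = map (\<lambda>i. 1) [0..<n]"
      using w1 by (auto simp: diag_mat_def E_def intro!: map_cong)
    finally show ?thesis by (simp add: map_replicate_const)
  qed
  define A where "A = ?f * E"
  have A: "A \<in> carrier_mat n n" using E by (simp add: A_def sq_carrier)
  have A1: "A $$ (r, c) = ?f $$ (r, c)" if "r < n" "c < n - 1" for r c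
  proof -
    have "A $$ (r, c) = (\<Sum>s<n. if s = c then ?f $$ (r, s) else 0)"
      unfolding A_def sq_mult_index[OF gauge_carrier(1) E that(1) order.strict_trans2[OF that(2)
          diff_le_self]]
      using that by (intro sum.cong) (auto simp: E_def)
    also have "\<dots> = ?f $$ (r, c)" using that by (subst sum.delta) auto
    finally show ?thesis .
  qed
  have A2: "A $$ (r, n - 1) = (if r = 0 then l - k else 0)" if "r < n" for r
  proof -
    have "A $$ (r, n - 1) = (\<Sum>s<n. ?f $$ (r, s) * w s)"
      using sq_mult_index[OF gauge_carrier(1) E that, of "n - 1"] n by (simp add: A_def E_def)
    also have "\<dots> = (?f *\<^sub>v vec n w) $ r" using that by (simp add: scalar_prod_def lessThan_atLeast0)
    also have "\<dots> = (if r = 0 then l - k else 0)" unfolding gauge_vec[OF n bt] using that by simp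
    finally show ?thesis .
  qed
  have "det ?f = det A" using det_mult[OF gauge_carrier(1) E] detE by (simp add: A_def)
  also have "\<dots> = (\<Sum>i<n. A $$ (i, n - 1) * cofactor A i (n - 1))"
    using A n by (intro laplace_expansion_column) auto
  also have "\<dots> = (\<Sum>i<n. if i = 0 then (l - k) * cofactor A i (n - 1) else 0)"
    by (intro sum.cong) (auto simp: A2[unfolded One_nat_def])
  also have "\<dots> = (l - k) * cofactor A 0 (n - 1)" using n by (subst sum.delta) auto
  also have "cofactor A 0 (n - 1) = (- 1) ^ (n - 1)"
  proof -
    let ?M = "mat_delete A 0 (n - 1)"
    have M: "?M \<in> carrier_mat (n - 1) (n - 1)" using A by (auto simp: mat_delete_def)
    have Me: "?M $$ (i, j) = ?f $$ (Suc i, j)" if "i < n - 1" "j < n - 1" for i j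
      using that A A1[of "Suc i" j] by (simp add: mat_delete_def)
    have fe: "?f $$ (Suc i, j) = (if i = j then 1 else 0)" if "i < n - 1" "j \<le> i" for i j
      using that by (auto simp: gauge_def comp_mat_def bin_mat_def binomial_eq_0)
    have "upper_triangular ?M" using M Me fe by (auto simp: upper_triangular_def)
    then have "det ?M = prod_list (diag_mat ?M)" by (rule det_upper_triangular[OF _ M])
    also have "diag_mat ?M = map (\<lambda>i. 1) [0..<n - 1]"
      using M Me fe by (auto simp: diag_mat_def intro!: map_cong)
    finally have "det ?M = 1" by (simp add: map_replicate_const)
    then show ?thesis by (simp add: cofactor_def)
  qed
  finally show ?thesis by (simp add: mult.commute)
qed

section \<open>Evolution under the flow\<close>

lemma covD:
  assumes n: "n \<ge> 2" and Z: "Z \<in> carrier_mat n n" and flat: "cov n U l Z = last_col n \<theta>"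
  shows "map_mat sD Z = Z * comp_mat n l U - comp_mat n l U * Z + last_col n \<theta>"
proof -
  have c: "comp_mat n l U * Z \<in> carrier_mat n n" "Z * comp_mat n l U \<in> carrier_mat n n"
    using Z by (auto simp: sq_carrier)
  show ?thesis unfolding flat[symmetric] cov_def using Z c
    by (intro eq_matI) (auto simp del: index_mult_mat(1))
qed

lemma last_col_mult_vec:
  fixes \<theta> :: "nat \<Rightarrow> 'a::comm_ring_1"
  assumes v: "v \<in> carrier_vec n" and r: "r < n"
  shows "(last_col n \<theta> *\<^sub>v v) $ r = (if r < n - 1 then \<theta> r * v $ (n - 1) else 0)"
proof -
  have "(last_col n \<theta> *\<^sub>v v) $ r = (\<Sum>c<n. last_col n \<theta> $$ (r, c) * v $ c)"
    using assms by (simp add: scalar_prod_def lessThan_atLeast0)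
  also have "\<dots> = (\<Sum>c<n. if c = n - 1 then (if r < n - 1 then \<theta> r * v $ c else 0) else 0)"
    using r by (intro sum.cong) (auto simp: last_col_def)
  also have "\<dots> = (if r < n - 1 then \<theta> r * v $ (n - 1) else 0)" using r by (subst sum.delta) auto
  finally show ?thesis .
qed

lemma mult_last_col_index:
  fixes M :: "'a::comm_ring_1 mat"
  assumes "M \<in> carrier_mat n n" "r < n" "c < n"
  shows "(M * last_col n \<theta>) $$ (r, c) = (if c = n - 1 then (\<Sum>i<n - 1. M $$ (r, i) * \<theta> i) else 0)"
proof -
  have "(M * last_col n \<theta>) $$ (r, c) = (\<Sum>i<n. if i < n - 1 then (if c =
      n - 1 then M $$ (r, i) * \<theta> i else 0) else 0)"
    unfolding sq_mult_index[OF assms(1) last_col_carrier(1) assms(2,3)]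
    using assms by (intro sum.cong) (auto simp: last_col_def)
  also have "\<dots> = (\<Sum>i<n - 1. if c = n - 1 then M $$ (r, i) * \<theta> i else 0)"
    by (rule sum.mono_neutral_cong_right) auto
  finally show ?thesis by simp
qed

text \<open>\<open>w\<^sub>t + Z w - (Z w)\<^sub>n w\<close> solves the homogeneous equation of \<open>w\<close> with vanishing last component,
  which forces all components to vanish one after the other.\<close>

lemma w_evolution:
  assumes n: "n \<ge> 2" and bt: "sD.bt n U W H k" and Z: "Z \<in> carrier_mat n n"
    and flat: "cov n U k Z = last_col n \<theta>"
    and Ht: "Ht = - sD ((Z *\<^sub>v vec n W) $ (n - 1))"
    and Wn: "Wt (n - 1) = 0"
    and Wt: "\<And>r. r < n \<Longrightarrow> sD (Wt r) + (if r = 0 then 0 else Wt (r - 1)) +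
        (if r < n - 1 then \<theta> r else 0)
        + Ht * W r + H * Wt r = 0"
    and r: "r < n"
  shows "Wt r = (Z *\<^sub>v vec n W) $ (n - 1) * W r - (Z *\<^sub>v vec n W) $ r"
proof -
  define y where "y = Z *\<^sub>v vec n W"
  have yc: "y \<in> carrier_vec n" using Z by (simp add: y_def)
  have w1: "W (n - 1) = 1" using bt by (simp add: sD.bt_def)
  have weq: "sD (W r) + (if r = 0 then 0 else W (r - 1)) + (if r < n - 1 then U r else 0) +
      H * W r = (if r = 0 then - k else 0)"
    if "r < n" for r using bt that by (auto simp: sD.bt_def)
  let ?K = "comp_mat n k U" and ?w = "vec n W"
  \<comment> \<open>For \<lambda> = k the multiple of e_1 in \<open>bt_vec\<close> disappears, so w
    solves a homogeneous equation and y = Z w inherits it up to \<theta>.\<close>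
  have yeq: "sD (y $ r) + (if r = 0 then k * y $ (n - 1) else y $ (r - 1)) +
      (if r < n - 1 then U r * y $ (n - 1) else 0) + H * y $ r
      = (if r < n - 1 then \<theta> r else 0)" if r: "r < n" for r
  proof -
    have wc: "?w \<in> carrier_vec n" "map_vec sD ?w \<in> carrier_vec n" "?K *\<^sub>v ?w \<in> carrier_vec n"
      by (auto intro: mult_mat_vec_carrier[of _ n n])
    have c: "Z * ?K \<in> carrier_mat n n" "?K * Z \<in> carrier_mat n n" using Z by (auto simp: sq_carrier)
    have "map_vec sD y = map_mat sD Z *\<^sub>v ?w + Z *\<^sub>v map_vec sD ?w"
      unfolding y_def by (rule sD.mD_mult_vec[OF Z wc(1)])
    also have "map_mat sD Z *\<^sub>v ?w = (Z * ?K - ?K * Z) *\<^sub>v ?w + last_col n \<theta> *\<^sub>v ?w"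
      unfolding covD[OF n Z flat] by (rule add_mult_distrib_mat_vec[OF sq_carrier(3)[OF c]
          last_col_carrier(1) wc(1)])
    also have "(Z * ?K - ?K * Z) *\<^sub>v ?w = Z *\<^sub>v (?K *\<^sub>v ?w) - ?K *\<^sub>v y"
      unfolding y_def minus_mult_distrib_mat_vec[OF c wc(1)] assoc_mult_mat_vec[OF Z
          comp_mat_carrier(1) wc(1)]
        assoc_mult_mat_vec[OF comp_mat_carrier(1) Z wc(1)] ..
    finally have 1: "map_vec sD y = Z *\<^sub>v (?K *\<^sub>v ?w) - ?K *\<^sub>v y + last_col n \<theta> *\<^sub>v ?w +
        Z *\<^sub>v map_vec sD ?w" .
    have "Z *\<^sub>v map_vec sD ?w + Z *\<^sub>v (?K *\<^sub>v ?w) = Z *\<^sub>v (map_vec sD ?w + ?K *\<^sub>v ?w)"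
      using mult_add_distrib_mat_vec[OF Z wc(2,3)] by simp
    also have "map_vec sD ?w + ?K *\<^sub>v ?w = (- H) \<cdot>\<^sub>v ?w"
      unfolding sD.bt_vec[OF n bt] by (intro eq_vecI) auto
    also have "Z *\<^sub>v ((- H) \<cdot>\<^sub>v ?w) = (- H) \<cdot>\<^sub>v y"
      unfolding y_def by (rule mult_mat_smult_vec[OF Z wc(1)])
    finally have 2: "(Z *\<^sub>v map_vec sD ?w + Z *\<^sub>v (?K *\<^sub>v ?w)) $ r = ((- H) \<cdot>\<^sub>v y) $ r" by simp
    have "map_vec sD y $ r = (Z *\<^sub>v (?K *\<^sub>v ?w)) $ r - (?K *\<^sub>v y) $ r + (last_col n \<theta> *\<^sub>v ?w) $ r +
        (Z *\<^sub>v map_vec sD ?w) $ r"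
      unfolding 1 using r Z by (simp del: index_mult_mat_vec)
    moreover have "map_vec sD y $ r = sD (y $ r)" using r yc by simp
    moreover have "(Z *\<^sub>v map_vec sD ?w) $ r + (Z *\<^sub>v (?K *\<^sub>v ?w)) $ r = - H * y $ r"
      using 2 r Z yc by (simp del: index_mult_mat_vec)
    moreover have "(last_col n \<theta> *\<^sub>v ?w) $ r = (if r < n - 1 then \<theta> r else 0)"
      using last_col_mult_vec[OF wc(1) r, of \<theta>] w1 n by simp
    moreover have "(?K *\<^sub>v y) $ r = (if r = 0 then k * y $ (n - 1) else y $ (r - 1)) +
        (if r < n - 1 then U r * y $ (n - 1) else 0)"
      by (rule comp_mat_mult_vec_index[OF yc r])
    ultimately show ?thesis by (simp add: algebra_simps del: index_mult_mat_vec)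
  qed
  \<comment> \<open>Subtracting y_n w kills the last component. The prescribed h_t is what cancels
    the x-derivative of y_n produced by this subtraction.\<close>
  define V where "V r = Wt r + y $ r - y $ (n - 1) * W r" for r
  have Vn: "V (n - 1) = 0" using Wn w1 by (simp add: V_def)
  have Vrec: "V (r - 1) = - sD (V r) - H * V r" if r: "r < n" "r > 0" for r
  proof -
    have "sD (V r) = sD (Wt r) + sD (y $ r) - sD (y $ (n - 1)) * W r - y $ (n - 1) * sD (W r)"
      by (simp add: V_def sD.D_add sD.D_diff sD.D_mult algebra_simps)
    moreover have "sD (Wt r) = - Wt (r - 1) - (if r < n - 1 then \<theta> r else 0) - Ht * W r - H * Wt r"
      using Wt[OF r(1)] r(2) by (simp add: algebra_simps eq_neg_iff_add_eq_0)
    moreover have "sD (y $ r) = (if r < n - 1 then \<theta> r else 0) - y $ (r - 1) - (if r < n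
        - 1 then U r * y $ (n - 1) else 0) - H * y $ r"
      using yeq[OF r(1)] r(2) by (simp add: algebra_simps)
    moreover have "sD (W r) = - W (r - 1) - (if r < n - 1 then U r else 0) - H * W r"
      using weq[OF r(1)] r(2) by (simp add: algebra_simps eq_neg_iff_add_eq_0)
    ultimately show ?thesis
      unfolding Ht y_def[symmetric] V_def by (cases "r < n - 1") (simp_all add: algebra_simps)
  qed
  have "V (n - 1 - m) = 0" if "m < n" for m
    using that
  proof (induction m)
    case (Suc m)
    then show ?case using Vrec[of "n - 1 - m"] by simp
  qed (use Vn in simp)
  from this[of "n - 1 - r"] r have "V r = 0" by simp
  then show ?thesis by (simp add: V_def y_def algebra_simps)
qed

text \<open>Apply \<open>gauge_Z\<close> to w. At \<lambda> = k we have f w = 0, at \<lambda> = 0 we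
  have f w = -k e_1, and f(k) - f(0) = k e_1n contributes k y_n e_1 = -f(0) (y_n w). The bracket is
  Z(0) w + w_t, so the right side is already the new flow up to the factor -k.\<close>

lemma gauge_w_evolution:
  fixes n j :: nat and k :: real
  assumes n: "n \<ge> 2" and bt: "sD.bt n U W H (sC k)"
  defines "v \<equiv> sD.ut n U W H" and "y \<equiv> Zs n j U k *\<^sub>v vec n W"
  shows "sD.gauge n 0 v H *\<^sub>v (Zs n j U 0 *\<^sub>v vec n W + (y $ (n - 1) \<cdot>\<^sub>v vec n W - y))
    = sC (- k) \<cdot>\<^sub>v (Zs n j v 0 *\<^sub>v unit_vec n 0)"
proof -
  let ?F0 = "sD.gauge n 0 v H" and ?Fk = "sD.gauge n (sC k) v H" and ?w = "vec n W"
  let ?Z0 = "Zs n j U 0" and ?Zk = "Zs n j U k" and ?Z0' = "Zs n j v 0" and ?Zk' = "Zs n j v k"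
  note Zc = Zs_carrier(1)
  have wc: "?w \<in> carrier_vec n" by simp
  have yc: "y \<in> carrier_vec n" unfolding y_def using Zc
      by (intro mult_mat_vec_carrier[of _ n n]) auto
  have F0w: "?F0 *\<^sub>v ?w = sC (- k) \<cdot>\<^sub>v unit_vec n 0"
    unfolding v_def sD.gauge_vec[OF n bt] by (intro eq_vecI) (auto intro!: sfun_eqI)
  have Fkw: "?Fk *\<^sub>v ?w = 0\<^sub>v n"
    unfolding v_def sD.gauge_vec[OF n bt] by (intro eq_vecI) auto
  have g: "?Fk * ?Zk - ?Zk' * ?Fk = ?F0 * ?Z0 - ?Z0' * ?F0"
    unfolding v_def by (rule gauge_Z[OF n bt])
  have app: "(A * B - C * E) *\<^sub>v ?w = A *\<^sub>v (B *\<^sub>v ?w) - C *\<^sub>v (E *\<^sub>v ?w)"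
    if "A \<in> carrier_mat n n" "B \<in> carrier_mat n n" "C \<in> carrier_mat n n" "E \<in> carrier_mat n n"
        for A B C E :: "sfun mat"
    using minus_mult_distrib_mat_vec[OF sq_carrier(1)[OF that(1,2)] sq_carrier(1)[OF that(3,4)] wc]
      assoc_mult_mat_vec[OF that(1,2) wc] assoc_mult_mat_vec[OF that(3,4) wc] by simp
  have "?Fk *\<^sub>v y - ?Zk' *\<^sub>v 0\<^sub>v n = ?F0 *\<^sub>v (?Z0 *\<^sub>v ?w) - ?Z0' *\<^sub>v (sC (- k) \<cdot>\<^sub>v unit_vec n 0)"
    using arg_cong[OF g, of "\<lambda>M. M *\<^sub>v ?w"]
    unfolding app[OF sD.gauge_carrier(1) Zc Zc sD.gauge_carrier(1)] Fkw F0w y_def .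
  moreover have "?Zk' *\<^sub>v 0\<^sub>v n = 0\<^sub>v n" using Zc[of n j v k] by (intro eq_vecI) auto
  moreover have "?Z0' *\<^sub>v (sC (- k) \<cdot>\<^sub>v unit_vec n 0) = sC (- k) \<cdot>\<^sub>v (?Z0' *\<^sub>v unit_vec n 0)"
    by (rule mult_mat_smult_vec[OF Zc]) simp
  ultimately have main: "?Fk *\<^sub>v y - 0\<^sub>v n = ?F0 *\<^sub>v (?Z0 *\<^sub>v ?w)
      - sC (- k) \<cdot>\<^sub>v (?Z0' *\<^sub>v unit_vec n 0)" by simp
  have Fky: "(?Fk *\<^sub>v y) $ r = (?F0 *\<^sub>v y) $ r + (if r = 0 then sC k * y $ (n - 1) else 0)" if r:
      "r < n" for r
    unfolding sD.gauge_def add_mult_distrib_mat_vec[OF comp_mat_carrier(1) sD.bin_mat_carrier(1) yc]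
    using r yc by (simp add: comp_mat_mult_vec_index[OF yc r] del: index_mult_mat_vec)
  have zc: "?Z0 *\<^sub>v ?w \<in> carrier_vec n" using Zc by (intro mult_mat_vec_carrier[of _ n n]) auto
  have dist: "?F0 *\<^sub>v (?Z0 *\<^sub>v ?w + (y $ (n - 1) \<cdot>\<^sub>v ?w - y)) =
      ?F0 *\<^sub>v (?Z0 *\<^sub>v ?w) + (y $ (n - 1) \<cdot>\<^sub>v (?F0 *\<^sub>v ?w) - ?F0 *\<^sub>v y)"
    using mult_add_distrib_mat_vec[OF sD.gauge_carrier(1) zc, of "y $ (n - 1) \<cdot>\<^sub>v ?w - y" 0 v H]
      mult_minus_distrib_mat_vec[OF sD.gauge_carrier(1)[of n 0 v H], of "y $ (n - 1) \<cdot>\<^sub>v ?w" y]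
      mult_mat_smult_vec[OF sD.gauge_carrier(1)[of n 0 v H] wc, of "y $ (n - 1)"] yc by simp
  show ?thesis
  proof (rule eq_vecI)
    fix r assume "r < dim_vec (sC (- k) \<cdot>\<^sub>v (?Z0' *\<^sub>v unit_vec n 0))"
    then have r: "r < n" using Zc[of n j v 0] by simp
    have "(?Fk *\<^sub>v y - 0\<^sub>v n) $ r = (?F0 *\<^sub>v (?Z0 *\<^sub>v ?w)
        - sC (- k) \<cdot>\<^sub>v (?Z0' *\<^sub>v unit_vec n 0)) $ r"
      unfolding main ..
    then have m: "(?Fk *\<^sub>v y) $ r = (?F0 *\<^sub>v (?Z0 *\<^sub>v ?w)) $ r
        - sC (- k) * (?Z0' *\<^sub>v unit_vec n 0) $ r"
      using r Zc[of n j v 0] by (simp del: index_mult_mat_vec)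
    have "(?F0 *\<^sub>v (?Z0 *\<^sub>v ?w + (y $ (n - 1) \<cdot>\<^sub>v ?w - y))) $ r =
      (?F0 *\<^sub>v (?Z0 *\<^sub>v ?w)) $ r + y $ (n - 1) * (sC (- k) * unit_vec n 0 $ r) - (?F0 *\<^sub>v y) $ r"
      unfolding dist F0w using r by (simp del: index_mult_mat_vec)
    also have "\<dots> = sC (- k) * (?Z0' *\<^sub>v unit_vec n 0) $ r"
    proof -
      have kk: "sC (- k) = - sC k" by (auto intro: sfun_eqI)
      show ?thesis using m Fky[OF r] r unfolding kk by (simp add: algebra_simps del:
          index_mult_mat_vec split: if_splits)
    qed
    finally show "(?F0 *\<^sub>v (?Z0 *\<^sub>v ?w + (y $ (n - 1) \<cdot>\<^sub>v ?w - y))) $ r =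
        (sC (- k) \<cdot>\<^sub>v (?Z0' *\<^sub>v unit_vec n 0)) $ r"
      using r Zc[of n j v 0] by (simp del: index_mult_mat_vec)
  qed (use Zc[of n j v 0] in auto)
qed

lemma mat_inverse_eq:
  fixes A B :: "real mat"
  assumes "A \<in> carrier_mat n n" "B \<in> carrier_mat n n" "A * B = 1\<^sub>m n" "B * A = 1\<^sub>m n"
  shows "the (mat_inverse A) = B"
proof (cases "mat_inverse A")
  case None
  from mat_inverse(1)[OF assms(1) None, of undefined] show ?thesis
    using assms by (auto simp: Units_def ring_mat_simps)
next
  case (Some C)
  from mat_inverse(2)[OF assms(1) Some] have C: "A * C = 1\<^sub>m n" "C \<in> carrier_mat n n" by auto
  have "C = (B * A) * C" unfolding assms(4) using C by simp
  also have "\<dots> = B * (A * C)" using assms C by (intro assoc_mult_mat[of _ n n _ n _ n]) auto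
  also have "\<dots> = B" unfolding C(1) using assms by simp
  finally show ?thesis using Some by simp
qed

lemma smooth2_det:
  assumes "open T" "\<And>x t. A x t \<in> carrier_mat m m"
    and "\<And>r c. r < m \<Longrightarrow> c < m \<Longrightarrow> smooth2 T (\<lambda>x t. A x t $$ (r, c))"
  shows "smooth2 T (\<lambda>x t. det (A x t))"
proof -
  have "smooth2 T (\<lambda>x t. \<Sum>p\<in>{p. p permutes {0..<m}}. signof p * (\<Prod>i\<in>{0..<m}. A x t $$ (i, p i)))"
    using assms(3) by (intro smooth2_sum smooth2_mult smooth2_prod smooth2_const assms(1)) (auto
        simp: permutes_in_image)
  then show ?thesis using det_def'[OF assms(2)] by simp
qed

lemma mat_mult_unit_vec: "M \<in> carrier_mat n m \<Longrightarrow> i < m \<Longrightarrow> r < n \<Longrightarrow>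
    (M *\<^sub>v unit_vec m i) $ r = (M $$ (r, i) :: 'a::comm_ring_1)"
  by (simp add: scalar_prod_right_unit)

section \<open>The new frame at a fixed time, then the evolution in t\<close>

section \<open>The transformed curve\<close>

lemma (in comm_ring_hom) hom_cofactor:
  assumes "A \<in> carrier_mat n n"
  shows "hom (cofactor A i j) = cofactor (map_mat hom A) i j"
proof -
  have "map_mat hom (mat_delete A i j) = mat_delete (map_mat hom A) i j"
    using assms by (intro eq_matI) (auto simp: mat_delete_def)
  moreover have "hom ((- 1) ^ m) = (- 1) ^ m" for m by (induction m) (auto simp: hom_distribs)
  ultimately show ?thesis by (simp add: cofactor_def hom_mult hom_det[symmetric] del: hom_det)
qed

locale bt_flow =
  fixes n j :: nat and k :: real and T :: "real set" and \<gamma> :: "real \<Rightarrow> real \<Rightarrow> real vec"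
    and h :: "real \<Rightarrow> real \<Rightarrow> real" and d :: "real mat"
  assumes n: "n \<ge> 2" and T: "open T" and sol: "ca_flow_solution n j T \<gamma>" and k: "k \<noteq> 0"
    and d: "d \<in> carrier_mat n n" "det d = (- 1) ^ n * k"
    and BT: "BT_solution n j T (\<lambda>x t. ca_curvature n (\<lambda>y. \<gamma> y t) x) k h"
begin

definition \<Gamma> :: "real \<Rightarrow> nat \<Rightarrow> sfun" where "\<Gamma> t r = Sfun (\<lambda>x. \<gamma> x t $ r)"
definition U :: "real \<Rightarrow> nat \<Rightarrow> sfun" where "U t = curv n (\<Gamma> t)"
definition G :: "real \<Rightarrow> sfun mat" where "G t = sframe n (\<Gamma> t)"
definition H :: "real \<Rightarrow> sfun" where "H t = Sfun (\<lambda>x. h x t)"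
definition W :: "real \<Rightarrow> nat \<Rightarrow> sfun" where "W t = sw n (U t) (H t)"
definition U' :: "real \<Rightarrow> nat \<Rightarrow> sfun" where "U' t = sD.ut n (U t) (W t) (H t)"
definition F0 :: "real \<Rightarrow> sfun mat" where "F0 t = sD.gauge n 0 (U' t) (H t)"
text \<open>The inverse of f at \<lambda> = 0: the constant in front is 1 / det f(0), by
  \<open>det_gauge\<close>.\<close>

definition Fi :: "real \<Rightarrow> sfun mat" where "Fi t = sC (1 / ((- 1) ^ n * k)) \<cdot>\<^sub>m adj_mat (F0 t)"
definition G' :: "real \<Rightarrow> sfun mat" where "G' t = map_mat sC d * G t * Fi t"
definition Z :: "real \<Rightarrow> real \<Rightarrow> sfun mat" where "Z t l = Zs n j (U t) l"

declare d(1) [simp]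

lemma n0: "n > 0" using n by simp

lemma carriers [simp]: "G t \<in> carrier_mat n n" "F0 t \<in> carrier_mat n n" "Fi t \<in> carrier_mat n n"
  "G' t \<in> carrier_mat n n" "Z t l \<in> carrier_mat n n" "map_mat sC d \<in> carrier_mat n n"
proof -
  show 1: "G t \<in> carrier_mat n n" "F0 t \<in> carrier_mat n n" "Z t l \<in> carrier_mat n n"
      "map_mat sC d \<in> carrier_mat n n"
    using d by (auto simp: G_def F0_def Z_def Zs_carrier)
  show 2: "Fi t \<in> carrier_mat n n" unfolding Fi_def using adj_mat(1)[OF 1(2)] by simp
  show "G' t \<in> carrier_mat n n" unfolding G'_def by (intro sq_carrier 1 2)
qed

lemma h_smooth: "smooth2 T h"
  using BT by (simp add: BT_solution_def smooth2_def)

context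
  fixes t assumes t: "t \<in> T"
begin

private lemma curve: "(\<lambda>x. \<gamma> x t) \<in> ca_curves n"
  using sol t by (simp add: ca_flow_solution_def)

lemma \<Gamma>: "r < n \<Longrightarrow> (\<lambda>y. \<gamma> y t $ r) = sapp (\<Gamma> t r)"
  using ca_curve_lift(1)[OF n0 curve] unfolding \<Gamma>_def by blast

lemma frame: "ca_frame n (\<lambda>y. \<gamma> y t) x = evm x (G t)"
  using ca_curve_lift(2)[OF n0 curve] unfolding G_def \<Gamma>_def by blast

lemma det_G: "det (G t) = 1"
  using ca_curve_lift(3)[OF n0 curve] unfolding G_def \<Gamma>_def by blast

lemma G_flat: "map_mat sD (G t) = G t * comp_mat n 0 (U t)"
  using ca_curve_lift(4)[OF n0 curve] unfolding G_def U_def \<Gamma>_def by blast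

lemma curvature: "ca_curvature n (\<lambda>y. \<gamma> y t) = umat n (U t)"
  using ca_curve_lift(5)[OF n0 curve] unfolding U_def \<Gamma>_def by blast

lemma H: "(\<lambda>y. h y t) = sapp (H t)"
  unfolding H_def using smooth2_slice[OF h_smooth t] by (simp add: sapp_Sfun)

lemma bt: "sD.bt n (U t) (W t) (H t) (sC k)"
proof -
  have "deriv (w_fun n (umat n (U t)) (sapp (H t)) 1) x +
      sapp (H t) x * w_fun n (umat n (U t)) (sapp (H t)) 1 x
        + ucoeff n (umat n (U t) x) 1 + k = 0" for x
  proof -
    have "deriv (w_fun n (\<lambda>y. ca_curvature n (\<lambda>y. \<gamma> y t) y) (\<lambda>y. h y t) 1) x
        + h x t * w_fun n (\<lambda>y. ca_curvature n (\<lambda>y. \<gamma> y t) y) (\<lambda>y. h y t) 1 x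
        + ucoeff n (ca_curvature n (\<lambda>y. \<gamma> y t) x) 1 + k = 0"
      using BT t unfolding BT_solution_def by blast
    then show ?thesis unfolding curvature H fun_cong[OF H, of x] .
  qed
  from bt_sw[OF n this] show ?thesis by (simp add: W_def)
qed

lemma h_t: "deriv (\<lambda>s. h x s) t = sapp (- sD ((Z t k *\<^sub>v vec n (W t)) $ (n - 1))) x"
proof -
  have e: "(Z_mat n j (umat n (U t)) k y *\<^sub>v w_vec n (umat n (U t)) (sapp (H t)) y) $ (n - 1)
     = sapp ((Z t k *\<^sub>v vec n (W t)) $ (n - 1)) y" for y
  proof -
    have "Z_mat n j (umat n (U t)) k y *\<^sub>v w_vec n (umat n (U t)) (sapp (H t)) y =
        map_vec (\<lambda>a. sapp a y) (Z t k *\<^sub>v vec n (W t))"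
      unfolding Z_mat_eq[OF n] w_vec_sapp[OF n] W_def Z_def
      by (rule sapp.mult_mat_vec_hom[OF Zs_carrier(1), symmetric]) simp
    then show ?thesis using n Zs_carrier(1)[of n j "U t" k]
        by (simp add: Z_def del: index_mult_mat_vec)
  qed
  have "deriv (\<lambda>s. h x s) t = - deriv (\<lambda>y. (Z_mat n j (\<lambda>z. ca_curvature n (\<lambda>y. \<gamma> y t) z) k y *\<^sub>v
      w_vec n (\<lambda>z. ca_curvature n (\<lambda>y. \<gamma> y t) z) (\<lambda>z. h z t) y) $ (n - 1)) x"
    using BT t unfolding BT_solution_def by blast
  then show ?thesis unfolding curvature H e by simp
qed

lemma f_mat_F0: "f_mat n (umat n (U t)) (sapp (H t)) x 0 = evm x (F0 t)"
  using f_mat_sapp[OF n, of "U t" "H t" x 0] by (simp add: F0_def U'_def W_def)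

lemma F0_inverse: "F0 t * Fi t = 1\<^sub>m n" "Fi t * F0 t = 1\<^sub>m n"
proof -
  let ?c = "sC (1 / ((- 1) ^ n * k))"
  have "det (F0 t) = (- 1) ^ (n - 1) * (0 - sC k)"
    unfolding F0_def U'_def by (rule sD.det_gauge[OF n bt])
  moreover have "sapp ((- 1) ^ m) x = (- 1) ^ m" for m x by (induction m) auto
  ultimately have "?c * det (F0 t) = 1"
    using n k by (intro sfun_eqI) (cases n; simp)
  then have 1: "?c \<cdot>\<^sub>m (det (F0 t) \<cdot>\<^sub>m 1\<^sub>m n) = 1\<^sub>m n"
    by (intro eq_matI) (auto simp: mult.assoc[symmetric])
  show "F0 t * Fi t = 1\<^sub>m n" "Fi t * F0 t = 1\<^sub>m n"
    unfolding Fi_def using adj_mat[OF carriers(2)[of t]] 1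
    by (auto simp: mult_smult_distrib[of _ n n _ n] mult_smult_assoc_mat[of _ n n _ n])
qed

lemma new_frame: "d * evm x (G t) * the (mat_inverse (f_mat n (umat n (U t)) (sapp (H t)) x 0)) =
    evm x (G' t)"
proof -
  have "the (mat_inverse (evm x (F0 t))) = evm x (Fi t)"
    using arg_cong[OF F0_inverse(1), of "evm x"] arg_cong[OF F0_inverse(2), of "evm x"]
    by (intro mat_inverse_eq[of _ n]) (auto simp: sapp.mat_hom_mult[of _ n n _ n] sapp.mat_hom_one)
  moreover have "evm x (map_mat sC d) = d" by (intro eq_matI) auto
  ultimately show ?thesis unfolding f_mat_F0 G'_def
    by (simp add: sapp.mat_hom_mult[of _ n n _ n] sq_carrier)
qed

lemma G'_F0: "G' t * F0 t = map_mat sC d * G t"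
proof -
  have "G' t * F0 t = map_mat sC d * G t * (Fi t * F0 t)"
    unfolding G'_def by (rule sq_simps(1)[of _ n]) (auto simp: sq_carrier)
  then show ?thesis unfolding F0_inverse by (simp add: sq_carrier right_mult_one_mat[of _ n n])
qed

text \<open>The product rule applied to g' f = d g, with f_x from \<open>gauge_flat\<close>;
  cancelling f at the end avoids differentiating its inverse.\<close>

lemma G'_flat: "map_mat sD (G' t) = G' t * comp_mat n 0 (U' t)"
proof -
  let ?D = "map_mat sD"
  have Dd: "?D (map_mat sC d) = 0\<^sub>m n n" using carrier_matD[OF d(1)] by (intro eq_matI) auto
  have c: "?D (G' t) \<in> carrier_mat n n" by simp
  have F: "?D (F0 t) = F0 t * comp_mat n 0 (U t) - comp_mat n 0 (U' t) * F0 t"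
    unfolding F0_def U'_def by (rule sD.gauge_flat[OF n bt]) simp
  have "?D (G' t) * F0 t + G' t * ?D (F0 t) = ?D (G' t * F0 t)"
    by (rule sD.mD_mult[symmetric, of _ n n _ n]) auto
  also have "\<dots> = map_mat sC d * (G t * comp_mat n 0 (U t))"
    unfolding G'_F0 sD.mD_mult[OF carriers(6) carriers(1)] Dd G_flat left_mult_zero_mat[OF
        carriers(1)]
    by (rule left_add_zero_mat) (auto simp: sq_carrier)
  also have "\<dots> = G' t * F0 t * comp_mat n 0 (U t)"
    unfolding G'_F0 by (rule sq_simps(1)[of _ n, symmetric]) auto
  finally have "?D (G' t) * F0 t = G' t * F0 t * comp_mat n 0 (U t) - G' t * ?D (F0 t)"
    by (intro sq_move[of _ n]) (auto simp: sq_carrier)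
  also have "\<dots> = G' t * comp_mat n 0 (U' t) * F0 t"
    unfolding F by (simp add: sq_simps[of _ n] sq_carrier) (intro eq_matI; auto simp del:
        index_mult_mat(1))
  finally have "?D (G' t) * F0 t * Fi t = G' t * comp_mat n 0 (U' t) * F0 t * Fi t" by simp
  then have "?D (G' t) * (F0 t * Fi t) = (G' t * comp_mat n 0 (U' t)) * (F0 t * Fi t)"
    using c by (simp add: sq_simps(1)[of _ n] sq_carrier)
  then show ?thesis unfolding F0_inverse
    using c by (simp add: sq_carrier right_mult_one_mat[of _ n n])
qed

text \<open>The condition on det d is tuned to this: it equals det f(0) = (-1)^n k.\<close>

lemma det_G': "det (evm x (G' t)) = 1"
proof -
  have "det (evm x (G' t)) * det (evm x (F0 t)) = det (evm x (G' t * F0 t))"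
    by (simp add: sapp.mat_hom_mult[of _ n n _ n] det_mult[of _ n])
  also have "\<dots> = det d * 1"
  proof -
    have "evm x (map_mat sC d) = d" by (intro eq_matI) auto
    then show ?thesis unfolding G'_F0 using d det_G
      by (simp add: sapp.mat_hom_mult[of _ n n _ n] det_mult[of _ n])
  qed
  also have "\<dots> = (- 1) ^ n * k" using d by simp
  finally have e: "det (evm x (G' t)) * det (evm x (F0 t)) = (- 1) ^ n * k" .
  have "det (F0 t) = (- 1) ^ (n - 1) * (0 - sC k)"
    unfolding F0_def U'_def by (rule sD.det_gauge[OF n bt])
  moreover have "sapp ((- 1) ^ m) x = (- 1) ^ m" for m x by (induction m) auto
  ultimately have "det (evm x (F0 t)) = (- 1) ^ n * k" using n by (cases n) auto
  with e show ?thesis using k by simp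
qed

lemma G'_columns: "r < n \<Longrightarrow> c < n \<Longrightarrow> G' t $$ (r, c) = (sD ^^ c) (G' t $$ (r, 0))"
proof (induction c)
  case (Suc c)
  have "sD (G' t $$ (r, c)) = map_mat sD (G' t) $$ (r, c)"
      using Suc carrier_matD[OF carriers(4)[of t]] by simp
  also have "\<dots> = G' t $$ (r, Suc c)" unfolding G'_flat
    using Suc by (subst mult_comp_mat_index[of _ n n]) auto
  finally show ?case using Suc by simp
qed simp

lemma G'_sframe: "G' t = sframe n (\<lambda>r. G' t $$ (r, 0))"
proof (rule eq_matI)
  fix r c assume "r < dim_row (sframe n (\<lambda>r. G' t $$ (r, 0)))"
      "c < dim_col (sframe n (\<lambda>r. G' t $$ (r, 0)))"
  then show "G' t $$ (r, c) = sframe n (\<lambda>r. G' t $$ (r, 0)) $$ (r, c)"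
    using G'_columns[of r c] by (simp add: sframe_def)
qed (use carrier_matD[OF carriers(4)[of t]] in auto)

text \<open>From f w = -k e_1 at \<lambda> = 0 one gets d g w = g' f w = -k g' e_1. The inverse of f
  is gone, so this form can be differentiated in t.\<close>

lemma G'_first_column:
  assumes "r < n"
  shows "G' t $$ (r, 0) = sC (- 1 / k) * ((map_mat sC d * G t) *\<^sub>v vec n (W t)) $ r"
proof -
  have w: "vec n (W t) \<in> carrier_vec n" by simp
  have "F0 t *\<^sub>v vec n (W t) = (0 - sC k) \<cdot>\<^sub>v unit_vec n 0"
    unfolding F0_def U'_def by (rule sD.gauge_vec[OF n bt])
  then have "(map_mat sC d * G t) *\<^sub>v vec n (W t) = (0 - sC k) \<cdot>\<^sub>v (G' t *\<^sub>v unit_vec n 0)"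
    unfolding G'_F0[symmetric] assoc_mult_mat_vec[OF carriers(4) carriers(2) w]
    using mult_mat_smult_vec[OF carriers(4), of "unit_vec n 0"] by simp
  then have "((map_mat sC d * G t) *\<^sub>v vec n (W t)) $ r = (0 - sC k) * G' t $$ (r, 0)"
    using assms mat_mult_unit_vec[OF carriers(4) n0 assms, of t] carrier_matD[OF carriers(4)[of
        t]] by (simp del: index_mult_mat_vec)
  then show ?thesis using k by (auto intro!: sfun_eqI)
qed

end

end

section \<open>Joint smoothness in x and t, and the time derivatives of g, u, w and the new
  curve\<close>

context bt_flow begin

lemma \<gamma>_smooth2: "r < n \<Longrightarrow> smooth2 T (\<lambda>x t. (deriv ^^ c) (\<lambda>y. \<gamma> y t $ r) x)"
  using sol by (intro smooth2_dx_iterate[OF T]) (simp add: ca_flow_solution_def smooth2_def)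

lemma G_entry:
  assumes "t \<in> T" "r < n" "c < n"
  shows "sapp (G t $$ (r, c)) x = (deriv ^^ c) (\<lambda>y. \<gamma> y t $ r) x"
  using arg_cong[OF frame[OF assms(1), of x], of "\<lambda>M. M $$ (r, c)"] assms carrier_matD[OF
      carriers(1)[of t]]
  by (simp add: ca_frame_index)

text \<open>The cofactor formula for the curvature is polynomial in x-derivatives of the curve,
  which are jointly smooth.\<close>

lemma U_smooth2:
  assumes r: "r < n"
  shows "smooth2 T (\<lambda>x t. sapp (U t r) x)"
proof (rule smooth2_cong[OF T])
  have "smooth2 T (\<lambda>x t. cofactor (ca_frame n (\<lambda>y. \<gamma> y t) x) i r)" if i: "i < n" for i
    unfolding cofactor_def
  proof (intro smooth2_mult smooth2_const T smooth2_det[where m = "n - 1"])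
    fix a b assume ab: "a < n - 1" "b < n - 1"
    define a' b' where "a' = (if a < i then a else Suc a)" and "b' = (if b < r then b else Suc b)"
    have "a' < n" "b' < n" using ab by (auto simp: a'_def b'_def)
    moreover have "mat_delete (ca_frame n (\<lambda>y. \<gamma> y t) x) i r $$ (a, b) =
        ca_frame n (\<lambda>y. \<gamma> y t) x $$ (a', b')" for x t
      using ab by (simp add: mat_delete_def a'_def b'_def)
    ultimately show "smooth2 T (\<lambda>x t. mat_delete (ca_frame n (\<lambda>y. \<gamma> y t) x) i r $$ (a, b))"
      using \<gamma>_smooth2[of a' b'] by (simp add: ca_frame_index)
  qed (auto simp: mat_delete_def)
  then show "smooth2 T (\<lambda>x t. \<Sum>i<n. cofactor (ca_frame n (\<lambda>y. \<gamma> y t) x) i r *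
      (deriv ^^ n) (\<lambda>y. \<gamma> y t $ i) x)"
    by (intro smooth2_sum smooth2_mult T \<gamma>_smooth2) auto
  fix x t assume t: "t \<in> T"
  show "(\<Sum>i<n. cofactor (ca_frame n (\<lambda>y. \<gamma> y t) x) i r * (deriv ^^ n) (\<lambda>y. \<gamma> y t $ i) x) =
      sapp (U t r) x"
    unfolding U_def curv_def sapp.hom_sum frame[OF t] G_def
    by (intro sum.cong) (auto simp: sapp.hom_cofactor[OF sframe_carrier(1)] \<Gamma>[OF t]
        deriv_iterate_sapp)
qed

lemma H_app: "t \<in> T \<Longrightarrow> sapp (H t) x = h x t"
  using fun_cong[OF H] by simp

lemma W_smooth2: "smooth2 T (\<lambda>x t. sapp (W t r) x)"
proof -
  have hs: "smooth2 T (\<lambda>x t. sapp (H t) x)"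
    by (rule smooth2_cong[OF T h_smooth]) (simp add: H_app)
  have "smooth2 T (\<lambda>x t. sapp (swrev n (U t) (H t) m) x)" if "m < n" for m
    using that
  proof (induction m rule: induct_nat_012)
    case 0
    then show ?case by (simp add: smooth2_const)
  next
    case 1
    then show ?case using smooth2_minus[OF T hs] by simp
  next
    case (ge2 m)
    then have "smooth2 T (\<lambda>x t. sapp (swrev n (U t) (H t) (Suc m)) x)" by simp
    note this smooth2_dx[OF T this]
    moreover have "smooth2 T (\<lambda>x t. sapp (U t (n - Suc (Suc m))) x)"
        using n by (intro U_smooth2) simp
    ultimately show ?case
      using smooth2_diff[OF T smooth2_diff[OF T smooth2_minus[OF T] smooth2_mult[OF T hs]]] by simp
  qed
  then show ?thesis unfolding W_def sw_def using n by simp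
qed

text \<open>One column for all \<lambda>: this lets u_t, found from the curve at \<lambda> = 0, be
  used in the equation for w at \<lambda> = k.\<close>

definition \<theta> :: "real \<Rightarrow> nat \<Rightarrow> sfun" where
  "\<theta> t = (SOME \<theta>. \<forall>l. cov n (U t) (sC l) (Z t l) = last_col n \<theta>)"

lemma cov_Z: "cov n (U t) (sC l) (Z t l) = last_col n (\<theta> t)"
  using someI_ex[OF Zs_flat[OF n, of "U t" j]] unfolding \<theta>_def Z_def by blast

context
  fixes t assumes t: "t \<in> T"
begin

lemma GZ_flat: "map_mat sD (G t * Z t 0) = G t * Z t 0 * comp_mat n 0 (U t) +
    G t * last_col n (\<theta> t)"
proof -
  have flat: "cov n (U t) 0 (Z t 0) = last_col n (\<theta> t)" using cov_Z[of t 0] by simp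
  have "map_mat sD (G t * Z t 0) = map_mat sD (G t) * Z t 0 + G t * map_mat sD (Z t 0)"
    by (rule sD.mD_mult[of _ n n _ n]) auto
  also have "\<dots> = G t * Z t 0 * comp_mat n 0 (U t) + G t * last_col n (\<theta> t)"
    unfolding G_flat[OF t] covD[OF n carriers(5) flat]
    by (simp add: sq_simps[of _ n] sq_carrier)
      (intro eq_matI; auto simp: carrier_matD[OF carriers(5)] carrier_matD[OF carriers(1)] simp
          del: index_mult_mat(1))
  finally show ?thesis .
qed

lemma sD_GZ:
  assumes "r < n" "c < n"
  shows "sD ((G t * Z t 0) $$ (r, c)) = (G t * Z t 0 * comp_mat n 0 (U t)) $$ (r, c) +
      (G t * last_col n (\<theta> t)) $$ (r, c)"
proof -
  have c: "G t * Z t 0 \<in> carrier_mat n n" by (simp add: sq_carrier)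
  have "sD ((G t * Z t 0) $$ (r, c)) = map_mat sD (G t * Z t 0) $$ (r, c)"
    using carrier_matD[OF c] assms by (simp del: index_mult_mat(1))
  then show ?thesis unfolding GZ_flat using assms carrier_matD[OF carriers(1)[of t]]
    by (simp del: index_mult_mat(1))
qed

text \<open>The frame evolves by g_t = g Z(0). The first column is the flow itself; exchanging the
  derivatives moves from column c to c + 1, since the defect g \<theta> in the x-derivative of g Z
  sits in the last column only.\<close>

lemma G_t:
  assumes "r < n" "c < n"
  shows "deriv (\<lambda>s. (deriv ^^ c) (\<lambda>y. \<gamma> y s $ r) x) t = sapp ((G t * Z t 0) $$ (r, c)) x"
  using assms(2)
proof (induction c arbitrary: x)
  case 0
  have "deriv (\<lambda>s. \<gamma> x s $ r) t = vec n (\<lambda>i. deriv (\<lambda>s. \<gamma> x s $ i) t) $ r" using assms by simp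
  also have "\<dots> = (evm x (G t) *\<^sub>v (evm x (Z t 0) *\<^sub>v unit_vec n 0)) $ r"
    using sol t unfolding ca_flow_solution_def by (simp add: frame curvature Z_mat_eq[OF n] Z_def
        del: index_mult_mat_vec)
  also have "evm x (G t) *\<^sub>v (evm x (Z t 0) *\<^sub>v unit_vec n 0) =
      evm x (G t * Z t 0) *\<^sub>v unit_vec n 0"
    by (simp add: sapp.mat_hom_mult[of _ n n _ n] assoc_mult_mat_vec[of _ n n _ n])
  also have "\<dots> $ r = evm x (G t * Z t 0) $$ (r, 0)"
    using assms n by (intro mat_mult_unit_vec[of _ n]) (auto simp: sq_carrier)
  also have "\<dots> = sapp ((G t * Z t 0) $$ (r, 0)) x"
    using assms n carrier_matD[OF carriers(1)[of t]] carrier_matD[OF carriers(5)[of t 0]]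
    by (simp del: index_mult_mat(1))
  finally show ?case by simp
next
  case (Suc c)
  have c: "G t * Z t 0 \<in> carrier_mat n n" by (simp add: sq_carrier)
  let ?F = "\<lambda>x s. (deriv ^^ c) (\<lambda>y. \<gamma> y s $ r) x"
  have "deriv (\<lambda>s. (deriv ^^ Suc c) (\<lambda>y. \<gamma> y s $ r) x) t =
      deriv (\<lambda>s. deriv (\<lambda>y. ?F y s) x) t" by simp
  also have "\<dots> = deriv (\<lambda>y. deriv (\<lambda>s. ?F y s) t) x"
    by (rule smooth2_mixed[OF T t \<gamma>_smooth2[OF assms(1)]])
  also have "(\<lambda>y. deriv (\<lambda>s. ?F y s) t) = sapp ((G t * Z t 0) $$ (r, c))"
    using Suc by (intro ext) simp
  also have "deriv \<dots> x = sapp (sD ((G t * Z t 0) $$ (r, c))) x" by simp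
  also have "\<dots> = sapp ((G t * Z t 0) $$ (r, Suc c)) x"
    using Suc.prems assms(1) unfolding sD_GZ[OF assms(1) Suc_lessD[OF Suc.prems]]
    by (simp add: mult_comp_mat_index[OF c] mult_last_col_index[OF carriers(1)] del:
        index_mult_mat(1))
  finally show ?case .
qed

text \<open>The t-derivative of \<gamma>^(n) is computed twice: from \<gamma>^(n) = \<Sum> u_i
  \<gamma>^(i-1), and as the x-derivative of the last column of g Z(0), where the defect g \<theta>
  now counts. Comparison gives g (u_t - \<theta>) = 0 with g invertible.\<close>

lemma U_t:
  assumes "i < n - 1"
  shows "deriv (\<lambda>s. sapp (U s i) x) t = sapp (\<theta> t i) x"
proof -
  have c: "G t * Z t 0 \<in> carrier_mat n n" by (simp add: sq_carrier)
  define u' where "u' i = deriv (\<lambda>s. sapp (U s i) x) t" for i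
  \<comment> \<open>V_n has only n - 1 coefficients; the entry 0 completes the difference to a
    vector on which g acts.\<close>
  define v where "v = vec n (\<lambda>i. if i < n - 1 then u' i - sapp (\<theta> t i) x else 0)"
  have v: "v \<in> carrier_vec n" by (simp add: v_def)
  have "(evm x (G t) *\<^sub>v v) $ r = 0" if r: "r < n" for r
  proof -
    let ?g = "\<lambda>s i. (deriv ^^ i) (\<lambda>y. \<gamma> y s $ r) x"
    have rel: "(deriv ^^ n) (\<lambda>y. \<gamma> y s $ r) x = (\<Sum>i<n - 1. sapp (U s i) x * ?g s i)" if s: "s \<in> T"
        for s
    proof -
      have "deriv (\<lambda>y. (deriv ^^ (n - 1)) (\<lambda>y. \<gamma> y s $ r) y) x = deriv (sapp (G s $$ (r, n - 1))) x"
        using G_entry[OF s r, of "n - 1"] n by (intro arg_cong[of _ _ "\<lambda>f. deriv f x"]) auto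
      moreover have "(deriv ^^ n) (\<lambda>y. \<gamma> y s $ r) x = deriv (\<lambda>y. (deriv ^^ (n
          - 1)) (\<lambda>y. \<gamma> y s $ r) y) x"
        using n by (cases n) auto
      moreover have "deriv (sapp (G s $$ (r, n - 1))) x = sapp (map_mat sD (G s) $$ (r, n - 1)) x"
        using r n carrier_matD[OF carriers(1)[of s]] by simp
      moreover have "\<dots> = (\<Sum>i<n - 1. sapp (U s i) x * sapp (G s $$ (r, i)) x)"
        unfolding G_flat[OF s] using r n by (subst mult_comp_mat_index[OF carriers(1)]) (auto
            simp: sapp.hom_sum)
      ultimately show ?thesis using G_entry[OF s r] by simp
    qed
    have "((\<lambda>s. \<Sum>i<n - 1. sapp (U s i) x * ?g s i) has_real_derivative
        (\<Sum>i<n - 1. u' i * ?g t i + sapp (U t i) x * sapp ((G t * Z t 0) $$ (r, i)) x)) (at t)"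
    proof (rule DERIV_sum)
      fix i assume "i \<in> {..<n - 1}"
      then have i: "i < n" by simp
      have "((\<lambda>s. ?g s i) has_real_derivative sapp ((G t * Z t 0) $$ (r, i)) x) (at t)"
        using smooth2_has_dt[OF \<gamma>_smooth2[OF r, of i] t, of x] unfolding G_t[OF r i] .
      moreover have "((\<lambda>s. sapp (U s i) x) has_real_derivative u' i) (at t)"
        using smooth2_has_dt[OF U_smooth2[OF i] t, of x] unfolding u'_def .
      ultimately show "((\<lambda>s. sapp (U s i) x * ?g s i) has_real_derivative u' i * ?g t i +
          sapp (U t i) x * sapp ((G t * Z t 0) $$ (r, i)) x) (at t)"
        by (auto intro!: derivative_eq_intros)
    qed
    then have "((\<lambda>s. (deriv ^^ n) (\<lambda>y. \<gamma> y s $ r) x) has_real_derivative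
        (\<Sum>i<n - 1. u' i * ?g t i + sapp (U t i) x * sapp ((G t * Z t 0) $$ (r, i)) x)) (at t)"
      by (rule has_field_derivative_transform_within_open[OF _ T t]) (simp add: rel)
    from DERIV_imp_deriv[OF this]
    have 1: "deriv (\<lambda>s. (deriv ^^ n) (\<lambda>y. \<gamma> y s $ r) x) t =
        (\<Sum>i<n - 1. u' i * ?g t i + sapp (U t i) x * sapp ((G t * Z t 0) $$ (r, i)) x)" .
    let ?F = "\<lambda>x s. (deriv ^^ (n - 1)) (\<lambda>y. \<gamma> y s $ r) x"
    have "deriv (\<lambda>s. (deriv ^^ n) (\<lambda>y. \<gamma> y s $ r) x) t = deriv (\<lambda>s. deriv (\<lambda>y. ?F y s) x) t"
      using n by (cases n) auto
    also have "\<dots> = deriv (\<lambda>y. deriv (\<lambda>s. ?F y s) t) x"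
      by (rule smooth2_mixed[OF T t \<gamma>_smooth2[OF r]])
    also have "(\<lambda>y. deriv (\<lambda>s. ?F y s) t) = sapp ((G t * Z t 0) $$ (r, n - 1))"
      using n by (intro ext G_t[OF r]) simp
    also have "deriv \<dots> x = sapp (sD ((G t * Z t 0) $$ (r, n - 1))) x" by simp
    also have "\<dots> = (\<Sum>i<n - 1. sapp (U t i) x * sapp ((G t * Z t 0) $$ (r, i)) x) +
        (\<Sum>i<n - 1. ?g t i * sapp (\<theta> t i) x)"
    proof -
      have n1: "n - 1 < n" using n by simp
      show ?thesis unfolding sD_GZ[OF r n1] mult_comp_mat_index[OF c r n1] mult_last_col_index[OF
          carriers(1) r n1]
        using G_entry[OF t r] by (simp add: sapp.hom_sum del: index_mult_mat(1))
    qed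
    finally have "(\<Sum>i<n - 1. u' i * ?g t i) = (\<Sum>i<n - 1. ?g t i * sapp (\<theta> t i) x)"
      unfolding 1 sum.distrib by simp
    moreover have "(evm x (G t) *\<^sub>v v) $ r = (\<Sum>i<n. if i < n - 1 then ?g t i * (u' i
        - sapp (\<theta> t i) x) else 0)"
    proof -
      have "(evm x (G t) *\<^sub>v v) $ r = (\<Sum>i<n. sapp (G t $$ (r, i)) x * v $ i)"
        using r v carrier_matD[OF carriers(1)[of t]] by (simp add: scalar_prod_def
            lessThan_atLeast0)
      then show ?thesis using G_entry[OF t r] by (auto simp: v_def intro!: sum.cong)
    qed
    moreover have "(\<Sum>i<n. if i < n - 1 then ?g t i * (u' i - sapp (\<theta> t i) x) else 0) =
        (\<Sum>i<n - 1. ?g t i * (u' i - sapp (\<theta> t i) x))"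
      by (rule sum.mono_neutral_cong_right) auto
    ultimately show ?thesis by (simp add: algebra_simps sum_subtractf)
  qed
  then have 0: "evm x (G t) *\<^sub>v v = 0\<^sub>v n" using carrier_matD[OF carriers(1)[of t]]
      by (intro eq_vecI) (auto simp del: index_mult_mat_vec)
  let ?A = "adj_mat (evm x (G t))"
  have gc: "evm x (G t) \<in> carrier_mat n n" by simp
  have A: "?A \<in> carrier_mat n n" "?A * evm x (G t) = 1\<^sub>m n"
    using adj_mat[OF gc] det_G[OF t] by auto
  have "v = (?A * evm x (G t)) *\<^sub>v v" unfolding A(2) using v by simp
  also have "\<dots> = ?A *\<^sub>v 0\<^sub>v n" using assoc_mult_mat_vec[OF A(1) gc v] 0 by simp
  also have "\<dots> = 0\<^sub>v n" using A(1) by (intro eq_vecI) auto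
  finally have "v $ i = 0" using assms by simp
  then show ?thesis using assms by (simp add: v_def u'_def)
qed

definition "W\<^sub>t = (\<lambda>r. Sfun (\<lambda>x. deriv (\<lambda>s. sapp (W s r) x) t))"

lemma W_t_app: "sapp (W\<^sub>t r) = (\<lambda>x. deriv (\<lambda>s. sapp (W s r) x) t)"
  unfolding W\<^sub>t_def by (intro sapp_Sfun smooth2_slice[OF smooth2_dt[OF T W_smooth2] t])

text \<open>Differentiating the equations of \<open>bt\<close> in t, with u_t = \<theta> and the
  second Baecklund equation for h_t, gives the hypotheses of \<open>w_evolution\<close> at \<lambda>
  = k.\<close>

lemma W_t:
  assumes r: "r < n"
  shows "W\<^sub>t r = (Z t k *\<^sub>v vec n (W t)) $ (n - 1) * W t r - (Z t k *\<^sub>v vec n (W t)) $ r"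
proof (rule w_evolution[OF n bt[OF t] carriers(5) cov_Z refl _ _ r])
  have "sapp (W s (n - 1)) x = 1" if "s \<in> T" for s x using bt[OF that] by (simp add: sD.bt_def)
  then have "((\<lambda>s. sapp (W s (n - 1)) x) has_real_derivative 0) (at t)" for x
    by (intro has_field_derivative_transform_within_open[OF DERIV_const T t]) auto
  from DERIV_imp_deriv[OF this] show "W\<^sub>t (n - 1) = 0" by (intro sfun_eqI) (simp add: W_t_app)
next
  fix r assume r: "r < n"
  let ?Ht = "- sD ((Z t k *\<^sub>v vec n (W t)) $ (n - 1))"
  show "sD (W\<^sub>t r) + (if r = 0 then 0 else W\<^sub>t (r - 1)) + (if r < n - 1 then \<theta> t r else 0)
      + ?Ht * W t r + H t * W\<^sub>t r = 0"
  proof (rule sfun_eqI)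
    fix x
    let ?w = "\<lambda>r x s. sapp (W s r) x"
    have rel: "deriv (\<lambda>y. ?w r y s) x + (if r = 0 then 0 else ?w (r - 1) x s) +
        (if r < n - 1 then sapp (U s r) x else 0) + h x s * ?w r x s
       = (if r = 0 then - k else 0)" if s: "s \<in> T" for s
    proof -
      have "sD (W s r) + (if r = 0 then 0 else W s (r - 1)) + (if r < n - 1 then U s r else 0) +
          H s * W s r = (if r = 0 then - sC k else 0)"
        using bt[OF s] r by (auto simp: sD.bt_def)
      from arg_cong[OF this, of "\<lambda>a. sapp a x"] show ?thesis
          using H_app[OF s] by (auto split: if_splits)
    qed
    have w: "((\<lambda>s. ?w r x s) has_real_derivative sapp (W\<^sub>t r) x) (at t)" for r
      using smooth2_has_dt[OF W_smooth2 t, of r x] unfolding W_t_app .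
    have dw: "((\<lambda>s. deriv (\<lambda>y. ?w r y s) x) has_real_derivative sapp (sD (W\<^sub>t r)) x) (at t)"
      using smooth2_has_dt[OF smooth2_dx[OF T W_smooth2] t, of r x]
      unfolding smooth2_mixed[OF T t W_smooth2] sapp_simps W_t_app .
    have u: "((\<lambda>s. sapp (U s r) x) has_real_derivative sapp (\<theta> t r) x) (at t)" if "r < n - 1"
      using smooth2_has_dt[OF U_smooth2[OF r] t, of x] unfolding U_t[OF that] .
    have hh: "((\<lambda>s. h x s) has_real_derivative sapp ?Ht x) (at t)"
      using smooth2_has_dt[OF h_smooth t, of x] unfolding h_t[OF t] .
    have 1: "((\<lambda>s. if r = 0 then 0 else ?w (r - 1) x s)
        has_real_derivative (if r = 0 then 0 else sapp (W\<^sub>t (r - 1)) x)) (at t)"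
      using w[of "r - 1"] by auto
    have 2: "((\<lambda>s. if r < n - 1 then sapp (U s r) x else 0)
        has_real_derivative (if r < n - 1 then sapp (\<theta> t r) x else 0)) (at t)"
      using u by auto
    have "((\<lambda>s. deriv (\<lambda>y. ?w r y s) x + (if r = 0 then 0 else ?w (r - 1) x s) +
        (if r < n - 1 then sapp (U s r) x else 0) + h x s * ?w r x s)
      has_real_derivative sapp (sD (W\<^sub>t r)) x + (if r = 0 then 0 else sapp (W\<^sub>t (r - 1)) x) +
          (if r < n - 1 then sapp (\<theta> t r) x else 0)
        + (sapp ?Ht x * ?w r x t + sapp (W\<^sub>t r) x * h x t)) (at t)"
      by (intro DERIV_add DERIV_mult dw 1 2 hh w)
    \<comment> \<open>By \<open>rel\<close> the expression keeps the same value on all of the open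
      set T, so its derivative is 0 and uniqueness of derivatives yields the linearized
      equation.\<close>
    moreover have "((\<lambda>s. deriv (\<lambda>y. ?w r y s) x + (if r =
        0 then 0 else ?w (r - 1) x s) + (if r < n - 1 then sapp (U s r) x else 0) +
        h x s * ?w r x s)
      has_real_derivative 0) (at t)"
      by (rule has_field_derivative_transform_within_open[OF DERIV_const[of "if r =
          0 then - k else 0"] T t]) (rule rel[symmetric])
    ultimately have "sapp (sD (W\<^sub>t r)) x + (if r = 0 then 0 else sapp (W\<^sub>t (r - 1)) x) +
        (if r < n - 1 then sapp (\<theta> t r) x else 0)
        + (sapp ?Ht x * ?w r x t + sapp (W\<^sub>t r) x * h x t) = 0"
      by (rule DERIV_unique)
    then show "sapp (sD (W\<^sub>t r) + (if r = 0 then 0 else W\<^sub>t (r - 1)) +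
        (if r < n - 1 then \<theta> t r else 0)
      + ?Ht * W t r + H t * W\<^sub>t r) x = sapp 0 x"
      using H_app[OF t, of x] by (auto simp: algebra_simps split: if_splits)
  qed
qed

end

lemma new_first_column:
  assumes t: "t \<in> T" and r: "r < n"
  shows "sapp (G' t $$ (r, 0)) x = (- 1 / k) * (\<Sum>q<n. d $$ (r, q) *
      (\<Sum>i<n. (deriv ^^ i) (\<lambda>y. \<gamma> y t $ q) x * sapp (W t i) x))"
proof -
  have w: "vec n (W t) \<in> carrier_vec n" by simp
  have "(map_mat sC d * G t) *\<^sub>v vec n (W t) = map_mat sC d *\<^sub>v (G t *\<^sub>v vec n (W t))"
    by (rule assoc_mult_mat_vec[OF carriers(6) carriers(1) w])
  also have "\<dots> $ r = (\<Sum>q<n. sC (d $$ (r, q)) * (\<Sum>i<n. G t $$ (q, i) * W t i))"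
    using r carrier_matD[OF d(1)] carrier_matD[OF carriers(1)[of t]]
        by (simp add: scalar_prod_def lessThan_atLeast0)
  finally show ?thesis unfolding G'_first_column[OF t r]
      using G_entry[OF t] by (simp add: sapp.hom_sum)
qed

text \<open>The derivative is -k^(-1) d g (Z(0) w + w_t). Replacing d g by g' f and applying
  \<open>gauge_w_evolution\<close> cancels the factor -k and leaves g' Z' e_1.\<close>

lemma new_evolution:
  assumes t: "t \<in> T" and r: "r < n"
  shows "((\<lambda>s. sapp (G' s $$ (r, 0)) x) has_real_derivative sapp ((G' t *\<^sub>v (Zs n j (U' t) 0 *\<^sub>v
      unit_vec n 0)) $ r) x) (at t)"
proof -
  let ?g = "\<lambda>q i s. (deriv ^^ i) (\<lambda>y. \<gamma> y s $ q) x"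
  let ?w = "vec n (W t)" and ?y = "Z t k *\<^sub>v vec n (W t)" and ?wt = "vec n (W\<^sub>t t)"
  have c: "G t * Z t 0 \<in> carrier_mat n n" by (simp add: sq_carrier)
  have gd: "((\<lambda>s. ?g q i s) has_real_derivative sapp ((G t * Z t 0) $$ (q, i)) x) (at t)"
      if "q < n" "i < n" for q i
    using smooth2_has_dt[OF \<gamma>_smooth2[OF that(1), of i] t, of x] unfolding G_t[OF t that] .
  have wd: "((\<lambda>s. sapp (W s i) x) has_real_derivative sapp (W\<^sub>t t i) x) (at t)" for i
    using smooth2_has_dt[OF W_smooth2 t, of i x] unfolding W_t_app[OF t] .
  have "((\<lambda>s. (- 1 / k) * (\<Sum>q<n. d $$ (r, q) * (\<Sum>i<n. ?g q i s *
      sapp (W s i) x))) has_real_derivative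
     (- 1 / k) * (\<Sum>q<n. d $$ (r, q) * (\<Sum>i<n. sapp ((G t * Z t 0) $$ (q, i)) x * sapp (W t i) x +
         sapp (W\<^sub>t t i) x * ?g q i t))) (at t)"
    by (intro DERIV_cmult DERIV_sum DERIV_mult gd wd) auto
  then have "((\<lambda>s. sapp (G' s $$ (r, 0)) x) has_real_derivative
     (- 1 / k) * (\<Sum>q<n. d $$ (r, q) * (\<Sum>i<n. sapp ((G t * Z t 0) $$ (q, i)) x * sapp (W t i) x +
         sapp (W\<^sub>t t i) x * ?g q i t))) (at t)"
    by (rule has_field_derivative_transform_within_open[OF _ T t]) (simp add: new_first_column[OF
        _ r])
  moreover have "(- 1 / k) * (\<Sum>q<n. d $$ (r, q) * (\<Sum>i<n. sapp ((G t * Z t 0) $$ (q, i)) x *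
      sapp (W t i) x + sapp (W\<^sub>t t i) x * ?g q i t))
     = sapp ((G' t *\<^sub>v (Zs n j (U' t) 0 *\<^sub>v unit_vec n 0)) $ r) x"
  proof -
    have wc: "?w \<in> carrier_vec n" "?wt \<in> carrier_vec n" "Z t 0 *\<^sub>v ?w \<in> carrier_vec n"
      by (auto intro: mult_mat_vec_carrier[OF carriers(5)])
    have zc: "Zs n j (U' t) 0 *\<^sub>v unit_vec n 0 \<in> carrier_vec n"
      by (intro mult_mat_vec_carrier[OF Zs_carrier(1)]) simp
    have wt: "?wt = ?y $ (n - 1) \<cdot>\<^sub>v ?w - ?y"
      using W_t[OF t] carrier_matD[OF carriers(5)[of t k]]
          by (intro eq_vecI) (auto simp del: index_mult_mat_vec)
    define p where "p = Z t 0 *\<^sub>v ?w + ?wt"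
    have pc: "p \<in> carrier_vec n" using wc by (simp add: p_def)
    have F: "F0 t *\<^sub>v p = sC (- k) \<cdot>\<^sub>v (Zs n j (U' t) 0 *\<^sub>v unit_vec n 0)"
      using gauge_w_evolution[OF n bt[OF t], of j] unfolding p_def wt F0_def U'_def Z_def .
    have "G' t *\<^sub>v (F0 t *\<^sub>v p) = map_mat sC d *\<^sub>v (G t *\<^sub>v p)"
      using assoc_mult_mat_vec[OF carriers(4) carriers(2) pc, of t t] assoc_mult_mat_vec[OF
          carriers(6) carriers(1) pc, of t]
      unfolding G'_F0[OF t] by simp
    then have e: "sC (- k) \<cdot>\<^sub>v (G' t *\<^sub>v (Zs n j (U' t) 0 *\<^sub>v unit_vec n 0)) =
        map_mat sC d *\<^sub>v (G t *\<^sub>v p)"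
      unfolding F mult_mat_smult_vec[OF carriers(4) zc] .
    have Gp: "(G t *\<^sub>v p) $ q = (\<Sum>i<n. (G t * Z t 0) $$ (q, i) * W t i +
        W\<^sub>t t i * G t $$ (q, i))" if q: "q < n" for q
    proof -
      have "G t *\<^sub>v p = (G t * Z t 0) *\<^sub>v ?w + G t *\<^sub>v ?wt"
        unfolding p_def mult_add_distrib_mat_vec[OF carriers(1) wc(3,2)] assoc_mult_mat_vec[OF
            carriers(1) carriers(5) wc(1)] ..
      moreover have "((G t * Z t 0) *\<^sub>v ?w) $ q = (\<Sum>i<n. (G t * Z t 0) $$ (q, i) * W t i)"
        using q carrier_matD[OF c] by (simp add: scalar_prod_def lessThan_atLeast0 row_def del:
            index_mult_mat(1))
      moreover have "(G t *\<^sub>v ?wt) $ q = (\<Sum>i<n. W\<^sub>t t i * G t $$ (q, i))"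
        using q carrier_matD[OF carriers(1)[of t]] by (simp add: scalar_prod_def lessThan_atLeast0
            mult.commute)
      moreover have "((G t * Z t 0) *\<^sub>v ?w + G t *\<^sub>v ?wt) $ q =
          ((G t * Z t 0) *\<^sub>v ?w) $ q + (G t *\<^sub>v ?wt) $ q"
        using q carrier_matD[OF carriers(1)[of t]] by (simp del: index_mult_mat_vec)
      ultimately show ?thesis by (simp only: sum.distrib)
    qed
    have "(map_mat sC d *\<^sub>v (G t *\<^sub>v p)) $ r = (\<Sum>q<n. sC (d $$ (r, q)) * (G t *\<^sub>v p) $ q)"
      using r carrier_matD[OF d(1)] carrier_matD[OF carriers(1)[of t]]
          by (simp add: scalar_prod_def lessThan_atLeast0)
    also have "\<dots> = (\<Sum>q<n. sC (d $$ (r, q)) * (\<Sum>i<n. (G t * Z t 0) $$ (q, i) * W t i +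
        W\<^sub>t t i * G t $$ (q, i)))"
      by (intro sum.cong) (auto simp: Gp simp del: index_mult_mat(1) index_mult_mat_vec)
    finally have 1: "sapp ((map_mat sC d *\<^sub>v (G t *\<^sub>v p)) $ r) x =
        (\<Sum>q<n. d $$ (r, q) * (\<Sum>i<n. sapp ((G t * Z t 0) $$ (q, i)) x * sapp (W t i) x +
        sapp (W\<^sub>t t i) x * ?g q i t))"
      using G_entry[OF t] by (simp add: sapp.hom_sum del: index_mult_mat(1) index_mult_mat_vec)
    have 2: "sapp ((map_mat sC d *\<^sub>v (G t *\<^sub>v p)) $ r) x =
        - k * sapp ((G' t *\<^sub>v (Zs n j (U' t) 0 *\<^sub>v unit_vec n 0)) $ r) x"
      unfolding e[symmetric] using r carrier_matD[OF carriers(4)[of t]]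
          by (simp del: index_mult_mat_vec)
    have "(- 1 / k) * a = b" if "a = - k * b" for a b using that k by simp
    then show ?thesis using trans[OF 1[symmetric] 2] by blast
  qed
  ultimately show ?thesis by simp
qed

lemma new_solution:
  fixes g' :: "real \<Rightarrow> real \<Rightarrow> real mat"
  assumes g': "\<And>x t. t \<in> T \<Longrightarrow> g' x t = evm x (G' t)"
  defines "\<gamma>' \<equiv> \<lambda>x t. g' x t *\<^sub>v unit_vec n 0"
  shows "ca_flow_solution n j T \<gamma>'" "\<And>x t. t \<in> T \<Longrightarrow> g' x t = ca_frame n (\<lambda>y. \<gamma>' y t) x"
proof -
  have entry: "\<gamma>' x t $ r = sapp (G' t $$ (r, 0)) x" if "t \<in> T" "r < n" for x t r
    using mat_mult_unit_vec[of "evm x (G' t)" n n 0 r] that n carrier_matD[OF carriers(4)[of t]]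
    by (simp add: \<gamma>'_def g' del: index_mult_mat_vec)
  have fr: "ca_frame n (\<lambda>y. \<gamma>' y t) x = evm x (G' t)" if t: "t \<in> T" for x t
    using ca_frame_sframe[of n "\<lambda>y. \<gamma>' y t" "\<lambda>r. G' t $$ (r, 0)" x] G'_sframe[OF t] entry[OF t] by
        auto
  show "g' x t = ca_frame n (\<lambda>y. \<gamma>' y t) x" if "t \<in> T" for x t
    using fr g' that by simp
  have cu: "ca_curvature n (\<lambda>y. \<gamma>' y t) = umat n (U' t)" if t: "t \<in> T" for t
  proof (rule ca_curvature_eq[OF carriers(4) _ _ fr[OF t] G'_flat[OF t]])
    have "det (G' t) = 1" using det_G'[OF t] by (intro sfun_eqI) simp
    then show "adj_mat (G' t) \<in> carrier_mat n n" "adj_mat (G' t) * G' t = 1\<^sub>m n"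
      using adj_mat[OF carriers(4)[of t]] by auto
  qed
  \<comment> \<open>The frame has determinant 1, so its first column cannot vanish.\<close>
  have nz: "\<gamma>' x t \<noteq> 0\<^sub>v n" if t: "t \<in> T" for x t
  proof
    assume z: "\<gamma>' x t = 0\<^sub>v n"
    let ?A = "adj_mat (evm x (G' t))"
    have gc: "evm x (G' t) \<in> carrier_mat n n" by simp
    have A: "?A \<in> carrier_mat n n" "?A * evm x (G' t) = 1\<^sub>m n"
      using adj_mat[OF gc] det_G'[OF t] by auto
    have "unit_vec n 0 = (?A * evm x (G' t)) *\<^sub>v unit_vec n 0" unfolding A(2) by simp
    also have "\<dots> = ?A *\<^sub>v \<gamma>' x t"
      using assoc_mult_mat_vec[OF A(1) gc, of "unit_vec n 0"] by (simp add: \<gamma>'_def g'[OF t])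
    also have "\<dots> = 0\<^sub>v n" unfolding z using A(1) by (intro eq_vecI) auto
    finally have "unit_vec n 0 $ 0 = (0\<^sub>v n :: real vec) $ 0" by simp
    then show False using n by simp
  qed
  show "ca_flow_solution n j T \<gamma>'"
    unfolding ca_flow_solution_def
  proof (intro conjI allI impI ballI)
    fix r assume r: "r < n"
    \<comment> \<open>Joint smoothness is read off from the form -k^(-1) d g w, again without the
      inverse of f.\<close>
    have "smooth2 T (\<lambda>x t. (- 1 / k) * (\<Sum>q<n. d $$ (r, q) * (\<Sum>i<n. (deriv ^^ i) (\<lambda>y. \<gamma> y t $ q) x *
        sapp (W t i) x)))"
      by (intro smooth2_mult smooth2_sum smooth2_const T \<gamma>_smooth2 W_smooth2) auto
    then have "smooth2 T (\<lambda>x t. \<gamma>' x t $ r)"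
      by (rule smooth2_cong[OF T]) (simp add: entry[OF _ r] new_first_column[OF _ r])
    then show "smooth_on (UNIV \<times> T) (\<lambda>(x, t). \<gamma>' x t $ r)" by (simp add: smooth2_def)
  next
    fix t assume t: "t \<in> T"
    have "smooth_on UNIV (\<lambda>x. \<gamma>' x t $ r)" if "r < n" for r
      unfolding entry[OF t that] using sapp_smooth by simp
    moreover have "\<gamma>' x t \<in> carrier_vec n" for x
      unfolding \<gamma>'_def g'[OF t] by (intro mult_mat_vec_carrier[of _ n n]) auto
    ultimately show "(\<lambda>x. \<gamma>' x t) \<in> ca_curves n"
      unfolding ca_curves_def using nz[OF t] fr[OF t] det_G'[OF t] by auto
  next
    fix t x assume t: "t \<in> T"
    have "deriv (\<lambda>s. \<gamma>' x s $ r) t = sapp ((G' t *\<^sub>v (Zs n j (U' t) 0 *\<^sub>v unit_vec n 0)) $ r) x"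
        if r: "r < n" for r
      by (intro DERIV_imp_deriv has_field_derivative_transform_within_open[OF new_evolution[OF t
          r] T t])
        (simp add: entry[OF _ r])
    moreover have "evm x (G' t) *\<^sub>v (evm x (Zs n j (U' t) 0) *\<^sub>v unit_vec n 0)
        = map_vec (\<lambda>a. sapp a x) (G' t *\<^sub>v (Zs n j (U' t) 0 *\<^sub>v unit_vec n 0))"
    proof -
      have zc: "Zs n j (U' t) 0 *\<^sub>v unit_vec n 0 \<in> carrier_vec n"
        by (intro mult_mat_vec_carrier[OF Zs_carrier(1)]) simp
      have "map_vec (\<lambda>a. sapp a x) (unit_vec n 0) = unit_vec n 0" by (intro eq_vecI) auto
      then show ?thesis
        using sapp.mult_mat_vec_hom[OF carriers(4) zc] sapp.mult_mat_vec_hom[OF Zs_carrier(1), of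
            "unit_vec n 0"]
        by simp
    qed
    ultimately show "vec n (\<lambda>i. deriv (\<lambda>s. \<gamma>' x s $ i) t) = ca_frame n (\<lambda>y. \<gamma>' y t) x *\<^sub>v
        (Z_mat n j (ca_curvature n (\<lambda>y. \<gamma>' y t)) 0 x *\<^sub>v unit_vec n 0)"
      unfolding fr[OF t] cu[OF t] Z_mat_eq[OF n]
      using carrier_matD[OF carriers(4)[of t]] by (intro eq_vecI) (auto simp del:
          index_mult_mat_vec)
  qed
qed

end

theorem theorem4p2:
  fixes n j :: nat and k :: real and T :: "real set"
    and \<gamma> \<gamma>' :: "real \<Rightarrow> real \<Rightarrow> real vec"
    and g g' u :: "real \<Rightarrow> real \<Rightarrow> real mat"
    and h :: "real \<Rightarrow> real \<Rightarrow> real" and d :: "real mat"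
  assumes n: "n \<ge> 2" and j: "j \<ge> 1" "\<not> n dvd j"
    and T: "open T"
    and \<gamma>: "ca_flow_solution n j T \<gamma>"
    and g: "g = (\<lambda>x t. ca_frame n (\<lambda>y. \<gamma> y t) x)"
    and u: "u = (\<lambda>x t. ca_curvature n (\<lambda>y. \<gamma> y t) x)"
    and k: "k \<noteq> 0"
    and d: "d \<in> carrier_mat n n" "invertible_mat d" "det d = (-1) ^ n * k"
    and h: "BT_solution n j T u k h"
    and g': "g' = (\<lambda>x t. d * g x t * the (mat_inverse (f_mat n (\<lambda>y. u y t) (\<lambda>y. h y t) x 0)))"
    and \<gamma>': "\<gamma>' = (\<lambda>x t. g' x t *\<^sub>v unit_vec n 0)"
  shows "ca_flow_solution n j T \<gamma>' \<and>
         (\<forall>t\<in>T. \<forall>x. g' x t = ca_frame n (\<lambda>y. \<gamma>' y t) x)"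
proof -
  interpret bt_flow n j k T \<gamma> h d
    by unfold_locales (use n T \<gamma> k d h u in auto)
  \<comment> \<open>At a fixed time in T all given data are evaluations of elements of the ring of
    smooth functions.\<close>
  have "g' x t = evm x (G' t)" if t: "t \<in> T" for x t
    using new_frame[OF t, of x] unfolding g' g u frame[OF t] curvature[OF t] H[OF t] .
  from new_solution[of g', OF this] show ?thesis unfolding \<gamma>' by blast
qed

end
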